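(* Let $(M,g)$ be a closed connected Riemannian manifold with complementary orthogonal distributions $D$ and $D^\perp$ of dimensions $n$ and $p$, where $D^\perp$ is integrable with all leaves compact and orientable. Suppose that the leaves of $D^\perp$ compose a fibration $L^\perp\hookrightarrow M\to B$ (i.e. they are the fibers of a fiber bundle $M\to B$), and, if $p>1$, that $d^\perp\theta_{H}=0$, where $H$ is the mean curvature vector field of $D$ with respect to $g$. Suppose that $D$ is umbilical with respect to $g_0=g$. Then $D$ is totally geodesic with respect to $g_\infty$, where $g_\infty$ is the limit as $t\to\infty$ of the metrics $g_t$ solving $$\partial_t g_t=-\frac2n\,(\operatorname{div}^\perp H_t)\,\hat g_t,\qquad g_0=g.$$
   Context: Under the stated hypotheses (without umbilicity) the evolution equation has a unique smooth solution $g_t$, $t\ge0$, among metrics for which $D$ and $D^\perp$ are orthogonal, and $g_t$ converges in the $C^\infty$-topology to a Riemannian metric $g_\infty$. For such a metric $g$, the $D$-truncated metric $\hat g$ is the $(0,2)$-tensor with $\hat g(X,Y)=g(X,Y)$ for $X,Y\in D$ and $\hat g(\xi,\cdot)=0$ for $\xi\in D^\perp$. The second fundamental tensor of $D$ is $b(X,Y)=\frac12(\nabla_XY+\nabla_YX)^\perp$ for $X,Y\in D$ ($\nabla$ the Levi-Civita connection, $(\cdot)^\perp$ the $D^\perp$-component), and the mean curvature vector of $D$ is $H=\operatorname{tr}_g b=\sum_{i\le n} b(e_i,e_i)\in\Gamma(D^\perp)$ ($(e_i)$ a local orthonormal frame of $D$; no factor $1/n$). $H_t$ is the mean curvature vector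 of $D$ with respect to $g_t$. $D$ is umbilical if $n\,b=H\cdot g_{|D}$, and totally geodesic if $b=0$. For $\xi\in\Gamma(D^\perp)$, $\operatorname{div}^\perp\xi=\sum_{\alpha\le p} g(\nabla_{\varepsilon_\alpha}\xi,\varepsilon_\alpha)$ for a local orthonormal frame $(\varepsilon_\alpha)$ of $D^\perp$, and $\theta_\xi$ is the 1-form on $D^\perp$ (along its leaves) dual to $\xi$: $\theta_\xi(\eta)=g(\xi,\eta)$ for $\eta\in D^\perp$. $d^\perp$ is the exterior derivative along the leaves of $D^\perp$. *)

theory Defs
  imports "HOL-Analysis.Analysis"
begin

section \<open>Smooth functions on Euclidean spaces\<close>

primrec iter_dderiv :: "'a list \<Rightarrow> ('a::real_normed_vector \<Rightarrow> 'b::real_normed_vector) \<Rightarrow> 'a \<Rightarrow> 'b" where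
  "iter_dderiv [] f = f"
| "iter_dderiv (v # vs) f = iter_dderiv vs (\<lambda>x. frechet_derivative f (at x) v)"

text \<open>On a set that need not be open, smoothness means local extendability to a function that is
  smooth on an open set. On an open set it is \<open>C\<^sup>\<infinity>\<close> in the usual sense; a function that has iterated
  directional derivatives of all orders which are all Frechet differentiable is \<open>C\<^sup>\<infinity>\<close>.\<close>

definition smooth_on :: "'a::real_normed_vector set \<Rightarrow> ('a \<Rightarrow> 'b::real_normed_vector) \<Rightarrow> bool" where
  "smooth_on S f \<longleftrightarrow> (\<forall>x\<in>S. \<exists>V F. open V \<and> x \<in> V \<and>
     (\<forall>vs. \<forall>y\<in>V. iter_dderiv vs F differentiable (at y)) \<and> (\<forall>y\<in>S \<inter> V. F y = f y))"


section \<open>Smooth manifolds\<close>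

text \<open>A manifold is a whole type with an atlas modelled on a Euclidean space. A chart is a pair of
  its domain and its coordinate map.\<close>

type_synonym ('m, 'e) chart = "'m set \<times> ('m \<Rightarrow> 'e)"

definition is_chart :: "('m::topological_space, 'e::euclidean_space) chart \<Rightarrow> bool" where
  "is_chart c \<longleftrightarrow> open (fst c) \<and> open (snd c ` fst c) \<and>
     (\<exists>\<psi>. homeomorphism (fst c) (snd c ` fst c) (snd c) \<psi>)"

definition cinv :: "('m, 'e) chart \<Rightarrow> 'e \<Rightarrow> 'm" where
  "cinv c = inv_into (fst c) (snd c)"

definition compatible :: "('m::topological_space, 'e::euclidean_space) chart \<Rightarrow> ('m, 'e) chart \<Rightarrow> bool" where
  "compatible c d \<longleftrightarrow> smooth_on (snd c ` (fst c \<inter> fst d)) (snd d \<circ> cinv c) \<and>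
                     smooth_on (snd d ` (fst c \<inter> fst d)) (snd c \<circ> cinv d)"

definition smooth_atlas :: "('m::topological_space, 'e::euclidean_space) chart set \<Rightarrow> bool" where
  "smooth_atlas A \<longleftrightarrow> (\<forall>c\<in>A. is_chart c) \<and> (\<Union>c\<in>A. fst c) = UNIV \<and> (\<forall>c\<in>A. \<forall>d\<in>A. compatible c d)"

definition smooth_chart :: "('m::topological_space, 'e::euclidean_space) chart set \<Rightarrow> ('m, 'e) chart \<Rightarrow> bool" where
  "smooth_chart A c \<longleftrightarrow> is_chart c \<and> (\<forall>d\<in>A. compatible c d)"

definition smooth_map ::
  "('m::topological_space, 'e::euclidean_space) chart set \<Rightarrow> ('n::topological_space, 'f::euclidean_space) chart set
    \<Rightarrow> 'm set \<Rightarrow> ('m \<Rightarrow> 'n) \<Rightarrow> bool" where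
  "smooth_map A C S f \<longleftrightarrow> continuous_on S f \<and>
     (\<forall>c\<in>A. \<forall>d\<in>C. smooth_on (snd c ` (fst c \<inter> S \<inter> f -` fst d)) (snd d \<circ> f \<circ> cinv c))"

definition prod_atlas :: "('b, 'k) chart set \<Rightarrow> ('f, 'l) chart set \<Rightarrow> ('b \<times> 'f, 'k \<times> 'l) chart set" where
  "prod_atlas AB AF = {(fst c \<times> fst d, map_prod (snd c) (snd d)) | c d. c \<in> AB \<and> d \<in> AF}"

definition smooth_fiber_bundle ::
  "('m::topological_space, 'e::euclidean_space) chart set \<Rightarrow> ('b::topological_space, 'k::euclidean_space) chart set
    \<Rightarrow> ('f::topological_space, 'l::euclidean_space) chart set \<Rightarrow> ('m \<Rightarrow> 'b) \<Rightarrow> bool" where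
  "smooth_fiber_bundle A AB AF \<pi> \<longleftrightarrow> surj \<pi> \<and> smooth_map A AB UNIV \<pi> \<and>
     (\<forall>b. \<exists>U \<Psi>. open U \<and> b \<in> U \<and> bij_betw \<Psi> (\<pi> -` U) (U \<times> UNIV) \<and>
        (\<forall>x\<in>\<pi> -` U. fst (\<Psi> x) = \<pi> x) \<and>
        smooth_map A (prod_atlas AB AF) (\<pi> -` U) \<Psi> \<and>
        smooth_map (prod_atlas AB AF) A (U \<times> UNIV) (inv_into (\<pi> -` U) \<Psi>))"


section \<open>Tangent vectors, vector fields, distributions, metrics\<close>

text \<open>The tangent space at \<open>x\<close> is the model space: a vector \<open>u\<close> stands for the tangent vector with
  components \<open>u\<close> in the chart \<open>chart_at A x\<close> chosen once and for all at \<open>x\<close>. Since this choice does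
  not vary continuously with \<open>x\<close>, regularity and derivatives of fields are always expressed through
  their components in one fixed chart \<open>c\<close>: \<open>to_comp A c x\<close> passes from a tangent vector at \<open>x\<close> to its
  components in \<open>c\<close>, and \<open>of_comp A c x\<close> is the inverse map.\<close>

definition chart_at :: "('m, 'e) chart set \<Rightarrow> 'm \<Rightarrow> ('m, 'e) chart" where
  "chart_at A x = (SOME c. c \<in> A \<and> x \<in> fst c)"

definition pos :: "('m, 'e) chart set \<Rightarrow> 'm \<Rightarrow> 'e" where
  "pos A x = snd (chart_at A x) x"

definition to_comp :: "('m, 'e::euclidean_space) chart set \<Rightarrow> ('m, 'e) chart \<Rightarrow> 'm \<Rightarrow> 'e \<Rightarrow> 'e" where
  "to_comp A c x = frechet_derivative (snd c \<circ> cinv (chart_at A x)) (at (pos A x))"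

definition of_comp :: "('m, 'e::euclidean_space) chart set \<Rightarrow> ('m, 'e) chart \<Rightarrow> 'm \<Rightarrow> 'e \<Rightarrow> 'e" where
  "of_comp A c x = frechet_derivative (snd (chart_at A x) \<circ> cinv c) (at (snd c x))"

definition vf_rep :: "('m, 'e::euclidean_space) chart set \<Rightarrow> ('m, 'e) chart \<Rightarrow> ('m \<Rightarrow> 'e) \<Rightarrow> 'e \<Rightarrow> 'e" where
  "vf_rep A c X y = to_comp A c (cinv c y) (X (cinv c y))"

definition smooth_vf :: "('m, 'e::euclidean_space) chart set \<Rightarrow> 'm set \<Rightarrow> ('m \<Rightarrow> 'e) \<Rightarrow> bool" where
  "smooth_vf A U X \<longleftrightarrow> (\<forall>c\<in>A. smooth_on (snd c ` (fst c \<inter> U)) (vf_rep A c X))"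

definition distribution ::
  "('m::topological_space, 'e::euclidean_space) chart set \<Rightarrow> ('m \<Rightarrow> 'e set) \<Rightarrow> nat \<Rightarrow> bool" where
  "distribution A D k \<longleftrightarrow> (\<forall>x. subspace (D x) \<and> dim (D x) = k) \<and>
     (\<forall>x. \<exists>U X. open U \<and> x \<in> U \<and> (\<forall>i<k. smooth_vf A U (X i)) \<and>
        (\<forall>y\<in>U. D y = span ((\<lambda>i. X i y) ` {..<k})))"

definition smooth_section ::
  "('m, 'e::euclidean_space) chart set \<Rightarrow> ('m \<Rightarrow> 'e set) \<Rightarrow> 'm set \<Rightarrow> ('m \<Rightarrow> 'e) \<Rightarrow> bool" where
  "smooth_section A D U X \<longleftrightarrow> smooth_vf A U X \<and> (\<forall>x\<in>U. X x \<in> D x)"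

definition complementary :: "('m \<Rightarrow> 'e::euclidean_space set) \<Rightarrow> ('m \<Rightarrow> 'e set) \<Rightarrow> bool" where
  "complementary D P \<longleftrightarrow> (\<forall>x. D x \<inter> P x = {0} \<and> {u + v | u v. u \<in> D x \<and> v \<in> P x} = UNIV)"

type_synonym ('m, 'e) tensor2 = "'m \<Rightarrow> 'e \<Rightarrow> 'e \<Rightarrow> real"

definition metric_rep ::
  "('m, 'e::euclidean_space) chart set \<Rightarrow> ('m, 'e) chart \<Rightarrow> ('m, 'e) tensor2 \<Rightarrow> 'e \<Rightarrow> 'e \<Rightarrow> 'e \<Rightarrow> real" where
  "metric_rep A c g y u v = g (cinv c y) (of_comp A c (cinv c y) u) (of_comp A c (cinv c y) v)"

definition riemannian_metric :: "('m, 'e::euclidean_space) chart set \<Rightarrow> ('m, 'e) tensor2 \<Rightarrow> bool" where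
  "riemannian_metric A g \<longleftrightarrow>
     (\<forall>x. bilinear (g x) \<and> (\<forall>u v. g x u v = g x v u) \<and> (\<forall>u. u \<noteq> 0 \<longrightarrow> g x u u > 0)) \<and>
     (\<forall>c\<in>A. \<forall>u v. smooth_on (snd c ` fst c) (\<lambda>y. metric_rep A c g y u v))"

definition orthogonal_dists :: "('m, 'e) tensor2 \<Rightarrow> ('m \<Rightarrow> 'e set) \<Rightarrow> ('m \<Rightarrow> 'e set) \<Rightarrow> bool" where
  "orthogonal_dists g D P \<longleftrightarrow> (\<forall>x. \<forall>u\<in>D x. \<forall>v\<in>P x. g x u v = 0)"


section \<open>Integrable distributions and their leaves\<close>

definition flat_chart ::
  "('m::topological_space, 'e::euclidean_space) chart set \<Rightarrow> ('m \<Rightarrow> 'e set) \<Rightarrow> ('m, 'e) chart \<Rightarrow> 'e set \<Rightarrow> bool" where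
  "flat_chart A P c W \<longleftrightarrow> smooth_chart A c \<and> subspace W \<and> (\<forall>x\<in>fst c. to_comp A c x ` P x = W)"

definition integrable_dist ::
  "('m::topological_space, 'e::euclidean_space) chart set \<Rightarrow> ('m \<Rightarrow> 'e set) \<Rightarrow> bool" where
  "integrable_dist A P \<longleftrightarrow> (\<forall>x. \<exists>c W. flat_chart A P c W \<and> x \<in> fst c)"

text \<open>The leaf topology is generated by the plaques of all flat charts (arbitrarily small ones
  included), and the leaves, i.e. the maximal connected integral manifolds, are its components.\<close>

definition leaf_topology ::
  "('m::topological_space, 'e::euclidean_space) chart set \<Rightarrow> ('m \<Rightarrow> 'e set) \<Rightarrow> 'm topology" where
  "leaf_topology A P =
     topology_generated_by {{y \<in> fst c. snd c y - a \<in> W} | c W a. flat_chart A P c W}"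

definition leaves ::
  "('m::topological_space, 'e::euclidean_space) chart set \<Rightarrow> ('m \<Rightarrow> 'e set) \<Rightarrow> 'm set set" where
  "leaves A P = connected_components_of (leaf_topology A P)"

definition nonzero_alternating_form :: "'e::real_vector set \<Rightarrow> nat \<Rightarrow> ((nat \<Rightarrow> 'e) \<Rightarrow> real) \<Rightarrow> bool" where
  "nonzero_alternating_form V p \<omega> \<longleftrightarrow>
     (\<forall>v w. (\<forall>i<p. v i = w i) \<longrightarrow> \<omega> v = \<omega> w) \<and>
     (\<forall>v i a b r. (\<forall>j<p. v j \<in> V) \<and> i < p \<and> a \<in> V \<and> b \<in> V \<longrightarrow>
        \<omega> (v(i := r *\<^sub>R a + b)) = r * \<omega> (v(i := a)) + \<omega> (v(i := b))) \<and>
     (\<forall>v i j. (\<forall>l<p. v l \<in> V) \<and> i < p \<and> j < p \<and> i \<noteq> j \<and> v i = v j \<longrightarrow> \<omega> v = 0) \<and>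
     (\<exists>v. (\<forall>i<p. v i \<in> V) \<and> \<omega> v \<noteq> 0)"

text \<open>A leaf is orientable if it carries a nowhere vanishing continuous top-degree form;
  continuity is with respect to the leaf topology.\<close>

definition orientable_leaf ::
  "('m::topological_space, 'e::euclidean_space) chart set \<Rightarrow> ('m \<Rightarrow> 'e set) \<Rightarrow> nat \<Rightarrow> 'm set \<Rightarrow> bool" where
  "orientable_leaf A P p L \<longleftrightarrow> (\<exists>\<omega>. (\<forall>x\<in>L. nonzero_alternating_form (P x) p (\<omega> x)) \<and>
     (\<forall>U X. open U \<and> (\<forall>i<p. smooth_section A P U (X i)) \<longrightarrow>
        continuous_map (subtopology (leaf_topology A P) (L \<inter> U)) euclideanreal
          (\<lambda>x. \<omega> x (\<lambda>i. X i x))))"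


section \<open>Connection, second fundamental tensor, mean curvature, divergence\<close>

text \<open>Derivatives at \<open>x\<close> are computed in the chart at \<open>x\<close>, where the components of tangent vectors
  at \<open>x\<close> are these vectors themselves.\<close>

definition fun_deriv :: "('m, 'e::euclidean_space) chart set \<Rightarrow> ('m \<Rightarrow> real) \<Rightarrow> 'm \<Rightarrow> 'e \<Rightarrow> real" where
  "fun_deriv A f x u = frechet_derivative (f \<circ> cinv (chart_at A x)) (at (pos A x)) u"

definition vf_deriv :: "('m, 'e::euclidean_space) chart set \<Rightarrow> ('m \<Rightarrow> 'e) \<Rightarrow> 'm \<Rightarrow> 'e \<Rightarrow> 'e" where
  "vf_deriv A Y x u = frechet_derivative (vf_rep A (chart_at A x) Y) (at (pos A x)) u"

definition lie_bracket :: "('m, 'e::euclidean_space) chart set \<Rightarrow> ('m \<Rightarrow> 'e) \<Rightarrow> ('m \<Rightarrow> 'e) \<Rightarrow> 'm \<Rightarrow> 'e" where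
  "lie_bracket A X Y x = vf_deriv A Y x (X x) - vf_deriv A X x (Y x)"

text \<open>The Levi-Civita connection is the torsion-free metric connection. In coordinates it is
  \<open>\<nabla>\<^sub>u Y = dY(u) + \<Gamma>(u, Y)\<close>, torsion-freeness is the symmetry of \<open>\<Gamma>\<close>, and compatibility
  with \<open>g\<close>, tested on the coordinate fields \<open>v\<close> and \<open>w\<close>, is
  \<open>u(g(v,w)) = g(\<Gamma>(u,v),w) + g(v,\<Gamma>(u,w))\<close>.\<close>

definition christoffel :: "('m, 'e::euclidean_space) chart set \<Rightarrow> ('m, 'e) tensor2 \<Rightarrow> 'm \<Rightarrow> 'e \<Rightarrow> 'e \<Rightarrow> 'e" where
  "christoffel A g x = (THE G. bilinear G \<and> (\<forall>u v. G u v = G v u) \<and>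
     (\<forall>u v w. frechet_derivative (\<lambda>y. metric_rep A (chart_at A x) g y v w) (at (pos A x)) u
        = g x (G u v) w + g x v (G u w)))"

definition levi_civita ::
  "('m, 'e::euclidean_space) chart set \<Rightarrow> ('m, 'e) tensor2 \<Rightarrow> ('m \<Rightarrow> 'e) \<Rightarrow> ('m \<Rightarrow> 'e) \<Rightarrow> 'm \<Rightarrow> 'e" where
  "levi_civita A g X Y x = vf_deriv A Y x (X x) + christoffel A g x (X x) (Y x)"

text \<open>Throughout, \<open>P\<close> plays the role of \<open>D\<^sup>\<bottom>\<close>; it is \<open>D\<close>'s orthogonal complement for every metric
  under consideration, so the projection along \<open>D\<close> does not depend on the metric.\<close>

definition perp_part :: "('m \<Rightarrow> 'e::euclidean_space set) \<Rightarrow> ('m \<Rightarrow> 'e set) \<Rightarrow> 'm \<Rightarrow> 'e \<Rightarrow> 'e" where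
  "perp_part D P x u = (THE w. w \<in> P x \<and> u - w \<in> D x)"

definition truncated_metric ::
  "('m \<Rightarrow> 'e::euclidean_space set) \<Rightarrow> ('m \<Rightarrow> 'e set) \<Rightarrow> ('m, 'e) tensor2 \<Rightarrow> ('m, 'e) tensor2" where
  "truncated_metric D P g x u v = g x (u - perp_part D P x u) (v - perp_part D P x v)"

definition second_fund ::
  "('m, 'e::euclidean_space) chart set \<Rightarrow> ('m \<Rightarrow> 'e set) \<Rightarrow> ('m \<Rightarrow> 'e set) \<Rightarrow> ('m, 'e) tensor2
    \<Rightarrow> ('m \<Rightarrow> 'e) \<Rightarrow> ('m \<Rightarrow> 'e) \<Rightarrow> 'm \<Rightarrow> 'e" where
  "second_fund A D P g X Y x =
     (1/2) *\<^sub>R perp_part D P x (levi_civita A g X Y x + levi_civita A g Y X x)"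

definition orthonormal_frame ::
  "('m::topological_space, 'e::euclidean_space) chart set \<Rightarrow> ('m, 'e) tensor2 \<Rightarrow> ('m \<Rightarrow> 'e set) \<Rightarrow> nat
    \<Rightarrow> 'm set \<Rightarrow> (nat \<Rightarrow> 'm \<Rightarrow> 'e) \<Rightarrow> bool" where
  "orthonormal_frame A g D k U e \<longleftrightarrow> open U \<and> (\<forall>i<k. smooth_section A D U (e i)) \<and>
     (\<forall>x\<in>U. \<forall>i<k. \<forall>j<k. g x (e i x) (e j x) = (if i = j then 1 else 0))"

definition frame_at ::
  "('m::topological_space, 'e::euclidean_space) chart set \<Rightarrow> ('m, 'e) tensor2 \<Rightarrow> ('m \<Rightarrow> 'e set) \<Rightarrow> 'm
    \<Rightarrow> nat \<Rightarrow> 'm \<Rightarrow> 'e" where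
  "frame_at A g D x = (SOME e. \<exists>U. x \<in> U \<and> orthonormal_frame A g D (dim (D x)) U e)"

definition mean_curvature ::
  "('m::topological_space, 'e::euclidean_space) chart set \<Rightarrow> ('m \<Rightarrow> 'e set) \<Rightarrow> ('m \<Rightarrow> 'e set) \<Rightarrow> ('m, 'e) tensor2
    \<Rightarrow> 'm \<Rightarrow> 'e" where
  "mean_curvature A D P g x =
     (\<Sum>i<dim (D x). second_fund A D P g (frame_at A g D x i) (frame_at A g D x i) x)"

definition umbilical ::
  "('m::topological_space, 'e::euclidean_space) chart set \<Rightarrow> ('m \<Rightarrow> 'e set) \<Rightarrow> ('m \<Rightarrow> 'e set) \<Rightarrow> ('m, 'e) tensor2
    \<Rightarrow> bool" where
  "umbilical A D P g \<longleftrightarrow> (\<forall>U X Y. open U \<and> smooth_section A D U X \<and> smooth_section A D U Y \<longrightarrow>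
     (\<forall>x\<in>U. real (dim (D x)) *\<^sub>R second_fund A D P g X Y x = g x (X x) (Y x) *\<^sub>R mean_curvature A D P g x))"

definition totally_geodesic ::
  "('m::topological_space, 'e::euclidean_space) chart set \<Rightarrow> ('m \<Rightarrow> 'e set) \<Rightarrow> ('m \<Rightarrow> 'e set) \<Rightarrow> ('m, 'e) tensor2
    \<Rightarrow> bool" where
  "totally_geodesic A D P g \<longleftrightarrow> (\<forall>U X Y. open U \<and> smooth_section A D U X \<and> smooth_section A D U Y \<longrightarrow>
     (\<forall>x\<in>U. second_fund A D P g X Y x = 0))"

definition div_perp ::
  "('m::topological_space, 'e::euclidean_space) chart set \<Rightarrow> ('m \<Rightarrow> 'e set) \<Rightarrow> ('m, 'e) tensor2
    \<Rightarrow> ('m \<Rightarrow> 'e) \<Rightarrow> 'm \<Rightarrow> real" where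
  "div_perp A P g \<xi> x =
     (\<Sum>i<dim (P x). g x (levi_civita A g (frame_at A g P x i) \<xi> x) (frame_at A g P x i x))"

definition dual_form :: "('m, 'e) tensor2 \<Rightarrow> ('m \<Rightarrow> 'e) \<Rightarrow> 'm \<Rightarrow> 'e \<Rightarrow> real" where
  "dual_form g \<xi> x \<eta> = g x (\<xi> x) \<eta>"

definition d_form ::
  "('m, 'e::euclidean_space) chart set \<Rightarrow> ('m \<Rightarrow> 'e \<Rightarrow> real) \<Rightarrow> ('m \<Rightarrow> 'e) \<Rightarrow> ('m \<Rightarrow> 'e) \<Rightarrow> 'm \<Rightarrow> real" where
  "d_form A \<theta> \<eta> \<zeta> x = fun_deriv A (\<lambda>y. \<theta> y (\<zeta> y)) x (\<eta> x) - fun_deriv A (\<lambda>y. \<theta> y (\<eta> y)) x (\<zeta> x)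
     - \<theta> x (lie_bracket A \<eta> \<zeta> x)"

text \<open>The exterior derivative along the leaves only involves vector fields tangent to the leaves.\<close>

definition leafwise_closed ::
  "('m::topological_space, 'e::euclidean_space) chart set \<Rightarrow> ('m \<Rightarrow> 'e set) \<Rightarrow> ('m \<Rightarrow> 'e \<Rightarrow> real) \<Rightarrow> bool" where
  "leafwise_closed A P \<theta> \<longleftrightarrow> (\<forall>U \<eta> \<zeta>. open U \<and> smooth_section A P U \<eta> \<and> smooth_section A P U \<zeta> \<longrightarrow>
     (\<forall>x\<in>U. d_form A \<theta> \<eta> \<zeta> x = 0))"


section \<open>The evolution equation\<close>

definition smooth_metric_family ::
  "('m, 'e::euclidean_space) chart set \<Rightarrow> (real \<Rightarrow> ('m, 'e) tensor2) \<Rightarrow> bool" where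
  "smooth_metric_family A gt \<longleftrightarrow> (\<forall>t\<ge>0. riemannian_metric A (gt t)) \<and>
     (\<forall>c\<in>A. \<forall>u v. smooth_on ({0..} \<times> snd c ` fst c) (\<lambda>(t, y). metric_rep A c (gt t) y u v))"

definition evolution_solution ::
  "('m::topological_space, 'e::euclidean_space) chart set \<Rightarrow> ('m \<Rightarrow> 'e set) \<Rightarrow> ('m \<Rightarrow> 'e set) \<Rightarrow> nat
    \<Rightarrow> (real \<Rightarrow> ('m, 'e) tensor2) \<Rightarrow> bool" where
  "evolution_solution A D P n gt \<longleftrightarrow> smooth_metric_family A gt \<and>
     (\<forall>t\<ge>0. orthogonal_dists (gt t) D P) \<and>
     (\<forall>t\<ge>0. \<forall>x u v. ((\<lambda>s. gt s x u v) has_real_derivative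
        - (2 / real n) * div_perp A P (gt t) (mean_curvature A D P (gt t)) x
          * truncated_metric D P (gt t) x u v) (at t within {0..}))"

text \<open>Convergence in the \<open>C\<^sup>\<infinity>\<close>-topology: in every chart all partial derivatives of the
  components converge uniformly on compact sets.\<close>

definition Cinf_converges ::
  "('m, 'e::euclidean_space) chart set \<Rightarrow> (real \<Rightarrow> ('m, 'e) tensor2) \<Rightarrow> ('m, 'e) tensor2 \<Rightarrow> bool" where
  "Cinf_converges A gt ginf \<longleftrightarrow> (\<forall>c\<in>A. \<forall>K. compact K \<and> K \<subseteq> snd c ` fst c \<longrightarrow>
     (\<forall>vs u v. uniform_limit K (\<lambda>t. iter_dderiv vs (\<lambda>y. metric_rep A c (gt t) y u v))
        (iter_dderiv vs (\<lambda>y. metric_rep A c ginf y u v)) at_top))"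

end

theory Submission
  imports Defs
begin

text \<open>
  Write \<open>P\<close> for \<open>D\<^sup>\<bottom>\<close>. In coordinates in which \<open>P\<close> is a constant subspace, the second fundamental tensor of
  \<open>D\<close> is \<open>-1/2\<close> times the derivative of the metric on \<open>D\<close> in the directions of \<open>P\<close> (\<open>second_fund_flat\<close>). Fix a
  leaf \<open>L\<close>, i.e. the fiber over a point \<open>b\<close> of the base, and a tangent vector \<open>w \<noteq> 0\<close> of the base at \<open>b\<close>. Let
  \<open>q\<^sub>t\<close> be the squared length with respect to \<open>g\<^sub>t\<close> of the lift of \<open>w\<close> to \<open>D\<close>; it is a function on the whole of
  \<open>L\<close>, and this is what the fibration is for. Umbilicity of \<open>D\<close> says that along \<open>L\<close> the mean curvature vector is
  \<open>- (n / 2)\<close> times the gradient of \<open>ln q\<^sub>0\<close>; in particular, the form dual to it is exact on the leaf.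

  The evolution does not change the metric on \<open>P\<close> (\<open>gt_P\<close>), and at each point it multiplies the metric on \<open>D\<close> by
  a number (\<open>gt_D_ratio\<close>). Therefore \<open>H\<^sub>t = - (n / 2) grad (ln q\<^sub>t)\<close> for all \<open>t\<close> (\<open>mean_curvature_q\<close>), and the
  evolution equation becomes the heat equation \<open>\<partial>\<^sub>t (ln q\<^sub>t) = \<Delta> (ln q\<^sub>t)\<close> on \<open>L\<close> for a metric that is constant in
  time. A limit as \<open>t \<rightarrow> \<infinity>\<close> should thus be harmonic on the compact connected manifold \<open>L\<close>, hence constant. This
  is made precise with a strong maximum principle: \<open>q\<^sub>t\<close> satisfies a parabolic differential inequality with
  bounds that are uniform in time (\<open>q_subsolution\<close>), and Hopf's argument is carried out for \<open>q\<^sub>t\<close> with large \<open>t\<close>, so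
  that locally uniform convergence of \<open>q\<^sub>t\<close> is all that is needed (\<open>limit_strong_maximum_principle\<close>). So the
  limit of \<open>q\<^sub>t\<close> is constant on \<open>L\<close> for every \<open>w\<close> (\<open>limit_length_constant\<close>), i.e. the derivative of the limit
  metric on \<open>D\<close> in the directions of \<open>P\<close> vanishes, and \<open>D\<close> is totally geodesic (\<open>limit_totally_geodesic\<close>).

  Three facts make the computation in adapted coordinates legitimate. The Levi-Civita connection, which
  is defined in a chart that changes with the point, has the usual form in every smooth chart
  (\<open>levi_civita_in_chart\<close>). Mean curvature and divergence are traces over local orthonormal frames, which
  exist by the Gram-Schmidt process (\<open>frame_at\<close>). Plaques are connected in the leaf topology and lie in the
  fibers (\<open>plaque_in_fiber\<close>), and the differential of the projection is onto (\<open>dproj_surj\<close>), so that by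
  dimension \<open>D\<close> projects isomorphically to the base.
\<close>

section \<open>Calculus of smooth functions\<close>

lemma frechet_derivative_cong_open:
  assumes "open S" "x \<in> S" "\<And>y. y \<in> S \<Longrightarrow> f y = g y"
  shows "frechet_derivative f (at x) = frechet_derivative g (at x)"
proof -
  have "(f has_derivative D) (at x) \<longleftrightarrow> (g has_derivative D) (at x)" for D
    using has_derivative_transform_within_open[of f D x UNIV S g]
      has_derivative_transform_within_open[of g D x UNIV S f] assms by auto
  then show ?thesis unfolding frechet_derivative_def by simp
qed

lemma frechet_derivativeI: "(f has_derivative D) (at x) \<Longrightarrow> frechet_derivative f (at x) = D"
  using frechet_derivative_at by metis

lemma differentiable_cong_open:
  assumes "open S" "x \<in> S" "\<And>y. y \<in> S \<Longrightarrow> f y = g y"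
  shows "f differentiable (at x) \<longleftrightarrow> g differentiable (at x)"
  using has_derivative_transform_within_open[of f _ x UNIV S g]
      has_derivative_transform_within_open[of g _ x UNIV S f] assms
  unfolding differentiable_def by (metis (no_types, lifting))

lemma iter_dderiv_cong_open:
  assumes "open S" "\<And>y. y \<in> S \<Longrightarrow> f y = g y" "x \<in> S"
  shows "iter_dderiv vs f x = iter_dderiv vs g x"
  using assms(2,3)
proof (induction vs arbitrary: f g x)
  case (Cons v vs)
  have "frechet_derivative f (at y) v = frechet_derivative g (at y) v" if "y \<in> S" for y
    using frechet_derivative_cong_open[OF assms(1) that Cons.prems(1)] by simp
  from Cons.IH[OF this Cons.prems(2)] show ?case by simp
qed simp

lemma smooth_onE:
  assumes "smooth_on S f" "x \<in> S"
  obtains V F where "open V" "x \<in> V" "\<forall>vs. \<forall>y\<in>V. iter_dderiv vs F differentiable (at y)"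
    "\<forall>y\<in>S \<inter> V. F y = f y"
  using bspec[OF assms(1)[unfolded smooth_on_def] assms(2)] by (elim exE conjE) (rule that)

lemma smooth_onI:
  assumes "\<And>x. x \<in> S \<Longrightarrow> \<exists>V F. open V \<and> x \<in> V \<and>
    (\<forall>vs. \<forall>y\<in>V. iter_dderiv vs F differentiable (at y)) \<and> (\<forall>y\<in>S \<inter> V. F y = f y)"
  shows "smooth_on S f"
  unfolding smooth_on_def by (rule ballI) (rule assms)

text \<open>On an open set the local extensions in the definition agree with the function itself, so they
  have the same iterated derivatives.\<close>

lemma smooth_on_open_iff:
  assumes "open S"
  shows "smooth_on S f \<longleftrightarrow> (\<forall>vs. \<forall>y\<in>S. iter_dderiv vs f differentiable (at y))"
proof
  assume f: "smooth_on S f"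
  show "\<forall>vs. \<forall>y\<in>S. iter_dderiv vs f differentiable (at y)"
  proof (intro allI ballI)
    fix vs y assume "y \<in> S"
    then obtain V F where VF: "open V" "y \<in> V" "\<forall>vs. \<forall>y\<in>V. iter_dderiv vs F differentiable (at y)"
      "\<forall>y\<in>S \<inter> V. F y = f y"
      by (rule smooth_onE[OF f])
    have "iter_dderiv vs F z = iter_dderiv vs f z" if "z \<in> S \<inter> V" for z
      by (rule iter_dderiv_cong_open[of "S \<inter> V"]) (use VF assms that in auto)
    then show "iter_dderiv vs f differentiable (at y)"
      using differentiable_cong_open[of "S \<inter> V" y "iter_dderiv vs F" "iter_dderiv vs f"] VF assms \<open>y \<in> S\<close>
      by auto
  qed
next
  assume "\<forall>vs. \<forall>y\<in>S. iter_dderiv vs f differentiable (at y)"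
  then show "smooth_on S f" by (intro smooth_onI exI[of _ S] exI[of _ f]) (use assms in auto)
qed

lemma smooth_on_local:
  assumes "\<And>x. x \<in> S \<Longrightarrow> \<exists>V. open V \<and> x \<in> V \<and> smooth_on (S \<inter> V) f"
  shows "smooth_on S f"
proof (rule smooth_onI)
  fix x assume "x \<in> S"
  then obtain V where V: "open V" "x \<in> V" "smooth_on (S \<inter> V) f" using assms by blast
  have "x \<in> S \<inter> V" using V \<open>x \<in> S\<close> by simp
  from smooth_onE[OF V(3) this]
  obtain V' F where F: "open V'" "x \<in> V'" "\<forall>vs. \<forall>y\<in>V'. iter_dderiv vs F differentiable (at y)"
    "\<forall>y\<in>S \<inter> V \<inter> V'. F y = f y" .
  show "\<exists>V F. open V \<and> x \<in> V \<and> (\<forall>vs. \<forall>y\<in>V. iter_dderiv vs F differentiable at y) \<and> (\<forall>y\<in>S \<inter> V. F y = f y)"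
    by (rule exI[of _ "V \<inter> V'"], rule exI[of _ F]) (use V F in auto)
qed

lemma smooth_on_subset:
  assumes "smooth_on S f" "T \<subseteq> S" shows "smooth_on T f"
proof (rule smooth_onI)
  fix x assume x: "x \<in> T"
  obtain V F where F: "open V" "x \<in> V" "\<forall>vs. \<forall>y\<in>V. iter_dderiv vs F differentiable (at y)"
    "\<forall>y\<in>S \<inter> V. F y = f y" using smooth_onE[OF assms(1) subsetD[OF assms(2) x]] .
  show "\<exists>V F. open V \<and> x \<in> V \<and> (\<forall>vs. \<forall>y\<in>V. iter_dderiv vs F differentiable at y) \<and> (\<forall>y\<in>T \<inter> V. F y = f y)"
    by (rule exI[of _ V], rule exI[of _ F]) (use F assms(2) in auto)
qed

lemma smooth_on_cong:
  assumes "\<And>x. x \<in> S \<Longrightarrow> f x = g x" shows "smooth_on S f \<longleftrightarrow> smooth_on S g"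
proof -
  have "(\<forall>y\<in>S \<inter> V. F y = f y) \<longleftrightarrow> (\<forall>y\<in>S \<inter> V. F y = g y)" for V F using assms by simp
  then show ?thesis unfolding smooth_on_def by simp
qed

lemma smooth_on_differentiable: "open S \<Longrightarrow> smooth_on S f \<Longrightarrow> x \<in> S \<Longrightarrow> f differentiable (at x)"
  unfolding smooth_on_open_iff by (metis iter_dderiv.simps(1))

lemma smooth_on_has_derivative:
  "open S \<Longrightarrow> smooth_on S f \<Longrightarrow> x \<in> S \<Longrightarrow> (f has_derivative frechet_derivative f (at x)) (at x)"
  using smooth_on_differentiable frechet_derivative_works by blast

lemma smooth_on_imp_continuous_on: "smooth_on S f \<Longrightarrow> continuous_on S f"
proof -
  assume f: "smooth_on S f"
  show "continuous_on S f" unfolding continuous_on_eq_continuous_within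
  proof
    fix x assume x: "x \<in> S"
    then obtain V F where VF: "open V" "x \<in> V" "\<forall>vs. \<forall>y\<in>V. iter_dderiv vs F differentiable (at y)"
      "\<forall>y\<in>S \<inter> V. F y = f y"
      by (rule smooth_onE[OF f])
    have "F differentiable (at x)" using VF(3)[rule_format, of x "[]"] VF(2) by simp
    then have "continuous (at x within S) F"
      using differentiable_imp_continuous_within continuous_at_imp_continuous_at_within by blast
    moreover obtain d where "d > 0" "ball x d \<subseteq> V" using VF(1,2) openE by blast
    moreover have "F y = f y" if "y \<in> S" "dist y x < d" for y
      using that VF(4) calculation(3) by (auto simp: dist_commute)
    ultimately show "continuous (at x within S) f"
      using continuous_transform_within[of x S F d f] x by blast
  qed
qed

lemma smooth_on_deriv:
  assumes "open S" "smooth_on S f"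
  shows "smooth_on S (\<lambda>x. frechet_derivative f (at x) v)"
  using assms unfolding smooth_on_open_iff[OF assms(1)] by (metis iter_dderiv.simps(2))

inductive add_closure :: "('a \<Rightarrow> 'b::real_normed_vector) set \<Rightarrow> ('a \<Rightarrow> 'b) \<Rightarrow> bool" for R where
  zero: "add_closure R (\<lambda>x. 0)"
| base: "f \<in> R \<Longrightarrow> add_closure R f"
| add: "add_closure R f \<Longrightarrow> add_closure R g \<Longrightarrow> add_closure R (\<lambda>x. f x + g x)"

lemma add_closure_sum: "finite I \<Longrightarrow> (\<And>i. i \<in> I \<Longrightarrow> add_closure R (f i)) \<Longrightarrow> add_closure R (\<lambda>x. \<Sum>i\<in>I. f i x)"
  by (induction rule: finite_induct) (auto intro: add_closure.intros)

text \<open>Coinduction up to sums. The derivatives of a product, of a power or of a composition are sums of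
  terms of the same shape, so for the closure properties of smooth functions it suffices to name
  that shape and to differentiate one term.\<close>

lemma smooth_on_coinduct:
  fixes R :: "('a::real_normed_vector \<Rightarrow> 'b::real_normed_vector) set"
  assumes S: "open S" and f: "add_closure R f"
    and R: "\<And>f x v. f \<in> R \<Longrightarrow> x \<in> S \<Longrightarrow> f differentiable (at x)"
      "\<And>f v. f \<in> R \<Longrightarrow> \<exists>h. add_closure R h \<and> (\<forall>x\<in>S. frechet_derivative f (at x) v = h x)"
  shows "smooth_on S f"
proof -
  have diff: "h differentiable (at x)" if "add_closure R h" "x \<in> S" for h x
    using that by (induction rule: add_closure.induct) (auto intro: R differentiable_add)
  have deriv: "\<exists>k. add_closure R k \<and> (\<forall>x\<in>S. frechet_derivative h (at x) v = k x)" if "add_closure R h" for h v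
    using that
  proof (induction rule: add_closure.induct)
    case zero
    then show ?case by (intro exI[of _ "\<lambda>x. 0"]) (auto intro: add_closure.zero simp: frechet_derivative_const)
  next
    case (base f)
    then show ?case using R(2) by blast
  next
    case (add f g)
    then obtain k l where kl: "add_closure R k" "add_closure R l" 
      "\<forall>x\<in>S. frechet_derivative f (at x) v = k x" "\<forall>x\<in>S. frechet_derivative g (at x) v = l x" by blast
    have "frechet_derivative (\<lambda>x. f x + g x) (at x) v = k x + l x" if "x \<in> S" for x
    proof -
      have "((\<lambda>x. f x + g x) has_derivative (\<lambda>v. frechet_derivative f (at x) v + frechet_derivative g (at x) v)) (at x)"
        by (intro has_derivative_add) (use diff add that frechet_derivative_works in blast)+
      from frechet_derivativeI[OF this] show ?thesis using kl(3,4) that by simp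
    qed
    then show ?case by (intro exI[of _ "\<lambda>x. k x + l x"] conjI add_closure.add kl) auto
  qed
  have "\<forall>x\<in>S. iter_dderiv vs h differentiable (at x)" if "add_closure R h" for h vs
    using that
  proof (induction vs arbitrary: h)
    case Nil
    then show ?case using diff by simp
  next
    case (Cons v vs)
    from deriv[OF Cons.prems] obtain k where k: "add_closure R k" "\<forall>x\<in>S. frechet_derivative h (at x) v = k x" by blast
    have e: "iter_dderiv vs (\<lambda>x. frechet_derivative h (at x) v) x = iter_dderiv vs k x" if "x \<in> S" for x
      by (rule iter_dderiv_cong_open[OF S]) (use k that in auto)
    show ?case
    proof
      fix x assume x: "x \<in> S"
      then show "iter_dderiv (v # vs) h differentiable at x"
        using Cons.IH[OF k(1)] differentiable_cong_open[OF S x e] by simp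
    qed
  qed
  then show ?thesis using f S by (simp add: smooth_on_open_iff)
qed

lemma smooth_on_const [simp]: "open S \<Longrightarrow> smooth_on S (\<lambda>x. c)"
  by (rule smooth_on_coinduct[where R="{h. \<exists>c. h = (\<lambda>x. c)}"]) 
     (auto intro!: exI[of _ "\<lambda>x. 0"] add_closure.zero intro: add_closure.base simp: frechet_derivative_const)

lemma smooth_on_add:
  assumes S: "open S" and fg: "smooth_on S f" "smooth_on S g"
  shows "smooth_on S (\<lambda>x. f x + g x)"
proof (rule smooth_on_coinduct[OF S, where R="{f. smooth_on S f}"])
  show "add_closure {f. smooth_on S f} (\<lambda>x. f x + g x)"
    using fg by (intro add_closure.add add_closure.base) auto
  show "\<exists>k. add_closure {f. smooth_on S f} k \<and> (\<forall>x\<in>S. frechet_derivative h (at x) v = k x)"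
    if "h \<in> {f. smooth_on S f}" for h :: "'a \<Rightarrow> 'b" and v
    by (rule exI[of _ "\<lambda>x. frechet_derivative h (at x) v"])
       (use that smooth_on_deriv[OF S] in \<open>auto intro: add_closure.base\<close>)
qed (use smooth_on_differentiable[OF S] in auto)

lemma smooth_on_sum:
  assumes "open S" "finite I" "\<And>i. i \<in> I \<Longrightarrow> smooth_on S (f i)"
  shows "smooth_on S (\<lambda>x. \<Sum>i\<in>I. f i x)"
  using assms(2,3) by (induction rule: finite_induct) (auto simp: assms(1) intro: smooth_on_add)

lemma (in bounded_bilinear) smooth_on:
  assumes S: "open S" and fg: "smooth_on S f" "smooth_on S g"
  shows "smooth_on S (\<lambda>x. prod (f x) (g x))"
proof -
  let ?R = "{\<lambda>x. prod (f x) (g x) | f g. smooth_on S f \<and> smooth_on S g}"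
  have D: "((\<lambda>x. prod (f x) (g x)) has_derivative (\<lambda>v. prod (f x) (frechet_derivative g (at x) v) + prod (frechet_derivative f (at x) v) (g x))) (at x)"
    if "smooth_on S f" "smooth_on S g" "x \<in> S" for x f g
    by (intro FDERIV smooth_on_has_derivative[OF S] that)
  have RI: "(\<lambda>x. prod (f x) (g x)) \<in> ?R" if "smooth_on S f" "smooth_on S g" for f g
    by (intro CollectI exI conjI) (rule refl that)+
  show ?thesis
  proof (rule smooth_on_coinduct[OF S, where R="?R"])
    show "h differentiable (at x)" if h: "h \<in> ?R" and x: "x \<in> S" for h x
    proof -
      from h obtain f g where "h = (\<lambda>x. prod (f x) (g x))" "smooth_on S f" "smooth_on S g" by auto
      then show ?thesis using D[OF _ _ x, of f g] differentiableI by simp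
    qed
    show "\<exists>k. add_closure ?R k \<and> (\<forall>x\<in>S. frechet_derivative h (at x) v = k x)"
      if "h \<in> ?R" for h v
    proof -
      from that obtain f g where h: "h = (\<lambda>x. prod (f x) (g x))" "smooth_on S f" "smooth_on S g" by auto
      have "add_closure ?R (\<lambda>x. prod (f x) (frechet_derivative g (at x) v) + prod (frechet_derivative f (at x) v) (g x))"
      proof (rule add_closure.add; rule add_closure.base)
        show "(\<lambda>x. prod (f x) (frechet_derivative g (at x) v)) \<in> ?R" by (intro RI h smooth_on_deriv[OF S])
        show "(\<lambda>x. prod (frechet_derivative f (at x) v) (g x)) \<in> ?R" by (intro RI h smooth_on_deriv[OF S])
      qed
      moreover note frechet_derivativeI[OF D[OF h(2,3)]]
      ultimately show ?thesis unfolding h(1) by (intro exI conjI ballI) (assumption, simp)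
    qed
  qed (intro add_closure.base RI fg)
qed

lemmas smooth_on_scaleR = bounded_bilinear.smooth_on[OF bounded_bilinear_scaleR]
lemmas smooth_on_mult = bounded_bilinear.smooth_on[OF bounded_bilinear_mult]

lemma smooth_on_inner_const: "open S \<Longrightarrow> smooth_on S f \<Longrightarrow> smooth_on S (\<lambda>x. f x \<bullet> c)"
  by (rule bounded_bilinear.smooth_on[OF bounded_bilinear_inner]) auto

lemma smooth_on_diff:
  assumes "open S" "smooth_on S f" "smooth_on S g" shows "smooth_on S (\<lambda>x. f x - g x)"
  using smooth_on_add[OF assms(1,2) smooth_on_scaleR[OF assms(1) smooth_on_const[OF assms(1), of "-1"] assms(3)]] by simp

text \<open>Used with exponent \<open>-1/2\<close> to normalise vector fields and with \<open>-1\<close> to divide.\<close>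

lemma smooth_on_powr:
  fixes f :: "'a::real_normed_vector \<Rightarrow> real"
  assumes S: "open S" and f: "smooth_on S f" and pos: "\<And>x. x \<in> S \<Longrightarrow> f x > 0"
  shows "smooth_on S (\<lambda>x. f x powr a)"
proof -
  let ?R = "{\<lambda>x. g x * f x powr a | g a. smooth_on S g}"
  have D: "((\<lambda>x. g x * f x powr a) has_derivative (\<lambda>v. frechet_derivative g (at x) v * f x powr a + 
       (a * g x * frechet_derivative f (at x) v) * f x powr (a - 1))) (at x)"
    if "smooth_on S g" "x \<in> S" for x g a
  proof -
    note fd = smooth_on_has_derivative[OF S f that(2)]
    have "((\<lambda>y. f y powr a) has_derivative (\<lambda>v. (a * f x powr (a - 1)) * frechet_derivative f (at x) v)) (at x)"
      using DERIV_compose_FDERIV[OF has_real_derivative_powr[OF pos[OF that(2)]] fd] by (simp add: ac_simps)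
    from has_derivative_mult[OF smooth_on_has_derivative[OF S that] this] show ?thesis
      by (rule has_derivative_eq_rhs) (auto simp: algebra_simps)
  qed
  have RI: "(\<lambda>x. g x * f x powr a) \<in> ?R" if "smooth_on S g" for g a
    by (intro CollectI exI conjI) (rule refl that)+
  have "smooth_on S (\<lambda>x. 1 * f x powr a)"
  proof (rule smooth_on_coinduct[OF S, where R="?R"])
    show "h differentiable (at x)" if h: "h \<in> ?R" and x: "x \<in> S" for h x
    proof -
      from h obtain g a where "h = (\<lambda>x. g x * f x powr a)" "smooth_on S g" by auto
      then show ?thesis using D[OF _ x, of g a] differentiableI by simp
    qed
    show "\<exists>k. add_closure ?R k \<and> (\<forall>x\<in>S. frechet_derivative h (at x) v = k x)"
      if "h \<in> ?R" for h v
    proof -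
      from that obtain g a where h: "h = (\<lambda>x. g x * f x powr a)" "smooth_on S g" by auto
      have "add_closure ?R (\<lambda>x. frechet_derivative g (at x) v * f x powr a + 
         (a * g x * frechet_derivative f (at x) v) * f x powr (a - 1))"
      proof (rule add_closure.add; rule add_closure.base)
        show "(\<lambda>x. frechet_derivative g (at x) v * f x powr a) \<in> ?R" by (intro RI smooth_on_deriv[OF S] h)
        have "smooth_on S (\<lambda>x. a * g x * frechet_derivative f (at x) v)"
          by (intro smooth_on_mult[OF S] smooth_on_deriv[OF S] f h smooth_on_const S)
        then show "(\<lambda>x. (a * g x * frechet_derivative f (at x) v) * f x powr (a - 1)) \<in> ?R" by (rule RI)
      qed
      moreover note frechet_derivativeI[OF D[OF h(2)]]
      ultimately show ?thesis unfolding h(1) by (intro exI conjI ballI) (assumption, simp)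
    qed
  next
    have "smooth_on S (\<lambda>x. 1::real)" using S by simp
    then show "add_closure ?R (\<lambda>x. 1 * f x powr a)" by (intro add_closure.base RI)
  qed
  then show ?thesis by simp
qed

lemma linear_basis_sum: "linear f \<Longrightarrow> f (x::'a::euclidean_space) = (\<Sum>b\<in>Basis. (x \<bullet> b) *\<^sub>R f b)"
  by (metis (no_types, lifting) euclidean_representation linear_scale linear_sum sum.cong)

lemma smooth_on_compose:
  fixes f :: "'b::euclidean_space \<Rightarrow> 'c::real_normed_vector"
  assumes S: "open S" and T: "open T" and f: "smooth_on T f" and k: "smooth_on S k" and kS: "k ` S \<subseteq> T"
  shows "smooth_on S (\<lambda>x. f (k x))"
proof -
  let ?R = "{\<lambda>x. g x *\<^sub>R f (k x) | g (f :: 'b \<Rightarrow> 'c). smooth_on S g \<and> smooth_on T f}"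
  have D: "((\<lambda>x. g x *\<^sub>R f (k x)) has_derivative (\<lambda>v. g x *\<^sub>R frechet_derivative f (at (k x)) (frechet_derivative k (at x) v)
        + frechet_derivative g (at x) v *\<^sub>R f (k x))) (at x)"
    if "smooth_on S g" "smooth_on T f" "x \<in> S" for x g and f :: "'b \<Rightarrow> 'c"
    by (intro has_derivative_scaleR has_derivative_compose[of k _ x UNIV f] smooth_on_has_derivative[OF S] smooth_on_has_derivative[OF T] that k)
       (use that kS in auto)
  have RI: "(\<lambda>x. g x *\<^sub>R f (k x)) \<in> ?R" if "smooth_on S g" "smooth_on T f" for g and f :: "'b \<Rightarrow> 'c"
    by (intro CollectI exI conjI) (rule refl that)+
  have "smooth_on S (\<lambda>x. 1 *\<^sub>R f (k x))"
  proof (rule smooth_on_coinduct[OF S, where R="?R"])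
    show "h differentiable (at x)" if h: "h \<in> ?R" and x: "x \<in> S" for h x
    proof -
      from h obtain g and f :: "'b \<Rightarrow> 'c" where "h = (\<lambda>x. g x *\<^sub>R f (k x))" "smooth_on S g" "smooth_on T f" by auto
      then show ?thesis using D[OF _ _ x, of g f] differentiableI by simp
    qed
    show "\<exists>k. add_closure ?R k \<and> (\<forall>x\<in>S. frechet_derivative h (at x) v = k x)"
      if "h \<in> ?R" for h v
    proof -
      from that obtain g and f :: "'b \<Rightarrow> 'c" where h: "h = (\<lambda>x. g x *\<^sub>R f (k x))" "smooth_on S g" "smooth_on T f" by auto
      have "add_closure ?R (\<lambda>x. (\<Sum>b\<in>Basis. (g x * (frechet_derivative k (at x) v \<bullet> b)) *\<^sub>R frechet_derivative f (at (k x)) b) + 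
         frechet_derivative g (at x) v *\<^sub>R f (k x))"
      proof (intro add_closure.add add_closure_sum finite_Basis; rule add_closure.base)
        show "(\<lambda>x. frechet_derivative g (at x) v *\<^sub>R f (k x)) \<in> ?R" by (intro RI smooth_on_deriv[OF S] h)
        have 1: "smooth_on S (\<lambda>x. (g x * (frechet_derivative k (at x) v \<bullet> b)))" for b
          by (intro smooth_on_mult[OF S] smooth_on_inner_const smooth_on_deriv[OF S] k h S)
        have 2: "smooth_on T (\<lambda>x. frechet_derivative f (at x) b)" for b by (intro smooth_on_deriv[OF T] h)
        show "(\<lambda>x. (g x * (frechet_derivative k (at x) v \<bullet> b)) *\<^sub>R frechet_derivative f (at (k x)) b) \<in> ?R" for b
          by (rule RI[OF 1 2])
      qed
      moreover have "frechet_derivative h (at x) v = (\<Sum>b\<in>Basis. (g x * (frechet_derivative k (at x) v \<bullet> b)) *\<^sub>R frechet_derivative f (at (k x)) b) + 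
         frechet_derivative g (at x) v *\<^sub>R f (k x)" if x: "x \<in> S" for x
      proof -
        have "frechet_derivative f (at (k x)) (frechet_derivative k (at x) v) = (\<Sum>b\<in>Basis. (frechet_derivative k (at x) v \<bullet> b) *\<^sub>R frechet_derivative f (at (k x)) b)"
          by (rule linear_basis_sum) (use smooth_on_has_derivative[OF T h(3), of "k x"] kS x has_derivative_linear in blast)
        then show ?thesis
          unfolding h(1) frechet_derivativeI[OF D[OF h(2,3) x]] by (simp add: scaleR_sum_right)
      qed
      ultimately show ?thesis by (intro exI conjI ballI) (assumption, simp)
    qed
  next
    have "smooth_on S (\<lambda>x. 1::real)" using S by simp
    then show "add_closure ?R (\<lambda>x. 1 *\<^sub>R f (k x))" by (intro add_closure.base RI f)
  qed
  then show ?thesis by simp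
qed

section \<open>A strong maximum principle for limits of parabolic subsolutions\<close>

text \<open>The derivative \<open>f'\<close> vanishes at \<open>0\<close>; if its slope there were positive, \<open>f\<close> would increase to the
  right of \<open>0\<close>.\<close>

lemma second_derivative_at_max:
  fixes f f' :: "real \<Rightarrow> real"
  assumes d: "d > 0" and f: "\<And>s. \<bar>s\<bar> < d \<Longrightarrow> DERIV f s :> f' s" and f': "DERIV f' 0 :> l"
    and max: "\<And>s. \<bar>s\<bar> < d \<Longrightarrow> f s \<le> f 0"
  shows "f' 0 = 0" "l \<le> 0"
proof -
  show 0: "f' 0 = 0" using DERIV_local_max[OF f[of 0] d] d max by simp
  show "l \<le> 0"
  proof (rule ccontr)
    assume "\<not> l \<le> 0"
    then obtain d' where d': "d' > 0" "\<And>h. 0 < h \<Longrightarrow> h < d' \<Longrightarrow> f' 0 < f' h"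
      using DERIV_pos_inc_right[OF f'] by auto
    define h where "h = min d d' / 2"
    have h: "0 < h" "h < d" "h < d'" using d d'(1) unfolding h_def by auto
    obtain z where z: "0 < z" "z < h" "f h - f 0 = (h - 0) * f' z"
      using MVT2[OF h(1), of f f'] f h by auto
    then have "f h - f 0 > 0" using h 0 d'(2)[of z] by simp
    then show False using max[of h] h by simp
  qed
qed

lemma gaussian_line_derivatives:
  fixes u e :: "'e::real_inner" and \<alpha> :: real
  defines "f \<equiv> (\<lambda>s. exp (- \<alpha> * (norm (u + s *\<^sub>R e))\<^sup>2))"
  defines "f' \<equiv> (\<lambda>s. - 2 * \<alpha> * ((u + s *\<^sub>R e) \<bullet> e) * f s)"
  shows "DERIV f s :> f' s" "DERIV f' 0 :> (4 * \<alpha>\<^sup>2 * (u \<bullet> e)\<^sup>2 - 2 * \<alpha> * (norm e)\<^sup>2) * exp (- \<alpha> * (norm u)\<^sup>2)"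
proof -
  have n: "(norm (u + s *\<^sub>R e))\<^sup>2 = (norm u)\<^sup>2 + 2 * s * (u \<bullet> e) + s\<^sup>2 * (norm e)\<^sup>2" for s
    unfolding power2_norm_eq_inner by (simp add: inner_add_left inner_add_right inner_commute power2_eq_square algebra_simps)
  show f: "DERIV f s :> f' s" for s
    unfolding f_def f'_def n
    by (auto intro!: derivative_eq_intros simp: algebra_simps power2_norm_eq_inner inner_commute)
  have i: "(u + s *\<^sub>R e) \<bullet> e = u \<bullet> e + s * (norm e)\<^sup>2" for s
    by (simp add: power2_norm_eq_inner algebra_simps)
  have f0: "f 0 = exp (- \<alpha> * (norm u)\<^sup>2)" unfolding f_def by simp
  show "DERIV f' 0 :> (4 * \<alpha>\<^sup>2 * (u \<bullet> e)\<^sup>2 - 2 * \<alpha> * (norm e)\<^sup>2) * exp (- \<alpha> * (norm u)\<^sup>2)"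
    unfolding f0[symmetric] unfolding f'_def i
    by (auto intro!: derivative_eq_intros f[unfolded f'_def i] simp: algebra_simps power2_eq_square)
qed

lemma DERIV_along_line:
  assumes "open S" "smooth_on S f" "y + s *\<^sub>R e \<in> S"
  shows "DERIV (\<lambda>s. f (y + s *\<^sub>R e)) s :> frechet_derivative f (at (y + s *\<^sub>R e)) e"
proof -
  note D = smooth_on_has_derivative[OF assms]
  have "((\<lambda>s. y + s *\<^sub>R e) has_derivative (\<lambda>h. h *\<^sub>R e)) (at s)" by (auto intro!: derivative_eq_intros)
  from has_derivative_compose[OF this D]
  show ?thesis unfolding has_field_derivative_def
    by (rule has_derivative_eq_rhs) (use linear_cmul[OF has_derivative_linear[OF D]] in \<open>auto simp: fun_eq_iff\<close>)
qed

text \<open>The function \<open>f\<close>, with time derivative \<open>\<tau>\<close> at \<open>y\<close>, is a subsolution of a parabolic equation in the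
  directions of \<open>W\<close>. The second order part is a sum of squares of \<open>p\<close> vectors, \<open>C\<close> bounds these vectors and
  their ellipticity, and the first order terms enter only through a bound \<open>N\<close> for the differential of
  \<open>f\<close> on \<open>W\<close>. In this form no coefficients have to be named, and \<open>e\<close> need not depend continuously on \<open>y\<close>.\<close>

definition subsolution_frame ::
  "nat \<Rightarrow> 'e::euclidean_space set \<Rightarrow> real \<Rightarrow> ('e \<Rightarrow> real) \<Rightarrow> 'e \<Rightarrow> real \<Rightarrow> (nat \<Rightarrow> 'e) \<Rightarrow> bool" where
  "subsolution_frame p W C f y \<tau> e \<longleftrightarrow>
     (\<forall>i<p. e i \<in> W \<and> norm (e i) \<le> C) \<and> (\<forall>\<xi>\<in>W. (norm \<xi>)\<^sup>2 \<le> C * (\<Sum>i<p. (\<xi> \<bullet> e i)\<^sup>2)) \<and>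
     (\<forall>N\<ge>0. (\<forall>a\<in>W. \<bar>frechet_derivative f (at y) a\<bar> \<le> N * norm a) \<longrightarrow>
        \<tau> \<le> (\<Sum>i<p. frechet_derivative (\<lambda>z. frechet_derivative f (at z) (e i)) (at y) (e i)) + C * N)"

text \<open>Hopf's barrier \<open>exp (- \<alpha> |u|\<^sup>2)\<close> is a strict subsolution on an annulus once \<open>\<alpha>\<close> is large: the term
  quadratic in \<open>\<alpha>\<close> is bounded below by ellipticity, the others are linear in \<open>\<alpha>\<close>.\<close>

lemma barrier_estimate:
  fixes e :: "nat \<Rightarrow> 'e::euclidean_space"
  assumes C: "C > 0" and R: "R > 0" and \<alpha>: "\<alpha> > 0" "\<alpha> * R\<^sup>2 / C \<ge> 2 * real p * C\<^sup>2 + 3 * R * C + 1"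
    and e: "\<And>i. i < p \<Longrightarrow> norm (e i) \<le> C" "(norm u)\<^sup>2 \<le> C * (\<Sum>i<p. (u \<bullet> e i)\<^sup>2)"
    and u: "norm u \<ge> R / 2" "norm u \<le> 3 * R / 2"
  shows "(\<Sum>i<p. (4 * \<alpha>\<^sup>2 * (u \<bullet> e i)\<^sup>2 - 2 * \<alpha> * (norm (e i))\<^sup>2) * exp (- \<alpha> * (norm u)\<^sup>2))
         - C * (3 * \<alpha> * R * exp (- \<alpha> * (norm u)\<^sup>2)) \<ge> \<alpha> * exp (- \<alpha> * (3 * R / 2)\<^sup>2)"
proof -
  let ?E = "exp (- \<alpha> * (norm u)\<^sup>2)"
  have "(\<Sum>i<p. (norm (e i))\<^sup>2) \<le> (\<Sum>i<p. C\<^sup>2)" by (intro sum_mono power_mono e) auto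
  then have 1: "(\<Sum>i<p. (norm (e i))\<^sup>2) \<le> real p * C\<^sup>2" by simp
  have "R\<^sup>2 / 4 \<le> (norm u)\<^sup>2" using power_mono[OF u(1), of 2] R by (simp add: power_divide)
  also have "\<dots> \<le> C * (\<Sum>i<p. (u \<bullet> e i)\<^sup>2)" by (rule e)
  finally have 2: "(\<Sum>i<p. (u \<bullet> e i)\<^sup>2) \<ge> R\<^sup>2 / (4 * C)" using C by (simp add: field_simps)
  have "(\<Sum>i<p. (4 * \<alpha>\<^sup>2 * (u \<bullet> e i)\<^sup>2 - 2 * \<alpha> * (norm (e i))\<^sup>2) * ?E) - C * (3 * \<alpha> * R * ?E)
     = \<alpha> * ?E * (4 * \<alpha> * (\<Sum>i<p. (u \<bullet> e i)\<^sup>2) - 2 * (\<Sum>i<p. (norm (e i))\<^sup>2) - 3 * R * C)"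
    by (simp add: sum_distrib_left sum_distrib_right sum_subtractf algebra_simps power2_eq_square)
  also have "\<dots> \<ge> \<alpha> * ?E * 1"
  proof (rule mult_left_mono)
    have "4 * \<alpha> * (\<Sum>i<p. (u \<bullet> e i)\<^sup>2) \<ge> 4 * \<alpha> * (R\<^sup>2 / (4 * C))" using 2 \<alpha>(1) by (intro mult_left_mono) auto
    then show "1 \<le> 4 * \<alpha> * (\<Sum>i<p. (u \<bullet> e i)\<^sup>2) - 2 * (\<Sum>i<p. (norm (e i))\<^sup>2) - 3 * R * C"
      using 1 \<alpha>(2) by simp
  qed (use \<alpha> in auto)
  also have "\<alpha> * ?E * 1 \<ge> \<alpha> * exp (- \<alpha> * (3 * R / 2)\<^sup>2)"
    using power_mono[OF u(2), of 2] \<alpha>(1) by simp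
  finally show ?thesis .
qed

lemma compact_strict_bound:
  fixes f :: "'a::topological_space \<Rightarrow> real"
  assumes "compact K" "continuous_on K f" "\<And>x. x \<in> K \<Longrightarrow> f x < M"
  obtains \<delta> where "\<delta> > 0" "\<And>x. x \<in> K \<Longrightarrow> f x \<le> M - \<delta>"
proof (cases "K = {}")
  case False
  then obtain x where "x \<in> K" "\<forall>y\<in>K. f y \<le> f x" using continuous_attains_sup[OF assms(1) _ assms(2)] by blast
  then show ?thesis using that[of "M - f x"] assms(3) by auto
qed (use that[of 1] in auto)

text \<open>The heart of Hopf's argument. A ball about \<open>y2\<close> in \<open>z + W\<close> on which the limit is below its maximum
  \<open>M\<close> cannot touch the set where the limit is \<open>M\<close> in the single point \<open>z\<close>. Adding a small multiple of the
  barrier \<open>v\<close> makes the limit smaller than \<open>M\<close> on a sphere about \<open>z\<close> and keeps it \<open>M\<close> at \<open>z\<close>. The limit itself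
  is only known to be continuous, so the second derivative test is applied to \<open>q t\<close> for large \<open>t\<close>: after
  the slowly growing term \<open>\<epsilon> c (t - T) / 2\<close> is added, the maximum over a long time cylinder is attained
  after the initial time and off the lateral boundary, which contradicts the differential inequality.\<close>

lemma no_contact_point:
  fixes q :: "real \<Rightarrow> 'e::euclidean_space \<Rightarrow> real"
  assumes W: "subspace W" and C: "C > 0"
    and S: "open S"
    and smooth: "\<And>t. t \<ge> 0 \<Longrightarrow> smooth_on S (q t)"
    and cont: "continuous_on ({0..} \<times> S) (\<lambda>(t, y). q t y)"
    and lim: "\<And>K. compact K \<Longrightarrow> K \<subseteq> S \<Longrightarrow> uniform_limit K q qinf at_top"
    and sub: "\<And>t y. t > 0 \<Longrightarrow> y \<in> S \<Longrightarrow> \<exists>\<tau> e. ((\<lambda>s. q s y) has_real_derivative \<tau>) (at t) \<and> subsolution_frame p W C (q t) y \<tau> e"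
    and max: "\<And>y. y \<in> S \<Longrightarrow> y - z \<in> W \<Longrightarrow> qinf y \<le> M"
    and z: "z \<in> S" "qinf z = M" and R: "R > 0" "norm (z - y2) = R" "z - y2 \<in> W"
    and inner: "\<And>y. y \<in> S \<Longrightarrow> y - z \<in> W \<Longrightarrow> norm (y - y2) \<le> R \<Longrightarrow> y \<noteq> z \<Longrightarrow> qinf y < M"
  shows False
proof -
  obtain \<rho>0 where \<rho>0: "\<rho>0 > 0" "cball z \<rho>0 \<subseteq> S" using S z(1) open_contains_cball by blast
  \<comment> \<open>Within \<open>R / 2\<close> of \<open>z\<close> the distance to \<open>y2\<close> stays between \<open>R / 2\<close> and \<open>3 R / 2\<close>.\<close>
  define \<rho> where "\<rho> = min \<rho>0 (R / 2)"
  have \<rho>: "\<rho> > 0" "cball z \<rho> \<subseteq> S" "\<rho> \<le> R / 2" using \<rho>0 R(1) unfolding \<rho>_def by auto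
  define K where "K = cball z \<rho> \<inter> {y. y - z \<in> W}"
  have clW: "closed {y. y - z \<in> W}"
    using closed_vimage[OF closed_subspace[OF W], of "\<lambda>y. y - z"] by (simp add: vimage_def continuous_intros)
  have K: "compact K" "K \<subseteq> S" using \<rho>(2) clW unfolding K_def by (auto intro: compact_Int_closed)
  have contq: "continuous_on S (q t)" if "t \<ge> 0" for t by (rule smooth_on_imp_continuous_on[OF smooth[OF that]])
  have contqinf: "continuous_on K qinf"
  proof (rule uniform_limit_theorem[OF _ lim[OF K]])
    show "\<forall>\<^sub>F t in at_top. continuous_on K (q t)"
      using eventually_ge_at_top[of 0] by eventually_elim (use contq continuous_on_subset K(2) in blast)
  qed simp
  define \<alpha> where "\<alpha> = (2 * real p * C\<^sup>2 + 3 * R * C + 1) * C / R\<^sup>2"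
  have "2 * real p * C\<^sup>2 + 3 * R * C + 1 > 0" using C R by (simp add: add_nonneg_pos)
  moreover have "\<alpha> * R\<^sup>2 / C = 2 * real p * C\<^sup>2 + 3 * R * C + 1" using C R(1) unfolding \<alpha>_def by simp
  ultimately have \<alpha>: "\<alpha> > 0" "\<alpha> * R\<^sup>2 / C \<ge> 2 * real p * C\<^sup>2 + 3 * R * C + 1"
    using C R(1) unfolding \<alpha>_def by (auto intro!: divide_pos_pos mult_pos_pos)
  define v where "v y = exp (- \<alpha> * (norm (y - y2))\<^sup>2) - exp (- \<alpha> * R\<^sup>2)" for y
  define c where "c = \<alpha> * exp (- \<alpha> * (3 * R / 2)\<^sup>2)"
  have c: "c > 0" using \<alpha> unfolding c_def by simp
  have contv: "continuous_on T v" for T unfolding v_def by (intro continuous_intros)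
  have v: "v y \<le> 1" "norm (y - y2) > R \<Longrightarrow> v y < 0" "v z = 0" for y
  proof -
    have "exp (- \<alpha> * (norm (y - y2))\<^sup>2) \<le> 1" using \<alpha>(1) by simp
    moreover have "exp (- \<alpha> * R\<^sup>2) > 0" by simp
    ultimately show "v y \<le> 1" unfolding v_def by linarith
    show "v y < 0" if "norm (y - y2) > R" using power_strict_mono[OF that, of 2] \<alpha>(1) R unfolding v_def by simp
    show "v z = 0" unfolding v_def using R by simp
  qed
  define K1 where "K1 = K \<inter> sphere z \<rho>"
  have K1: "compact K1" using K(1) unfolding K1_def by (simp add: compact_Int_closed)
  have cq1: "continuous_on K1 qinf" using contqinf continuous_on_subset unfolding K1_def by blast
  obtain \<delta> where \<delta>: "\<delta> > 0" "\<And>y. y \<in> K1 \<inter> cball y2 R \<Longrightarrow> qinf y \<le> M - \<delta>"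
  proof (rule compact_strict_bound[of "K1 \<inter> cball y2 R" qinf M])
    show "compact (K1 \<inter> cball y2 R)" using K1 by (simp add: compact_Int_closed)
    show "continuous_on (K1 \<inter> cball y2 R) qinf" using cq1 continuous_on_subset by blast
    show "qinf y < M" if "y \<in> K1 \<inter> cball y2 R" for y
    proof (rule inner)
      have "y \<in> K" using that unfolding K1_def by blast
      then show "y \<in> S" "y - z \<in> W" using K(2) unfolding K_def by auto
      show "norm (y - y2) \<le> R" "y \<noteq> z" using that \<rho>(1) unfolding K1_def by (auto simp: dist_norm norm_minus_commute)
    qed
  qed blast
  \<comment> \<open>Inside the ball about \<open>y2\<close> the gap \<open>\<delta>\<close> absorbs \<open>\<epsilon> v\<close>, as \<open>v \<le> 1\<close>; outside, \<open>v\<close> is negative.\<close>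
  define \<epsilon> where "\<epsilon> = \<delta> / 2"
  have \<epsilon>: "\<epsilon> > 0" using \<delta> unfolding \<epsilon>_def by simp
  obtain \<delta>' where \<delta>': "\<delta>' > 0" "\<And>y. y \<in> K1 \<Longrightarrow> qinf y + \<epsilon> * v y \<le> M - \<delta>'"
  proof (rule compact_strict_bound[of "K1" "\<lambda>y. qinf y + \<epsilon> * v y" M])
    show "continuous_on K1 (\<lambda>y. qinf y + \<epsilon> * v y)" by (intro continuous_intros cq1 contv)
    show "qinf y + \<epsilon> * v y < M" if y: "y \<in> K1" for y
    proof (cases "norm (y - y2) \<le> R")
      case True
      then have "qinf y \<le> M - \<delta>" using y by (intro \<delta>) (auto simp: dist_norm norm_minus_commute)
      moreover have "\<epsilon> * v y \<le> \<epsilon> * 1" using v(1) \<epsilon> by (intro mult_left_mono) auto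
      moreover have "\<epsilon> < \<delta>" using \<delta>(1) unfolding \<epsilon>_def by simp
      ultimately show ?thesis by simp
    next
      case False
      then have "\<epsilon> * v y < 0" using v(2)[of y] \<epsilon> by (simp add: mult_less_0_iff)
      moreover have "qinf y \<le> M" using y K(2) unfolding K1_def K_def by (intro max) auto
      ultimately show ?thesis by simp
    qed
  qed (use K1 in blast)+
  define \<eta> where "\<eta> = \<delta>' / 4"
  have \<eta>: "\<eta> > 0" "2 * \<eta> < \<delta>'" using \<delta>' unfolding \<eta>_def by auto
  have "\<forall>\<^sub>F t in at_top. \<forall>y\<in>K. dist (q t y) (qinf y) < \<eta>"
    using uniform_limitD[OF lim[OF K] \<eta>(1)] .
  then obtain T0 where T0: "\<And>t y. t \<ge> T0 \<Longrightarrow> y \<in> K \<Longrightarrow> dist (q t y) (qinf y) < \<eta>"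
    unfolding eventually_at_top_linorder by blast
  define T where "T = Max {T0, 1}"
  have T: "T > 0" "\<And>t y. t \<ge> T \<Longrightarrow> y \<in> K \<Longrightarrow> \<bar>q t y - qinf y\<bar> < \<eta>"
    using T0 unfolding T_def by (auto simp: dist_real_def)
  \<comment> \<open>So long that the time term outweighs \<open>\<epsilon> v\<close> and the error \<open>\<eta>\<close> of the convergence.\<close>
  define len where "len = 2 * (\<epsilon> + 2 * \<eta> + 1) / (\<epsilon> * c)"
  have len: "len > 0" "\<epsilon> * c / 2 * len = \<epsilon> + 2 * \<eta> + 1" using \<epsilon> c \<eta> unfolding len_def by (auto simp: field_simps)
  define w where "w t y = q t y + \<epsilon> * v y + \<epsilon> * c / 2 * (t - T)" for t y
  have zK: "z \<in> K" using \<rho>(1) subspace_0[OF W] unfolding K_def by simp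
  have "\<exists>x\<in>{T..T + len} \<times> K. \<forall>y\<in>{T..T + len} \<times> K. (case y of (t, y) \<Rightarrow> w t y) \<le> (case x of (t, y) \<Rightarrow> w t y)"
  proof (rule continuous_attains_sup)
    show "compact ({T..T + len} \<times> K)" using K(1) by (intro compact_Times) auto
    show "{T..T + len} \<times> K \<noteq> {}" using zK len by auto
    have "continuous_on ({T..T + len} \<times> K) (\<lambda>(t, y). q t y)"
      by (rule continuous_on_subset[OF cont]) (use K(2) T(1) in auto)
    moreover have "continuous_on ({T..T + len} \<times> K) (\<lambda>x. v (snd x))"
      by (rule continuous_on_compose2[OF contv[of UNIV]]) (auto intro: continuous_intros)
    ultimately show "continuous_on ({T..T + len} \<times> K) (\<lambda>(t, y). w t y)"
      unfolding w_def by (auto simp: case_prod_unfold intro!: continuous_intros)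
  qed
  then obtain t y where ty: "T \<le> t" "t \<le> T + len" "y \<in> K"
    and mx: "\<And>s x. T \<le> s \<Longrightarrow> s \<le> T + len \<Longrightarrow> x \<in> K \<Longrightarrow> w s x \<le> w t y" by auto
  have "w (T + len) z \<le> w t y" using len zK by (intro mx) auto
  moreover have "w (T + len) z \<ge> M - \<eta> + \<epsilon> * c / 2 * len"
    using T(2)[of "T + len" z] zK len z(2) v(3) unfolding w_def by (simp add: abs_less_iff)
  ultimately have low: "w t y \<ge> M - \<eta> + \<epsilon> * c / 2 * len" by simp
  have up: "w t y < qinf y + \<epsilon> * v y + \<eta> + \<epsilon> * c / 2 * (t - T)"
    using T(2)[OF ty(1,3)] unfolding w_def by (simp add: abs_less_iff)
  have "t \<noteq> T"
  proof
    assume "t = T"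
    have "qinf y \<le> M" using ty(3) K(2) unfolding K_def by (intro max) auto
    moreover have "\<epsilon> * v y \<le> \<epsilon> * 1" using v(1) \<epsilon> by (intro mult_left_mono) auto
    ultimately show False using up low len(2) \<open>t = T\<close> by simp
  qed
  then have tT: "T < t" using ty by simp
  have yint: "norm (y - z) < \<rho>"
  proof (rule ccontr)
    assume "\<not> norm (y - z) < \<rho>"
    then have "y \<in> K1" using ty(3) unfolding K1_def K_def by (auto simp: dist_norm norm_minus_commute)
    from \<delta>'(2)[OF this] have "w t y < M - \<delta>' + \<eta> + \<epsilon> * c / 2 * (t - T)" using up by simp
    also have "\<dots> \<le> M - \<delta>' + \<eta> + \<epsilon> * c / 2 * len" using ty(2) \<epsilon> c by (intro add_left_mono mult_left_mono) auto
    finally show False using low \<eta> by simp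
  qed
  have yS: "y \<in> S" using ty K by blast
  have yW: "y - z \<in> W" using ty unfolding K_def by simp
  obtain \<tau> e where \<tau>: "((\<lambda>s. q s y) has_real_derivative \<tau>) (at t)" and fr: "subsolution_frame p W C (q t) y \<tau> e"
    using sub[of t y] yS tT T(1) by auto
  have e: "\<And>i. i < p \<Longrightarrow> e i \<in> W" "\<And>i. i < p \<Longrightarrow> norm (e i) \<le> C" "\<And>\<xi>. \<xi> \<in> W \<Longrightarrow> (norm \<xi>)\<^sup>2 \<le> C * (\<Sum>i<p. (\<xi> \<bullet> e i)\<^sup>2)"
    and ineq: "\<And>N. N \<ge> 0 \<Longrightarrow> (\<And>a. a\<in>W \<Longrightarrow> \<bar>frechet_derivative (q t) (at y) a\<bar> \<le> N * norm a) \<Longrightarrow>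
        \<tau> \<le> (\<Sum>i<p. frechet_derivative (\<lambda>z. frechet_derivative (q t) (at z) (e i)) (at y) (e i)) + C * N"
    using fr unfolding subsolution_frame_def by blast+
  have \<tau>0: "\<tau> + \<epsilon> * c / 2 \<ge> 0"
  proof (rule ccontr)
    assume neg: "\<not> \<tau> + \<epsilon> * c / 2 \<ge> 0"
    have "((\<lambda>s. w s y) has_real_derivative (\<tau> + \<epsilon> * c / 2)) (at t)"
      unfolding w_def by (auto intro!: derivative_eq_intros \<tau>)
    from DERIV_neg_dec_left[OF this] neg obtain d where d: "d > 0" "\<And>h. 0 < h \<Longrightarrow> h < d \<Longrightarrow> w t y < w (t - h) y" by auto
    define h where "h = min (d / 2) (t - T)"
    have "h > 0" "h < d" "h \<le> t - T" using d tT unfolding h_def by auto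
    then show False using d(2)[of h] mx[of "t - h" y] ty by simp
  qed
  define u where "u = y - y2"
  have uW: "u \<in> W" using subspace_add[OF W yW R(3)] unfolding u_def by simp
  have un: "norm u \<ge> R / 2" "norm u \<le> 3 * R / 2"
    using norm_triangle_ineq[of "y - z" "z - y2"] norm_triangle_ineq[of "z - y" "y - y2"] yint R(2) \<rho>(3)
    unfolding u_def by (auto simp: norm_minus_commute)
  let ?E = "exp (- \<alpha> * (norm u)\<^sup>2)"
  \<comment> \<open>At an interior maximum of \<open>w t\<close>, the first and second derivatives of \<open>q t\<close> are governed by those of \<open>v\<close>.\<close>
  have line: "frechet_derivative (q t) (at y) a = 2 * \<epsilon> * \<alpha> * (u \<bullet> a) * ?E \<and>
    frechet_derivative (\<lambda>z. frechet_derivative (q t) (at z) a) (at y) a \<le> - \<epsilon> * ((4 * \<alpha>\<^sup>2 * (u \<bullet> a)\<^sup>2 - 2 * \<alpha> * (norm a)\<^sup>2) * ?E)"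
    if a: "a \<in> W" for a
  proof -
    define d where "d = (\<rho> - norm (y - z)) / (norm a + 1)"
    have d: "d > 0" using yint unfolding d_def by (simp add: add_nonneg_pos)
    have inK: "y + s *\<^sub>R a \<in> K" if "\<bar>s\<bar> < d" for s
    proof -
      have "norm (s *\<^sub>R a) \<le> d * norm a" using that by (simp add: mult_right_mono)
      also have "\<dots> \<le> d * (norm a + 1)" using d by simp
      also have "\<dots> = \<rho> - norm (y - z)" unfolding d_def using add_nonneg_pos[OF norm_ge_zero[of a] zero_less_one] by simp
      finally have "norm (y + s *\<^sub>R a - z) \<le> \<rho>" using norm_triangle_ineq[of "y - z" "s *\<^sub>R a"] by (simp add: algebra_simps)
      moreover have "y + s *\<^sub>R a - z \<in> W" using subspace_add[OF W yW subspace_scale[OF W a, of s]] by (simp add: algebra_simps)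
      ultimately show ?thesis unfolding K_def by (simp add: dist_norm norm_minus_commute)
    qed
    define G where "G s = exp (- \<alpha> * (norm (u + s *\<^sub>R a))\<^sup>2)" for s
    define f where "f s = q t (y + s *\<^sub>R a) + \<epsilon> * (G s - exp (- \<alpha> * R\<^sup>2))" for s
    define f' where "f' s = frechet_derivative (q t) (at (y + s *\<^sub>R a)) a + \<epsilon> * (- 2 * \<alpha> * ((u + s *\<^sub>R a) \<bullet> a) * G s)" for s
    let ?l = "frechet_derivative (\<lambda>z. frechet_derivative (q t) (at z) a) (at y) a + \<epsilon> * ((4 * \<alpha>\<^sup>2 * (u \<bullet> a)\<^sup>2 - 2 * \<alpha> * (norm a)\<^sup>2) * ?E)"
    have t0: "t \<ge> 0" using tT T by simp
    have 1: "DERIV f s :> f' s" if "\<bar>s\<bar> < d" for s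
      unfolding f_def f'_def
      using DERIV_along_line[OF S smooth[OF t0], of y s a] inK[OF that] K(2) gaussian_line_derivatives(1)[of \<alpha> u a s]
      unfolding G_def[symmetric] by (auto intro!: derivative_eq_intros)
    have "DERIV (\<lambda>s. frechet_derivative (q t) (at (y + s *\<^sub>R a)) a) 0 :> frechet_derivative (\<lambda>z. frechet_derivative (q t) (at z) a) (at (y + 0 *\<^sub>R a)) a"
      by (rule DERIV_along_line[OF S smooth_on_deriv[OF S smooth[OF t0]]]) (use yS in simp)
    then have 2: "DERIV f' 0 :> ?l"
      unfolding f'_def using gaussian_line_derivatives(2)[of \<alpha> u a]
      unfolding G_def[symmetric] by (intro DERIV_add DERIV_cmult) simp_all
    have 3: "f s \<le> f 0" if "\<bar>s\<bar> < d" for s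
    proof -
      have "f s = w t (y + s *\<^sub>R a) - \<epsilon> * c / 2 * (t - T)" for s
        unfolding f_def w_def v_def G_def u_def by (simp add: algebra_simps)
      then show ?thesis using mx[OF ty(1,2) inK[OF that]] by simp
    qed
    from second_derivative_at_max[OF d 1 2 3] show ?thesis
      unfolding f'_def G_def by simp
  qed
  have "\<tau> \<le> (\<Sum>i<p. frechet_derivative (\<lambda>z. frechet_derivative (q t) (at z) (e i)) (at y) (e i)) + C * (\<epsilon> * (3 * \<alpha> * R * ?E))"
  proof (rule ineq)
    show "\<epsilon> * (3 * \<alpha> * R * ?E) \<ge> 0" using \<epsilon> \<alpha>(1) R(1) by simp
    fix a assume a: "a \<in> W"
    have "\<bar>u \<bullet> a\<bar> \<le> 3 * R / 2 * norm a"
      using Cauchy_Schwarz_ineq2[of u a] mult_right_mono[OF un(2) norm_ge_zero[of a]] by simp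
    then have "(2 * \<epsilon> * \<alpha> * ?E) * \<bar>u \<bullet> a\<bar> \<le> (2 * \<epsilon> * \<alpha> * ?E) * (3 * R / 2 * norm a)"
      using \<epsilon> \<alpha>(1) by (intro mult_left_mono) auto
    then show "\<bar>frechet_derivative (q t) (at y) a\<bar> \<le> \<epsilon> * (3 * \<alpha> * R * ?E) * norm a"
      using line[OF a] \<epsilon> \<alpha>(1) by (simp add: abs_mult algebra_simps)
  qed
  also have "\<dots> \<le> (\<Sum>i<p. - \<epsilon> * ((4 * \<alpha>\<^sup>2 * (u \<bullet> e i)\<^sup>2 - 2 * \<alpha> * (norm (e i))\<^sup>2) * ?E)) + C * (\<epsilon> * (3 * \<alpha> * R * ?E))"
    by (intro add_right_mono sum_mono) (use line e(1) in auto)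
  also have "\<dots> = - \<epsilon> * ((\<Sum>i<p. (4 * \<alpha>\<^sup>2 * (u \<bullet> e i)\<^sup>2 - 2 * \<alpha> * (norm (e i))\<^sup>2) * ?E) - C * (3 * \<alpha> * R * ?E))"
    by (simp add: sum_distrib_left sum_negf algebra_simps)
  also have "\<dots> \<le> - \<epsilon> * c"
    using barrier_estimate[OF C R(1) \<alpha> e(2) e(3)[OF uW] un] \<epsilon> unfolding c_def by simp
  finally have "\<tau> \<le> - (\<epsilon> * c)" by simp
  moreover have "\<epsilon> * c > 0" using \<epsilon> c by simp
  ultimately show False using \<tau>0 by linarith
qed

text \<open>If the limit were below its maximum at \<open>y1\<close>, let \<open>z\<close> be a point nearest to \<open>y1\<close> at which the maximum is
  attained. The ball with half the radius whose centre is the midpoint of \<open>y1\<close> and \<open>z\<close> touches the set of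
  maxima in \<open>z\<close> alone.\<close>

theorem limit_strong_maximum_principle:
  fixes q :: "real \<Rightarrow> 'e::euclidean_space \<Rightarrow> real"
  assumes W: "subspace W" and C: "C > 0" and r: "r > 0"
    and smooth: "\<And>t. t \<ge> 0 \<Longrightarrow> smooth_on (ball y0 r) (q t)"
    and cont: "continuous_on ({0..} \<times> ball y0 r) (\<lambda>(t, y). q t y)"
    and lim: "\<And>K. compact K \<Longrightarrow> K \<subseteq> ball y0 r \<Longrightarrow> uniform_limit K q qinf at_top"
    and sub: "\<And>t y. t > 0 \<Longrightarrow> y \<in> ball y0 r \<Longrightarrow>
      \<exists>\<tau> e. ((\<lambda>s. q s y) has_real_derivative \<tau>) (at t) \<and> subsolution_frame p W C (q t) y \<tau> e"
    and max: "\<And>y. y \<in> ball y0 r \<Longrightarrow> y - y0 \<in> W \<Longrightarrow> qinf y \<le> qinf y0"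
    and y1: "y1 \<in> ball y0 (r / 2)" "y1 - y0 \<in> W"
  shows "qinf y1 = qinf y0"
proof (rule ccontr)
  assume ne: "qinf y1 \<noteq> qinf y0"
  let ?S = "ball y0 r"
  define d where "d = dist y1 y0"
  have d: "d > 0" "d < r / 2" using ne y1(1) unfolding d_def by (auto simp: dist_commute)
  define K where "K = cball y1 d \<inter> {y. y - y0 \<in> W}"
  have clW: "closed {y. y - y0 \<in> W}"
    using closed_vimage[OF closed_subspace[OF W], of "\<lambda>y. y - y0"] by (simp add: vimage_def continuous_intros)
  have cS: "cball y1 d \<subseteq> ?S"
  proof
    fix x assume "x \<in> cball y1 d"
    then show "x \<in> ?S" using dist_triangle[of y0 x y1] d y1(1) by (auto simp: dist_commute d_def)
  qed
  have K: "compact K" "K \<subseteq> ?S" using cS clW unfolding K_def by (auto intro: compact_Int_closed)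
  have contqinf: "continuous_on K qinf"
  proof (rule uniform_limit_theorem[OF _ lim[OF K]])
    show "\<forall>\<^sub>F t in at_top. continuous_on K (q t)"
      using eventually_ge_at_top[of 0]
      by eventually_elim (rule continuous_on_subset[OF smooth_on_imp_continuous_on[OF smooth] K(2)])
  qed simp
  define F where "F = {y \<in> K. qinf y = qinf y0}"
  have "closed F" unfolding F_def
    using continuous_closed_preimage_constant[OF contqinf compact_imp_closed[OF K(1)]] .
  then have F: "compact F" using compact_Int_closed[OF K(1), of F] unfolding F_def by (simp add: Int_absorb1)
  have "y0 \<in> F" using subspace_0[OF W] unfolding F_def K_def d_def by simp
  then obtain z where z: "z \<in> F" "\<And>x. x \<in> F \<Longrightarrow> dist y1 z \<le> dist y1 x"
  proof -
    have "continuous_on F (dist y1)" by (intro continuous_intros)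
    then show ?thesis using continuous_attains_inf[OF F, of "dist y1"] \<open>y0 \<in> F\<close> that by blast
  qed
  define R where "R = dist y1 z / 2"
  have zK: "z \<in> K" "qinf z = qinf y0" using z(1) unfolding F_def by auto
  have R: "R > 0" "2 * R \<le> d" using ne zK(2) zK(1) unfolding R_def K_def by (auto simp: dist_commute)
  define y2 where "y2 = y1 + (1/2) *\<^sub>R (z - y1)"
  have zW: "z - y0 \<in> W" using zK unfolding K_def by simp
  have e1: "z - y2 = (1/2) *\<^sub>R (z - y1)" "y2 - y1 = (1/2) *\<^sub>R (z - y1)"
  proof -
    have h: "(1/2) *\<^sub>R a + (1/2) *\<^sub>R a = a" for a :: 'e by (simp flip: scaleR_left_distrib)
    have "z - y2 = (1/2) *\<^sub>R (z - y1) + (1/2) *\<^sub>R (z - y1) - (1/2) *\<^sub>R (z - y1)"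
      unfolding h unfolding y2_def by (simp add: diff_diff_eq[symmetric])
    then show "z - y2 = (1/2) *\<^sub>R (z - y1)" by simp
    show "y2 - y1 = (1/2) *\<^sub>R (z - y1)" unfolding y2_def by simp
  qed
  have Wdiff: "a - b \<in> W" if "a - y0 \<in> W" "b - y0 \<in> W" for a b
    using subspace_diff[OF W that] by simp
  have Wadd: "a - y0 \<in> W" if "a - z \<in> W" for a
    using subspace_add[OF W that zW] by simp
  show False
  proof (rule no_contact_point[where z=z and ?y2.0=y2 and R=R and M="qinf y0" and S="ball y0 r" and q=q and qinf=qinf and p=p, OF W C open_ball smooth cont lim sub])
    show "qinf y \<le> qinf y0" if "y \<in> ?S" "y - z \<in> W" for y by (rule max[OF that(1) Wadd[OF that(2)]])
    show "z \<in> ?S" using zK(1) K(2) by blast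
    show "qinf z = qinf y0" by (rule zK)
    show "R > 0" by (rule R)
    show "norm (z - y2) = R" unfolding e1 R_def by (simp add: dist_norm norm_minus_commute)
    show "z - y2 \<in> W" unfolding e1 by (rule subspace_scale[OF W Wdiff[OF zW y1(2)]])
    show "qinf y < qinf y0" if y: "y \<in> ?S" "y - z \<in> W" "norm (y - y2) \<le> R" "y \<noteq> z" for y
    proof (rule ccontr)
      assume "\<not> qinf y < qinf y0"
      then have eq: "qinf y = qinf y0" using max[OF y(1) Wadd[OF y(2)]] by simp
      have n2: "norm (y2 - y1) = R" unfolding e1 R_def by (simp add: dist_norm norm_minus_commute)
      have tri: "norm (y - y1) \<le> norm (y - y2) + norm (y2 - y1)" using norm_triangle_ineq[of "y - y2" "y2 - y1"] by simp
      have "y \<in> K" using tri n2 y(3) R Wadd[OF y(2)] unfolding K_def by (simp add: dist_norm norm_minus_commute)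
      then have "dist y1 z \<le> dist y1 y" using eq by (intro z) (simp add: F_def)
      then have n: "norm (y - y1) = 2 * R" "norm (y - y2) = R"
        using tri n2 y(3) unfolding R_def by (auto simp: dist_norm norm_minus_commute)
      have "norm ((y - y2) + (y2 - y1)) = norm (y - y2) + norm (y2 - y1)" using n n2 by simp
      then have "norm (y - y2) *\<^sub>R (y2 - y1) = norm (y2 - y1) *\<^sub>R (y - y2)" by (simp only: norm_triangle_eq)
      then have "y2 - y1 = y - y2" using n n2 R(1) by simp
      also have "y2 - y1 = z - y2" using e1 by simp
      finally show False using y(4) by simp
    qed
  qed
qed

section \<open>Change of charts\<close>

lemma bilinear_basis_sum:
  assumes "bilinear B"
  shows "B (u::'a::euclidean_space) (v::'b::euclidean_space) = (\<Sum>i\<in>Basis. \<Sum>j\<in>Basis. (u \<bullet> i) *\<^sub>R (v \<bullet> j) *\<^sub>R B i j)"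
proof -
  have l: "linear (\<lambda>u. B u v)" "linear (B u)" for u v using assms unfolding bilinear_def by blast+
  have "B u v = (\<Sum>i\<in>Basis. (u \<bullet> i) *\<^sub>R B i v)" by (rule linear_basis_sum[OF l(1)])
  also have "\<dots> = (\<Sum>i\<in>Basis. (u \<bullet> i) *\<^sub>R (\<Sum>j\<in>Basis. (v \<bullet> j) *\<^sub>R B i j))"
    by (subst linear_basis_sum[OF l(2)]) simp
  finally show ?thesis by (simp add: scaleR_sum_right)
qed

lemma smooth_on_eqI: "smooth_on S g \<Longrightarrow> (\<And>x. x \<in> S \<Longrightarrow> f x = g x) \<Longrightarrow> smooth_on S f"
  using smooth_on_cong[of S f g] by simp

lemma smooth_on_linear_family:
  fixes X :: "'a::real_normed_vector \<Rightarrow> 'b::euclidean_space" and L :: "'a \<Rightarrow> 'b \<Rightarrow> 'c::real_normed_vector"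
  assumes "open S" "\<And>y. y \<in> S \<Longrightarrow> linear (L y)" "\<And>u. smooth_on S (\<lambda>y. L y u)" "smooth_on S X"
  shows "smooth_on S (\<lambda>y. L y (X y))"
proof -
  have "smooth_on S (\<lambda>y. \<Sum>i\<in>Basis. (X y \<bullet> i) *\<^sub>R L y i)"
    by (intro smooth_on_sum smooth_on_scaleR smooth_on_inner_const assms finite_Basis)
  then show ?thesis by (rule smooth_on_eqI) (rule linear_basis_sum[OF assms(2)])
qed

lemma smooth_on_bilinear_family:
  fixes X :: "'a::real_normed_vector \<Rightarrow> 'b::euclidean_space" and B :: "'a \<Rightarrow> 'b \<Rightarrow> 'b \<Rightarrow> 'c::real_normed_vector"
  assumes "open S" "\<And>y. y \<in> S \<Longrightarrow> bilinear (B y)" "\<And>u v. smooth_on S (\<lambda>y. B y u v)" "smooth_on S X" "smooth_on S Y"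
  shows "smooth_on S (\<lambda>y. B y (X y) (Y y))"
proof (rule smooth_on_linear_family[OF assms(1) _ _ assms(5)])
  show "linear (B y (X y))" if "y \<in> S" for y using assms(2)[OF that] unfolding bilinear_def by blast
  show "smooth_on S (\<lambda>y. B y (X y) u)" for u
    by (rule smooth_on_linear_family[OF assms(1) _ _ assms(4)])
      (use assms(2) assms(3) in \<open>auto simp: bilinear_def\<close>)
qed

text \<open>Both \<open>to_comp\<close> and \<open>of_comp\<close> are instances, which reduces their calculus to the chain rule for
  coordinate changes.\<close>

definition trans_deriv :: "('m, 'e::euclidean_space) chart \<Rightarrow> ('m, 'f::euclidean_space) chart \<Rightarrow> 'm \<Rightarrow> 'e \<Rightarrow> 'f" where
  "trans_deriv c d x = frechet_derivative (snd d \<circ> cinv c) (at (snd c x))"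

lemma is_chart_inj: "is_chart c \<Longrightarrow> inj_on (snd c) (fst c)"
  unfolding is_chart_def homeomorphism_def by (auto intro: inj_on_inverseI)

lemma cinv_chart [simp]: "is_chart c \<Longrightarrow> x \<in> fst c \<Longrightarrow> cinv c (snd c x) = x"
  unfolding cinv_def by (simp add: is_chart_inj)

lemma chart_cinv: "y \<in> snd c ` fst c \<Longrightarrow> snd c (cinv c y) = y" "y \<in> snd c ` fst c \<Longrightarrow> cinv c y \<in> fst c"
  unfolding cinv_def by (auto simp: f_inv_into_f inv_into_into)

lemma is_chart_continuous: "is_chart c \<Longrightarrow> continuous_on (fst c) (snd c)"
  unfolding is_chart_def homeomorphism_def by blast

lemma is_chart_continuous_cinv:
  assumes "is_chart c" shows "continuous_on (snd c ` fst c) (cinv c)"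
proof -
  obtain h where h: "homeomorphism (fst c) (snd c ` fst c) (snd c) h" using assms unfolding is_chart_def by blast
  have "cinv c y = h y" if "y \<in> snd c ` fst c" for y
    using homeomorphism_apply1[OF h] that cinv_chart[OF assms] by (elim imageE) simp
  then show ?thesis using homeomorphism_cont2[OF h] continuous_on_cong[of "snd c ` fst c" _ "cinv c" h] by simp
qed

lemma is_chart_image_eq:
  assumes "is_chart c" shows "snd c ` (fst c \<inter> T) = snd c ` fst c \<inter> cinv c -` T"
proof -
  have "y \<in> snd c ` (fst c \<inter> T)" if "y \<in> snd c ` fst c" "cinv c y \<in> T" for y
    using chart_cinv[OF that(1)] that(2) by (metis IntI imageI)
  then show ?thesis using assms by auto
qed

lemma is_chart_open_image:
  assumes "is_chart c" "open T" shows "open (snd c ` (fst c \<inter> T))"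
  unfolding is_chart_image_eq[OF assms(1)]
  using continuous_open_preimage[OF is_chart_continuous_cinv[OF assms(1)] _ assms(2)] assms(1)
  unfolding is_chart_def by blast

lemma is_chart_open_preimage:
  assumes "is_chart c" "open T" shows "open (fst c \<inter> snd c -` T)"
  using continuous_open_preimage[OF is_chart_continuous[OF assms(1)] _ assms(2)] assms(1) unfolding is_chart_def by blast

lemma trans_smooth_on:
  assumes "compatible c d" shows "smooth_on (snd c ` (fst c \<inter> fst d)) (snd d \<circ> cinv c)"
  using assms unfolding compatible_def by blast

lemma compatible_sym: "compatible c d \<Longrightarrow> compatible d c"
  unfolding compatible_def by (simp add: Int_commute)

lemma trans_open: "is_chart c \<Longrightarrow> is_chart d \<Longrightarrow> open (snd c ` (fst c \<inter> fst d))"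
  by (rule is_chart_open_image) (auto simp: is_chart_def)

lemma trans_has_derivative:
  assumes "is_chart c" "is_chart d" "compatible c d" "x \<in> fst c" "x \<in> fst d"
  shows "((snd d \<circ> cinv c) has_derivative trans_deriv c d x) (at (snd c x))"
  unfolding trans_deriv_def
  using smooth_on_has_derivative[OF trans_open trans_smooth_on] assms by blast

lemma trans_deriv_linear:
  assumes "is_chart c" "is_chart d" "compatible c d" "x \<in> fst c" "x \<in> fst d"
  shows "linear (trans_deriv c d x)"
  using trans_has_derivative[OF assms] has_derivative_linear by blast

lemma trans_deriv_comp:
  assumes c: "is_chart c" "is_chart d" "is_chart e" and cd: "compatible c d" "compatible d e"
    and x: "x \<in> fst c" "x \<in> fst d" "x \<in> fst e"
  shows "trans_deriv d e x (trans_deriv c d x v) = trans_deriv c e x v"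
proof -
  have "((snd d \<circ> cinv c) has_derivative trans_deriv c d x) (at (snd c x))"
    by (intro trans_has_derivative c cd x)
  moreover have "((snd e \<circ> cinv d) has_derivative trans_deriv d e x) (at ((snd d \<circ> cinv c) (snd c x)))"
    using trans_has_derivative[OF c(2,3) cd(2) x(2,3)] c x by simp
  ultimately have "((snd e \<circ> cinv d) \<circ> (snd d \<circ> cinv c) has_derivative (trans_deriv d e x \<circ> trans_deriv c d x)) (at (snd c x))"
    by (rule diff_chain_at)
  then have "((snd e \<circ> cinv c) has_derivative (trans_deriv d e x \<circ> trans_deriv c d x)) (at (snd c x))"
    by (rule has_derivative_transform_within_open[where s="snd c ` (fst c \<inter> fst d)"])
       (use c x trans_open[OF c(1,2)] in auto)
  from frechet_derivativeI[OF this] show ?thesis unfolding trans_deriv_def by (simp add: fun_eq_iff)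
qed

lemma trans_deriv_self:
  assumes "is_chart c" "x \<in> fst c" shows "trans_deriv c c x v = v"
proof -
  have "((snd c \<circ> cinv c) has_derivative (\<lambda>v. v)) (at (snd c x))"
    by (rule has_derivative_transform_within_open[OF has_derivative_ident, where s="snd c ` fst c"])
       (use assms in \<open>auto simp: is_chart_def chart_cinv\<close>)
  from frechet_derivativeI[OF this] show ?thesis unfolding trans_deriv_def by simp
qed

lemma trans_deriv_inverse:
  assumes "is_chart c" "is_chart d" "compatible c d" "x \<in> fst c" "x \<in> fst d"
  shows "trans_deriv d c x (trans_deriv c d x v) = v"
  using trans_deriv_comp[OF assms(1,2,1,3) compatible_sym[OF assms(3)] assms(4,5,4), of v]
    trans_deriv_self[OF assms(1,4)] by simp

locale atlas =
  fixes A :: "('m::topological_space, 'e::euclidean_space) chart set"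
  assumes smooth_atlas: "smooth_atlas A"
begin

lemma atlas_chart: "c \<in> A \<Longrightarrow> is_chart c" and atlas_compatible: "c \<in> A \<Longrightarrow> d \<in> A \<Longrightarrow> compatible c d"
  using smooth_atlas unfolding smooth_atlas_def by auto

lemma atlas_smooth_chart: "c \<in> A \<Longrightarrow> smooth_chart A c"
  unfolding smooth_chart_def using atlas_chart atlas_compatible by blast

lemma chart_at: "chart_at A x \<in> A" "x \<in> fst (chart_at A x)"
proof -
  have "\<exists>c. c \<in> A \<and> x \<in> fst c" using smooth_atlas unfolding smooth_atlas_def by blast
  from someI_ex[OF this] show "chart_at A x \<in> A" "x \<in> fst (chart_at A x)" unfolding chart_at_def by auto
qed

lemma chart_at_is_chart [simp]: "is_chart (chart_at A x)" using atlas_chart chart_at by blast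

lemma smooth_chart_is_chart: "smooth_chart A c \<Longrightarrow> is_chart c"
  unfolding smooth_chart_def by simp

lemma smooth_chart_compatible: "smooth_chart A c \<Longrightarrow> d \<in> A \<Longrightarrow> compatible c d" "smooth_chart A c \<Longrightarrow> d \<in> A \<Longrightarrow> compatible d c"
  unfolding smooth_chart_def using compatible_sym by blast+

lemmas chart_rules = atlas_chart atlas_smooth_chart chart_at smooth_chart_is_chart smooth_chart_compatible

lemma to_comp_eq: "to_comp A c x = trans_deriv (chart_at A x) c x"
  unfolding to_comp_def trans_deriv_def pos_def ..

lemma of_comp_eq: "of_comp A c x = trans_deriv c (chart_at A x) x"
  unfolding of_comp_def trans_deriv_def ..

lemma linear_to_comp: "smooth_chart A c \<Longrightarrow> x \<in> fst c \<Longrightarrow> linear (to_comp A c x)"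
  unfolding to_comp_eq by (rule trans_deriv_linear) (blast intro: chart_rules)+

lemma linear_of_comp: "smooth_chart A c \<Longrightarrow> x \<in> fst c \<Longrightarrow> linear (of_comp A c x)"
  unfolding of_comp_eq by (rule trans_deriv_linear) (blast intro: chart_rules)+

lemma of_to_comp [simp]: "smooth_chart A c \<Longrightarrow> x \<in> fst c \<Longrightarrow> of_comp A c x (to_comp A c x u) = u"
  unfolding of_comp_eq to_comp_eq by (rule trans_deriv_inverse) (blast intro: chart_rules)+

lemma to_of_comp [simp]: "smooth_chart A c \<Longrightarrow> x \<in> fst c \<Longrightarrow> to_comp A c x (of_comp A c x u) = u"
  unfolding of_comp_eq to_comp_eq by (rule trans_deriv_inverse) (blast intro: chart_rules)+

text \<open>The chart at \<open>x\<close> varies arbitrarily with \<open>x\<close>. Passing between two fixed charts \<open>c\<close> and \<open>d\<close> no longer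
  involves it, so smoothness can be transferred from the charts of the atlas to \<open>c\<close>.\<close>

lemma to_comp_change:
  "smooth_chart A c \<Longrightarrow> d \<in> A \<Longrightarrow> x \<in> fst c \<Longrightarrow> x \<in> fst d \<Longrightarrow> to_comp A c x u = trans_deriv d c x (to_comp A d x u)"
  unfolding to_comp_eq by (rule trans_deriv_comp[symmetric]) (blast intro: chart_rules)+

lemma of_comp_change:
  "smooth_chart A c \<Longrightarrow> d \<in> A \<Longrightarrow> x \<in> fst c \<Longrightarrow> x \<in> fst d \<Longrightarrow> of_comp A c x u = of_comp A d x (trans_deriv c d x u)"
  unfolding of_comp_eq by (rule trans_deriv_comp[symmetric]) (blast intro: chart_rules)+

lemma of_comp_self: "of_comp A (chart_at A x) x u = u"
  unfolding of_comp_eq by (intro trans_deriv_self chart_at_is_chart chart_at)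

lemma vf_rep_at: "is_chart c \<Longrightarrow> x \<in> fst c \<Longrightarrow> vf_rep A c X (snd c x) = to_comp A c x (X x)"
  unfolding vf_rep_def by simp

lemma metric_rep_at: "is_chart c \<Longrightarrow> x \<in> fst c \<Longrightarrow> metric_rep A c g (snd c x) u v = g x (of_comp A c x u) (of_comp A c x v)"
  unfolding metric_rep_def by simp

lemma vf_rep_change:
  "smooth_chart A c \<Longrightarrow> d \<in> A \<Longrightarrow> x \<in> fst c \<Longrightarrow> x \<in> fst d \<Longrightarrow> 
    vf_rep A c X (snd c x) = trans_deriv d c x (vf_rep A d X (snd d x))"
  unfolding vf_rep_at[OF smooth_chart_is_chart] vf_rep_at[OF atlas_chart] by (rule to_comp_change)

lemma metric_rep_change:
  "smooth_chart A c \<Longrightarrow> d \<in> A \<Longrightarrow> x \<in> fst c \<Longrightarrow> x \<in> fst d \<Longrightarrow> 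
    metric_rep A c g (snd c x) u v = metric_rep A d g (snd d x) (trans_deriv c d x u) (trans_deriv c d x v)"
  unfolding metric_rep_at[OF smooth_chart_is_chart] metric_rep_at[OF atlas_chart]
  by (simp only: of_comp_change)

lemma metric_rep_to_comp:
  "smooth_chart A c \<Longrightarrow> x \<in> fst c \<Longrightarrow> metric_rep A c g (snd c x) (to_comp A c x u) (to_comp A c x v) = g x u v"
  unfolding metric_rep_at[OF smooth_chart_is_chart] by simp

lemma smooth_on_vf_rep:
  assumes c: "smooth_chart A c" and U: "open U" and X: "smooth_vf A U X"
  shows "smooth_on (snd c ` (fst c \<inter> U)) (vf_rep A c X)"
proof (rule smooth_on_local)
  fix y assume "y \<in> snd c ` (fst c \<inter> U)"
  then obtain x where x: "x \<in> fst c" "x \<in> U" and y: "y = snd c x" by blast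
  define d where "d = chart_at A x"
  have d: "d \<in> A" "x \<in> fst d" unfolding d_def by (rule chart_at)+
  note ic = smooth_chart_is_chart[OF c] atlas_chart[OF d(1)]
  let ?V = "snd c ` (fst c \<inter> (fst d \<inter> U))" and ?V' = "snd d ` (fst d \<inter> (fst c \<inter> U))"
  have V: "open ?V" "open ?V'" by (intro is_chart_open_image ic open_Int U; use ic in \<open>simp add: is_chart_def\<close>)+
  have tr: "smooth_on ?V (snd d \<circ> cinv c)" "smooth_on ?V' (snd c \<circ> cinv d)"
    by (rule smooth_on_subset[OF trans_smooth_on], intro chart_rules c d, blast)+
  have Xd: "smooth_on ?V' (vf_rep A d X)"
    using X d(1) unfolding smooth_vf_def by (blast intro: smooth_on_subset)
  have im: "(snd d \<circ> cinv c) ` ?V \<subseteq> ?V'" using ic by auto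
  have "smooth_on ?V' (\<lambda>z. frechet_derivative (snd c \<circ> cinv d) (at z) (vf_rep A d X z))"
    by (rule smooth_on_linear_family[OF V(2) _ _ Xd])
       (use smooth_on_has_derivative[OF V(2) tr(2)] has_derivative_linear smooth_on_deriv[OF V(2) tr(2)] in blast)+
  from smooth_on_compose[OF V this tr(1) im]
  have "smooth_on ?V (\<lambda>z. frechet_derivative (snd c \<circ> cinv d) (at ((snd d \<circ> cinv c) z)) (vf_rep A d X ((snd d \<circ> cinv c) z)))" .
  moreover have "vf_rep A c X z = frechet_derivative (snd c \<circ> cinv d) (at ((snd d \<circ> cinv c) z)) (vf_rep A d X ((snd d \<circ> cinv c) z))"
    if "z \<in> ?V" for z
  proof -
    from that obtain w where w: "w \<in> fst c" "w \<in> fst d" "z = snd c w" by blast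
    show ?thesis using vf_rep_change[OF c d(1) w(1,2)] w ic by (simp add: trans_deriv_def)
  qed
  ultimately have "smooth_on ?V (vf_rep A c X)" by (rule smooth_on_eqI)
  then have "smooth_on (snd c ` (fst c \<inter> U) \<inter> ?V) (vf_rep A c X)" by (rule smooth_on_subset) blast
  moreover have "y \<in> ?V" using x y d by blast
  ultimately show "\<exists>V. open V \<and> y \<in> V \<and> smooth_on (snd c ` (fst c \<inter> U) \<inter> V) (vf_rep A c X)"
    using V(1) by (intro exI[of _ ?V] conjI)
qed

end

locale riemannian = atlas A for A :: "('m::topological_space, 'e::euclidean_space) chart set" +
  fixes g :: "('m, 'e) tensor2"
  assumes riemannian: "riemannian_metric A g"
begin

lemma bilinear_g: "bilinear (g x)" and g_sym: "g x u v = g x v u" and g_pos: "u \<noteq> 0 \<Longrightarrow> g x u u > 0"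
  using riemannian unfolding riemannian_metric_def by blast+

lemma linear_g: "linear (g x u)" "linear (\<lambda>u. g x u v)"
  using bilinear_g unfolding bilinear_def by blast+

lemmas g_simps = linear_g[THEN linear_add] linear_g[THEN linear_diff] linear_g[THEN linear_cmul] linear_g[THEN linear_neg]
 linear_g[THEN linear_0] linear_g[THEN linear_sum]

lemma g_nondegenerate: "(\<And>v. g x u v = 0) \<Longrightarrow> u = 0"
  using g_pos[of u x] by fastforce

lemma bilinear_metric_rep: "smooth_chart A c \<Longrightarrow> y \<in> snd c ` fst c \<Longrightarrow> bilinear (metric_rep A c g y)"
proof -
  assume c: "smooth_chart A c" and y: "y \<in> snd c ` fst c"
  have l: "linear (of_comp A c (cinv c y))" using c y by (intro linear_of_comp) (auto simp: chart_cinv)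
  show ?thesis unfolding bilinear_def metric_rep_def
    using linear_compose[OF l linear_g(1)] linear_compose[OF l linear_g(2)] by (simp add: o_def)
qed

lemma metric_rep_sym: "metric_rep A c g y u v = metric_rep A c g y v u"
  unfolding metric_rep_def by (rule g_sym)

lemma metric_rep_pos:
  assumes "smooth_chart A c" "y \<in> snd c ` fst c" "u \<noteq> 0"
  shows "metric_rep A c g y u u > 0"
proof -
  have "of_comp A c (cinv c y) u \<noteq> 0"
    using to_of_comp[OF assms(1), of "cinv c y" u] linear_0[OF linear_to_comp[OF assms(1)]] assms(2,3)
    by (metis chart_cinv(2))
  then show ?thesis unfolding metric_rep_def by (rule g_pos)
qed

lemma smooth_on_metric_rep:
  assumes c: "smooth_chart A c"
  shows "smooth_on (snd c ` fst c) (\<lambda>y. metric_rep A c g y u v)"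
proof (rule smooth_on_local)
  fix y assume "y \<in> snd c ` fst c"
  then obtain x where x: "x \<in> fst c" and y: "y = snd c x" by blast
  define d where "d = chart_at A x"
  have d: "d \<in> A" "x \<in> fst d" unfolding d_def by (rule chart_at)+
  note ic = smooth_chart_is_chart[OF c] atlas_chart[OF d(1)]
  let ?V = "snd c ` (fst c \<inter> fst d)" and ?V' = "snd d ` fst d"
  have V: "open ?V" "open ?V'" using trans_open[OF ic] ic by (auto simp: is_chart_def)
  have tr: "smooth_on ?V (snd d \<circ> cinv c)" by (intro trans_smooth_on chart_rules c d)
  have im: "(snd d \<circ> cinv c) ` ?V \<subseteq> ?V'" using ic by auto
  have m: "smooth_on ?V' (\<lambda>y. metric_rep A d g y u v)" for u v
    using riemannian d(1) unfolding riemannian_metric_def by blast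
  have "smooth_on ?V (\<lambda>z. metric_rep A d g ((snd d \<circ> cinv c) z) (frechet_derivative (snd d \<circ> cinv c) (at z) u) (frechet_derivative (snd d \<circ> cinv c) (at z) v))"
    by (rule smooth_on_bilinear_family[OF V(1) _ smooth_on_compose[OF V m tr im]])
       (use im in \<open>auto intro!: smooth_on_deriv V tr bilinear_metric_rep atlas_smooth_chart d\<close>)
  moreover have "metric_rep A c g z u v = metric_rep A d g ((snd d \<circ> cinv c) z) (frechet_derivative (snd d \<circ> cinv c) (at z) u) (frechet_derivative (snd d \<circ> cinv c) (at z) v)"
    if "z \<in> ?V" for z
  proof -
    from that obtain w where w: "w \<in> fst c" "w \<in> fst d" "z = snd c w" by blast
    show ?thesis using metric_rep_change[OF c d(1) w(1,2)] w ic by (simp add: trans_deriv_def)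
  qed
  ultimately have "smooth_on ?V (\<lambda>z. metric_rep A c g z u v)" by (rule smooth_on_eqI)
  then have "smooth_on (snd c ` fst c \<inter> ?V) (\<lambda>z. metric_rep A c g z u v)" by (rule smooth_on_subset) blast
  moreover have "y \<in> ?V" using x y d by blast
  ultimately show "\<exists>V. open V \<and> y \<in> V \<and> smooth_on (snd c ` fst c \<inter> V) (\<lambda>y. metric_rep A c g y u v)"
    using V(1) by (intro exI[of _ ?V] conjI)
qed

end

section \<open>Symmetry of second derivatives and the Christoffel symbols\<close>

text \<open>Two applications of the mean value theorem, first in the direction \<open>u\<close>, then in the direction \<open>v\<close>.\<close>

lemma second_difference_mean_value:
  fixes f :: "'a::real_normed_vector \<Rightarrow> real"
  assumes S: "open S" and f: "smooth_on S f" and s: "s > 0"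
    and box: "\<And>a b. 0 \<le> a \<Longrightarrow> a \<le> s \<Longrightarrow> 0 \<le> b \<Longrightarrow> b \<le> s \<Longrightarrow> y + a *\<^sub>R u + b *\<^sub>R v \<in> S"
  obtains a b where "0 < a" "a < s" "0 < b" "b < s"
    "f (y + s *\<^sub>R u + s *\<^sub>R v) - f (y + s *\<^sub>R u) - f (y + s *\<^sub>R v) + f y =
      s * s * frechet_derivative (\<lambda>z. frechet_derivative f (at z) u) (at (y + a *\<^sub>R u + b *\<^sub>R v)) v"
proof -
  define fu where "fu z = frechet_derivative f (at z) u" for z
  have fu: "smooth_on S fu" unfolding fu_def by (rule smooth_on_deriv[OF S f])
  define \<phi> where "\<phi> r = f ((y + s *\<^sub>R v) + r *\<^sub>R u) - f (y + r *\<^sub>R u)" for r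
  have "DERIV \<phi> r :> fu ((y + s *\<^sub>R v) + r *\<^sub>R u) - fu (y + r *\<^sub>R u)" if "0 \<le> r" "r \<le> s" for r
  proof -
    have "(y + s *\<^sub>R v) + r *\<^sub>R u \<in> S" "y + r *\<^sub>R u \<in> S"
      using box[of r s] box[of r 0] that s by (simp_all add: add_ac)
    from DERIV_diff[OF DERIV_along_line[OF S f this(1)] DERIV_along_line[OF S f this(2)]]
    show ?thesis unfolding \<phi>_def[abs_def] fu_def .
  qed
  then obtain a where a: "0 < a" "a < s" "\<phi> s - \<phi> 0 = (s - 0) * (fu ((y + s *\<^sub>R v) + a *\<^sub>R u) - fu (y + a *\<^sub>R u))"
    using MVT2[OF s, of \<phi> "\<lambda>r. fu ((y + s *\<^sub>R v) + r *\<^sub>R u) - fu (y + r *\<^sub>R u)"] by auto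
  define \<psi> where "\<psi> r = fu ((y + a *\<^sub>R u) + r *\<^sub>R v)" for r
  have "DERIV \<psi> r :> frechet_derivative fu (at ((y + a *\<^sub>R u) + r *\<^sub>R v)) v" if "0 \<le> r" "r \<le> s" for r
    unfolding \<psi>_def by (rule DERIV_along_line[OF S fu]) (use box[of a r] that a in simp)
  then obtain b where b: "0 < b" "b < s" "\<psi> s - \<psi> 0 = (s - 0) * frechet_derivative fu (at ((y + a *\<^sub>R u) + b *\<^sub>R v)) v"
    using MVT2[OF s, of \<psi> "\<lambda>r. frechet_derivative fu (at ((y + a *\<^sub>R u) + r *\<^sub>R v)) v"] by auto
  have "\<phi> s - \<phi> 0 = s * (\<psi> s - \<psi> 0)" using a(3) unfolding \<psi>_def by (simp add: algebra_simps)
  then have "\<phi> s - \<phi> 0 = s * s * frechet_derivative fu (at (y + a *\<^sub>R u + b *\<^sub>R v)) v" using b(3) by simp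
  moreover have "\<phi> s - \<phi> 0 = f (y + s *\<^sub>R u + s *\<^sub>R v) - f (y + s *\<^sub>R u) - f (y + s *\<^sub>R v) + f y"
    unfolding \<phi>_def by (simp add: algebra_simps)
  ultimately show ?thesis using that a b unfolding fu_def[abs_def] by simp
qed

text \<open>The second difference is symmetric in \<open>u\<close> and \<open>v\<close>; dividing it by \<open>s\<^sup>2\<close> gives values, at nearby points,
  of both mixed derivatives.\<close>

lemma symmetric_second_derivative_real:
  fixes f :: "'a::real_normed_vector \<Rightarrow> real"
  assumes S: "open S" and f: "smooth_on S f" and y: "y \<in> S"
  shows "frechet_derivative (\<lambda>z. frechet_derivative f (at z) u) (at y) v =
    frechet_derivative (\<lambda>z. frechet_derivative f (at z) v) (at y) u"
proof (rule ccontr)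
  define F where "F z = frechet_derivative (\<lambda>z. frechet_derivative f (at z) u) (at z) v" for z
  define G where "G z = frechet_derivative (\<lambda>z. frechet_derivative f (at z) v) (at z) u" for z
  assume "\<not> ?thesis"
  then have ne: "F y \<noteq> G y" unfolding F_def G_def .
  define \<epsilon> where "\<epsilon> = \<bar>F y - G y\<bar> / 2"
  have \<epsilon>: "\<epsilon> > 0" using ne unfolding \<epsilon>_def by simp
  have "continuous_on S F" "continuous_on S G"
    unfolding F_def G_def by (intro smooth_on_imp_continuous_on smooth_on_deriv S f)+
  then have "isCont F y" "isCont G y" using S y continuous_on_eq_continuous_at by blast+
  then obtain d1 d2 where d: "d1 > 0" "\<And>z. dist z y < d1 \<Longrightarrow> dist (F z) (F y) < \<epsilon>"
    "d2 > 0" "\<And>z. dist z y < d2 \<Longrightarrow> dist (G z) (G y) < \<epsilon>"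
    using \<epsilon> unfolding continuous_at_eps_delta by blast
  obtain d3 where d3: "d3 > 0" "ball y d3 \<subseteq> S" using S y openE by blast
  define d where "d = min d1 (min d2 d3)"
  have dpos: "d > 0" "d \<le> d1" "d \<le> d2" "d \<le> d3" using d d3 unfolding d_def by auto
  obtain k where k: "k > 0" "norm u + norm v + 1 = k" using add_nonneg_pos[of "norm u + norm v" 1] that by simp
  define s where "s = d / (2 * k)"
  have s: "s > 0" "s * (norm u + norm v + 1) < d" using dpos(1) k(1) unfolding s_def k(2) by simp_all
  have near: "dist (y + a *\<^sub>R u + b *\<^sub>R v) y < d" if "0 \<le> a" "a \<le> s" "0 \<le> b" "b \<le> s" for a b
  proof -
    have "dist (y + a *\<^sub>R u + b *\<^sub>R v) y = norm (a *\<^sub>R u + b *\<^sub>R v)" by (simp add: dist_norm)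
    also have "\<dots> \<le> norm (a *\<^sub>R u) + norm (b *\<^sub>R v)" by (rule norm_triangle_ineq)
    also have "\<dots> = a * norm u + b * norm v" using that by simp
    also have "\<dots> \<le> s * norm u + s * norm v" using that by (intro add_mono mult_right_mono) auto
    also have "\<dots> \<le> s * (norm u + norm v + 1)" using s(1) by (simp add: algebra_simps)
    finally show ?thesis using s(2) by simp
  qed
  have inS: "y + a *\<^sub>R u + b *\<^sub>R v \<in> S" if "0 \<le> a" "a \<le> s" "0 \<le> b" "b \<le> s" for a b
    using near[OF that] d3(2) dpos(4) by (auto simp: dist_commute)
  have inS': "y + b *\<^sub>R v + a *\<^sub>R u \<in> S" if "0 \<le> b" "b \<le> s" "0 \<le> a" "a \<le> s" for a b
    using inS[OF that(3,4,1,2)] by (simp add: algebra_simps)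
  obtain a b where ab: "0 < a" "a < s" "0 < b" "b < s"
    "f (y + s *\<^sub>R u + s *\<^sub>R v) - f (y + s *\<^sub>R u) - f (y + s *\<^sub>R v) + f y = s * s * F (y + a *\<^sub>R u + b *\<^sub>R v)"
    unfolding F_def by (rule second_difference_mean_value[OF S f s(1) inS])
  obtain a' b' where ab': "0 < a'" "a' < s" "0 < b'" "b' < s"
    "f (y + s *\<^sub>R v + s *\<^sub>R u) - f (y + s *\<^sub>R v) - f (y + s *\<^sub>R u) + f y = s * s * G (y + a' *\<^sub>R v + b' *\<^sub>R u)"
    unfolding G_def by (rule second_difference_mean_value[OF S f s(1) inS'])
  have "s * s * F (y + a *\<^sub>R u + b *\<^sub>R v) = s * s * G (y + a' *\<^sub>R v + b' *\<^sub>R u)"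
    using ab(5) ab'(5) by (simp add: algebra_simps)
  then have "F (y + a *\<^sub>R u + b *\<^sub>R v) = G (y + b' *\<^sub>R u + a' *\<^sub>R v)" using s(1) by (simp add: algebra_simps)
  moreover have "dist (F (y + a *\<^sub>R u + b *\<^sub>R v)) (F y) < \<epsilon>" using d(2) near[of a b] ab dpos by simp
  moreover have "dist (G (y + b' *\<^sub>R u + a' *\<^sub>R v)) (G y) < \<epsilon>" using d(4) near[of b' a'] ab' dpos by simp
  ultimately have "\<bar>F y - G y\<bar> < 2 * \<epsilon>" unfolding dist_real_def by linarith
  then show False unfolding \<epsilon>_def by simp
qed

lemma frechet_derivative_inner:
  assumes "f differentiable (at x)"
  shows "frechet_derivative (\<lambda>z. f z \<bullet> b) (at x) u = frechet_derivative f (at x) u \<bullet> b"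
  using frechet_derivativeI[OF has_derivative_inner_left[OF frechet_derivative_works[THEN iffD1, OF assms]]] by simp

lemma symmetric_second_derivative:
  fixes f :: "'a::real_normed_vector \<Rightarrow> 'b::euclidean_space"
  assumes S: "open S" and f: "smooth_on S f" and y: "y \<in> S"
  shows "frechet_derivative (\<lambda>z. frechet_derivative f (at z) u) (at y) v =
    frechet_derivative (\<lambda>z. frechet_derivative f (at z) v) (at y) u"
proof (rule euclidean_eqI)
  fix b :: 'b
  have "frechet_derivative (\<lambda>z. frechet_derivative f (at z) u) (at y) v \<bullet> b =
     frechet_derivative (\<lambda>z. frechet_derivative (\<lambda>z. f z \<bullet> b) (at z) u) (at y) v" for u v
  proof -
    have "frechet_derivative (\<lambda>z. frechet_derivative f (at z) u) (at y) v \<bullet> b = frechet_derivative (\<lambda>z. frechet_derivative f (at z) u \<bullet> b) (at y) v"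
      by (rule frechet_derivative_inner[symmetric]) (rule smooth_on_differentiable[OF S smooth_on_deriv[OF S f] y])
    also have "frechet_derivative (\<lambda>z. frechet_derivative f (at z) u \<bullet> b) (at y) = frechet_derivative (\<lambda>z. frechet_derivative (\<lambda>z. f z \<bullet> b) (at z) u) (at y)"
      by (rule frechet_derivative_cong_open[OF S y]) (rule frechet_derivative_inner[symmetric, OF smooth_on_differentiable[OF S f]])
    finally show ?thesis .
  qed
  then show "frechet_derivative (\<lambda>z. frechet_derivative f (at z) u) (at y) v \<bullet> b = frechet_derivative (\<lambda>z. frechet_derivative f (at z) v) (at y) u \<bullet> b"
    using symmetric_second_derivative_real[OF S smooth_on_inner_const[OF S f] y, of b u v] by simp
qed

text \<open>The product rule for \<open>B y (p y) (q y)\<close>, where only the components of the bilinear maps \<open>B y\<close> are known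
  to be differentiable.\<close>

lemma has_derivative_bilinear_family:
  fixes B :: "'a::real_normed_vector \<Rightarrow> 'b::euclidean_space \<Rightarrow> 'c::euclidean_space \<Rightarrow> 'd::real_normed_vector"
  assumes S: "open S" "y0 \<in> S" and B: "\<And>y. y \<in> S \<Longrightarrow> bilinear (B y)"
    and dB: "\<And>u v. (\<lambda>y. B y u v) differentiable (at y0)"
    and p: "(p has_derivative p') (at y0)" and q: "(q has_derivative q') (at y0)"
  shows "((\<lambda>y. B y (p y) (q y)) has_derivative
    (\<lambda>h. frechet_derivative (\<lambda>y. B y (p y0) (q y0)) (at y0) h + B y0 (p' h) (q y0) + B y0 (p y0) (q' h))) (at y0)"
proof -
  define dBf where "dBf u v = frechet_derivative (\<lambda>y. B y u v) (at y0)" for u v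
  have dBh: "((\<lambda>y. B y u v) has_derivative dBf u v) (at y0)" for u v
    unfolding dBf_def using dB frechet_derivative_works by blast
  have dsum: "dBf u v h = (\<Sum>i\<in>Basis. \<Sum>j\<in>Basis. (u \<bullet> i) *\<^sub>R (v \<bullet> j) *\<^sub>R dBf i j h)" for u v h
  proof -
    have "((\<lambda>y. \<Sum>i\<in>Basis. \<Sum>j\<in>Basis. (u \<bullet> i) *\<^sub>R (v \<bullet> j) *\<^sub>R B y i j) has_derivative
         (\<lambda>h. \<Sum>i\<in>Basis. \<Sum>j\<in>Basis. (u \<bullet> i) *\<^sub>R (v \<bullet> j) *\<^sub>R dBf i j h)) (at y0)"
      by (intro has_derivative_sum has_derivative_scaleR_right dBh)
    then have "((\<lambda>y. B y u v) has_derivative (\<lambda>h. \<Sum>i\<in>Basis. \<Sum>j\<in>Basis. (u \<bullet> i) *\<^sub>R (v \<bullet> j) *\<^sub>R dBf i j h)) (at y0)"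
      by (rule has_derivative_transform_within_open[OF _ S]) (simp add: bilinear_basis_sum[OF B])
    from has_derivative_unique[OF dBh this] show ?thesis by (simp add: fun_eq_iff)
  qed
  have "((\<lambda>y. \<Sum>i\<in>Basis. \<Sum>j\<in>Basis. (p y \<bullet> i) *\<^sub>R (q y \<bullet> j) *\<^sub>R B y i j) has_derivative
     (\<lambda>h. \<Sum>i\<in>Basis. \<Sum>j\<in>Basis. (p y0 \<bullet> i) *\<^sub>R ((q y0 \<bullet> j) *\<^sub>R dBf i j h + (q' h \<bullet> j) *\<^sub>R B y0 i j) + (p' h \<bullet> i) *\<^sub>R (q y0 \<bullet> j) *\<^sub>R B y0 i j)) (at y0)"
    by (intro has_derivative_sum has_derivative_scaleR dBh has_derivative_inner_left p q)
  then have "((\<lambda>y. B y (p y) (q y)) has_derivative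
     (\<lambda>h. \<Sum>i\<in>Basis. \<Sum>j\<in>Basis. (p y0 \<bullet> i) *\<^sub>R ((q y0 \<bullet> j) *\<^sub>R dBf i j h + (q' h \<bullet> j) *\<^sub>R B y0 i j) + (p' h \<bullet> i) *\<^sub>R (q y0 \<bullet> j) *\<^sub>R B y0 i j)) (at y0)"
    by (rule has_derivative_transform_within_open[OF _ S]) (rule bilinear_basis_sum[OF B, symmetric])
  then show ?thesis
  proof (rule has_derivative_eq_rhs)
    show "(\<lambda>h. \<Sum>i\<in>Basis. \<Sum>j\<in>Basis. (p y0 \<bullet> i) *\<^sub>R ((q y0 \<bullet> j) *\<^sub>R dBf i j h + (q' h \<bullet> j) *\<^sub>R B y0 i j) + (p' h \<bullet> i) *\<^sub>R (q y0 \<bullet> j) *\<^sub>R B y0 i j)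
      = (\<lambda>h. frechet_derivative (\<lambda>y. B y (p y0) (q y0)) (at y0) h + B y0 (p' h) (q y0) + B y0 (p y0) (q' h))"
      unfolding dBf_def[symmetric] dsum[of "p y0" "q y0"] bilinear_basis_sum[OF B[OF S(2)], of _ "q y0"]
        bilinear_basis_sum[OF B[OF S(2)], of "p y0" "q' _"]
      by (simp only: sum.distrib scaleR_add_right add_ac)
  qed
qed

lemma has_derivative_linear_family:
  fixes L :: "'a::real_normed_vector \<Rightarrow> 'b::euclidean_space \<Rightarrow> 'd::real_normed_vector"
  assumes S: "open S" "y0 \<in> S" and L: "\<And>y. y \<in> S \<Longrightarrow> linear (L y)"
    and dL: "\<And>u. (\<lambda>y. L y u) differentiable (at y0)" and p: "(p has_derivative p') (at y0)"
  shows "((\<lambda>y. L y (p y)) has_derivative (\<lambda>h. frechet_derivative (\<lambda>y. L y (p y0)) (at y0) h + L y0 (p' h))) (at y0)"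
proof -
  have 1: "bilinear (\<lambda>(r::real) v. r *\<^sub>R L y v)" if "y \<in> S" for y
    unfolding bilinear_def using L[OF that]
    by (auto intro!: linearI simp: linear_add linear_cmul scaleR_add_left scaleR_add_right)
  have 2: "(\<lambda>y. r *\<^sub>R L y u) differentiable (at y0)" for r u by (intro differentiable_scaleR differentiable_const dL)
  have "((\<lambda>y. (1::real) *\<^sub>R L y (p y)) has_derivative
     (\<lambda>h. frechet_derivative (\<lambda>y. (1::real) *\<^sub>R L y (p y0)) (at y0) h + (0::real) *\<^sub>R L y0 (p y0) + (1::real) *\<^sub>R L y0 (p' h))) (at y0)"
    by (rule has_derivative_bilinear_family[OF S 1 2 has_derivative_const[of "1::real"] p])
  then show ?thesis by simp
qed

context riemannian
begin

text \<open>The classical \<open>\<partial>\<^sub>u g\<^sub>v\<^sub>w\<close>, where \<open>u\<close>, \<open>v\<close>, \<open>w\<close> are constant in the chart \<open>c\<close>.\<close>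

definition dmetric :: "('m, 'e) chart \<Rightarrow> 'e \<Rightarrow> 'e \<Rightarrow> 'e \<Rightarrow> 'e \<Rightarrow> real" where
  "dmetric c y u v w = frechet_derivative (\<lambda>z. metric_rep A c g z v w) (at y) u"

lemma smooth_chart_open: "smooth_chart A c \<Longrightarrow> open (snd c ` fst c)"
  using smooth_chart_is_chart unfolding is_chart_def by blast

lemma dmetric_has_derivative:
  assumes "smooth_chart A c" "y \<in> snd c ` fst c"
  shows "((\<lambda>z. metric_rep A c g z v w) has_derivative (\<lambda>u. dmetric c y u v w)) (at y)"
  unfolding dmetric_def using smooth_on_has_derivative[OF smooth_chart_open smooth_on_metric_rep] assms by blast

lemma dmetric_sym: "dmetric c y u v w = dmetric c y u w v"
  unfolding dmetric_def by (subst metric_rep_sym) (rule refl)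

lemma linear_dmetric1: "smooth_chart A c \<Longrightarrow> y \<in> snd c ` fst c \<Longrightarrow> linear (\<lambda>u. dmetric c y u v w)"
  using dmetric_has_derivative has_derivative_linear by blast

lemma linear_dmetric3:
  assumes c: "smooth_chart A c" and y: "y \<in> snd c ` fst c"
  shows "linear (\<lambda>w. dmetric c y u v w)"
proof -
  note o = smooth_chart_open[OF c]
  have l: "linear (metric_rep A c g z v)" if "z \<in> snd c ` fst c" for z
    using bilinear_metric_rep[OF c that] unfolding bilinear_def by blast
  note D = dmetric_has_derivative[OF c y]
  show ?thesis
  proof (rule linearI)
    fix w1 w2 r
    have "((\<lambda>z. metric_rep A c g z v (w1 + w2)) has_derivative (\<lambda>u. dmetric c y u v w1 + dmetric c y u v w2)) (at y)"
      by (rule has_derivative_transform_within_open[OF has_derivative_add[OF D[of v w1] D[of v w2]] o y]) (simp add: linear_add[OF l])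
    from fun_cong[OF has_derivative_unique[OF D this]] show "dmetric c y u v (w1 + w2) = dmetric c y u v w1 + dmetric c y u v w2" .
    have "((\<lambda>z. metric_rep A c g z v (r *\<^sub>R w1)) has_derivative (\<lambda>u. r *\<^sub>R dmetric c y u v w1)) (at y)"
      by (rule has_derivative_transform_within_open[OF has_derivative_scaleR_right[OF D[of v w1]] o y]) (simp add: linear_cmul[OF l])
    from fun_cong[OF has_derivative_unique[OF D this]] show "dmetric c y u v (r *\<^sub>R w1) = r *\<^sub>R dmetric c y u v w1" .
  qed
qed

lemma linear_dmetric2: "smooth_chart A c \<Longrightarrow> y \<in> snd c ` fst c \<Longrightarrow> linear (\<lambda>v. dmetric c y u v w)"
  by (subst dmetric_sym) (rule linear_dmetric3)

lemma bilinear_dmetric: "smooth_chart A c \<Longrightarrow> y \<in> snd c ` fst c \<Longrightarrow> bilinear (dmetric c y u)"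
  unfolding bilinear_def using linear_dmetric2 linear_dmetric3 by blast

lemma metric_has_derivative:
  assumes "smooth_chart A c" "y \<in> snd c ` fst c" "(p has_derivative p') (at y)" "(q has_derivative q') (at y)"
  shows "((\<lambda>z. metric_rep A c g z (p z) (q z)) has_derivative
    (\<lambda>h. dmetric c y h (p y) (q y) + metric_rep A c g y (p' h) (q y) + metric_rep A c g y (p y) (q' h))) (at y)"
  unfolding dmetric_def
  by (rule has_derivative_bilinear_family[OF smooth_chart_open[OF assms(1)] assms(2) bilinear_metric_rep[OF assms(1)] _ assms(3,4)])
     (use smooth_on_differentiable[OF smooth_chart_open[OF assms(1)] smooth_on_metric_rep[OF assms(1)] assms(2)] in auto)

lemma riesz:
  assumes "linear \<phi>" obtains a where "\<And>w. g x a w = \<phi> w"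
proof -
  define T where "T a = (\<Sum>b\<in>Basis. g x a b *\<^sub>R b)" for a :: 'e
  have T: "T a \<bullet> b = g x a b" if "b \<in> Basis" for a b
    using that unfolding T_def by (simp add: inner_sum_left inner_Basis if_distrib sum.delta cong: if_cong)
  have lT: "linear T" unfolding T_def by (rule linearI) (simp_all add: g_simps scaleR_add_left sum.distrib scaleR_sum_right)
  have "a = 0" if "T a = 0" for a
  proof (rule g_nondegenerate)
    fix v
    have "g x a b = 0" if "b \<in> Basis" for b using T[OF that, of a] \<open>T a = 0\<close> by simp
    then show "g x a v = 0" using linear_basis_sum[OF linear_g(1), of x a v] by simp
  qed
  then have "inj T" using linear_injective_0[OF lT] by blast
  then have "surj T" using linear_injective_imp_surjective[OF lT] by blast
  then obtain a where a: "T a = (\<Sum>b\<in>Basis. \<phi> b *\<^sub>R b)" by (metis surjD)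
  have "g x a b = \<phi> b" if "b \<in> Basis" for b
    using T[OF that, of a] that unfolding a by (simp add: inner_sum_left inner_Basis if_distrib sum.delta cong: if_cong)
  then have "g x a w = \<phi> w" for w
    using linear_basis_sum[OF linear_g(1), of x a w] linear_basis_sum[OF assms, of w] by simp
  then show ?thesis using that by blast
qed

lemma g_eqI: "(\<And>w. g x a w = g x b w) \<Longrightarrow> a = b"
  using g_nondegenerate[of x "a - b"] by (simp add: g_simps)

text \<open>Koszul's formula determines \<open>g (\<Gamma> u v) w\<close> from \<open>\<partial>g\<close>, and the Riesz representation of a linear functional
  by \<open>g\<close> turns it into a definition; hence the description in the definition of \<open>christoffel\<close> is proper.\<close>

lemma christoffel:
  shows christoffel_sym: "christoffel A g x u v = christoffel A g x v u"
    and christoffel_metric: "dmetric (chart_at A x) (pos A x) u v w = g x (christoffel A g x u v) w + g x v (christoffel A g x u w)"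
proof -
  let ?c = "chart_at A x" and ?y = "pos A x"
  have c: "smooth_chart A ?c" using atlas_smooth_chart chart_at(1) by blast
  have y: "?y \<in> snd ?c ` fst ?c" unfolding pos_def using chart_at(2) by blast
  let ?d = "dmetric ?c ?y"
  note l1 = linear_dmetric1[OF c y] and l2 = linear_dmetric2[OF c y] and l3 = linear_dmetric3[OF c y]
  note lin = l1[THEN linear_add] l2[THEN linear_add] l3[THEN linear_add] l1[THEN linear_cmul] l2[THEN linear_cmul] l3[THEN linear_cmul]
  let ?P = "\<lambda>G. bilinear G \<and> (\<forall>u v. G u v = G v u) \<and> (\<forall>u v w. ?d u v w = g x (G u v) w + g x v (G u w))"
  define \<phi> where "\<phi> u v w = (?d u v w + ?d v u w - ?d w u v) / 2" for u v w
  have "linear (\<phi> u v)" for u v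
    unfolding \<phi>_def by (rule linearI) (simp_all add: lin algebra_simps add_divide_distrib diff_divide_distrib)
  then have "\<exists>a. \<forall>w. g x a w = \<phi> u v w" for u v using riesz by metis
  then obtain G where G: "\<And>u v w. g x (G u v) w = \<phi> u v w" by metis
  have "bilinear G" unfolding bilinear_def
    by (intro conjI allI linearI; rule g_eqI[of x])
       (simp_all add: g_simps G, simp_all add: \<phi>_def lin algebra_simps add_divide_distrib diff_divide_distrib)
  moreover have "G u v = G v u" for u v
    by (rule g_eqI[of x]) (simp add: G \<phi>_def dmetric_sym[of _ _ _ u v])
  moreover have "?d u v w = g x (G u v) w + g x v (G u w)" for u v w
    unfolding g_sym[of x v] G \<phi>_def using dmetric_sym[of ?c ?y u v w] dmetric_sym[of ?c ?y v u w] dmetric_sym[of ?c ?y w u v]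
    by (simp add: field_simps)
  ultimately have PG: "?P G" by blast
  have uniq: "G' = G" if P: "?P G'" for G'
  proof (intro ext, rule g_eqI[of x])
    fix u v w
    have s: "G' u v = G' v u" "G' w u = G' u w" "G' w v = G' v w" using P by blast+
    have "?d u v w = g x (G' u v) w + g x v (G' u w)" "?d v u w = g x (G' v u) w + g x u (G' v w)"
       "?d w u v = g x (G' w u) v + g x u (G' w v)" using P by blast+
    then show "g x (G' u v) w = g x (G u v) w"
      unfolding G \<phi>_def s using g_sym[of x v "G' u w"] by simp
  qed
  have "\<exists>!G. ?P G" by (rule ex1I[of ?P, OF PG uniq])
  from theI'[OF this] have "?P (christoffel A g x)"
    unfolding christoffel_def dmetric_def .
  then show "christoffel A g x u v = christoffel A g x v u"
     "?d u v w = g x (christoffel A g x u v) w + g x v (christoffel A g x u w)" by blast+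
qed

end

section \<open>The Levi-Civita connection and the second fundamental tensor in charts\<close>

context riemannian
begin

text \<open>The connection is defined in the chart at \<open>x\<close>, but both the second fundamental tensor and the
  divergence are computed in charts adapted to the foliation. The predicate says that \<open>G\<close> plays the role
  of the Christoffel symbols in the chart \<open>c\<close>. Symmetry and compatibility with
  the metric characterise them.\<close>

definition chart_christoffel :: "('m, 'e) chart \<Rightarrow> 'm \<Rightarrow> ('e \<Rightarrow> 'e \<Rightarrow> 'e) \<Rightarrow> bool" where
  "chart_christoffel c x G \<longleftrightarrow> (\<forall>u v. G u v = G v u) \<and>
    (\<forall>u v w. dmetric c (snd c x) u v w = metric_rep A c g (snd c x) (G u v) w + metric_rep A c g (snd c x) v (G u w)) \<and>
    (\<forall>X Y. vf_rep A c Y differentiable (at (snd c x)) \<longrightarrow>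
      to_comp A c x (levi_civita A g X Y x) =
        frechet_derivative (vf_rep A c Y) (at (snd c x)) (to_comp A c x (X x)) + G (to_comp A c x (X x)) (to_comp A c x (Y x)))"

lemma chart_christoffelD:
  assumes "chart_christoffel c x G"
  shows "G u v = G v u"
    "dmetric c (snd c x) u v w = metric_rep A c g (snd c x) (G u v) w + metric_rep A c g (snd c x) v (G u w)"
    "vf_rep A c Y differentiable (at (snd c x)) \<Longrightarrow> to_comp A c x (levi_civita A g X Y x) =
        frechet_derivative (vf_rep A c Y) (at (snd c x)) (to_comp A c x (X x)) + G (to_comp A c x (X x)) (to_comp A c x (Y x))"
  using assms unfolding chart_christoffel_def by blast+

text \<open>The second derivative \<open>S\<close> of the coordinate change enters both the derivative of a vector field and
  the derivative of the metric. Since it is symmetric, adding it to the Christoffel symbols of the chart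
  at \<open>x\<close> preserves torsion-freeness.\<close>

lemma levi_civita_in_chart:
  assumes c: "smooth_chart A c" and x: "x \<in> fst c"
  obtains G where "chart_christoffel c x G"
proof -
  define d where "d = chart_at A x"
  have d: "d \<in> A" "x \<in> fst d" unfolding d_def by (rule chart_at)+
  have sd: "smooth_chart A d" by (rule atlas_smooth_chart[OF d(1)])
  note ic = smooth_chart_is_chart[OF c] atlas_chart[OF d(1)]
  define s where "s = snd d \<circ> cinv c"
  define k where "k = snd c \<circ> cinv d"
  let ?V = "snd c ` (fst c \<inter> fst d)" and ?V' = "snd d ` (fst d \<inter> fst c)"
  let ?y = "snd c x" and ?z = "snd d x"
  have V: "open ?V" "open ?V'" using trans_open ic by blast+
  have sV: "smooth_on ?V s" unfolding s_def by (intro trans_smooth_on chart_rules c d)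
  have yV: "?y \<in> ?V" "?z \<in> ?V'" using x d by auto
  define S where "S a b = frechet_derivative (\<lambda>z. frechet_derivative s (at z) b) (at ?y) a" for a b
  note Ds = smooth_on_has_derivative[OF V(1) sV]
  have linDs: "linear (frechet_derivative s (at y))" if "y \<in> ?V" for y
    using Ds[OF that] has_derivative_linear by blast
  have diffDs: "(\<lambda>z. frechet_derivative s (at z) b) differentiable (at ?y)" for b
    by (rule smooth_on_differentiable[OF V(1) smooth_on_deriv[OF V(1) sV] yV(1)])
  have Ssym: "S a b = S b a" for a b
    unfolding S_def by (rule symmetric_second_derivative[OF V(1) sV yV(1)])
  have s'_eq: "frechet_derivative s (at ?y) = of_comp A c x"
    unfolding of_comp_eq trans_deriv_def s_def d_def ..
  have k'_eq: "frechet_derivative k (at ?z) = to_comp A c x"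
    unfolding to_comp_eq trans_deriv_def k_def d_def ..
  let ?s = "of_comp A c x" and ?k = "to_comp A c x" and ?\<Gamma> = "christoffel A g x"
  note lk = linear_to_comp[OF c x]
  have sk [simp]: "?s (?k a) = a" "?k (?s a) = a" for a using c x by simp_all
  define G where "G a b = ?k (S a b + ?\<Gamma> (?s a) (?s b))" for a b
  have sG: "?s (G a b) = S a b + ?\<Gamma> (?s a) (?s b)" for a b unfolding G_def by simp
  have metric_y: "metric_rep A c g ?y u v = g x (?s u) (?s v)" for u v
    by (rule metric_rep_at[OF ic(1) x])
  have posd: "pos A x = ?z" "chart_at A x = d" unfolding pos_def d_def by simp_all
  have "chart_christoffel c x G"
    unfolding chart_christoffel_def
  proof (intro conjI allI impI)
    show Gsym: "G u v = G v u" for u v unfolding G_def using Ssym[of u v] christoffel_sym[of x "?s u" "?s v"] by simp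
    show "dmetric c ?y u v w = metric_rep A c g ?y (G u v) w + metric_rep A c g ?y v (G u w)" for u v w
    proof -
      have D1: "((\<lambda>y. frechet_derivative s (at y) v) has_derivative (\<lambda>a. S a v)) (at ?y)" for v
        unfolding S_def using diffDs frechet_derivative_works by blast
      have sy: "s ?y = ?z" using ic x d unfolding s_def by simp
      have "((\<lambda>y. metric_rep A d g (s y) (frechet_derivative s (at y) v) (frechet_derivative s (at y) w)) has_derivative
         (\<lambda>h. dmetric d ?z (?s h) (?s v) (?s w) + g x (S h v) (?s w) + g x (?s v) (S h w))) (at ?y)"
      proof -
        have im: "s ` ?V \<subseteq> snd d ` fst d" unfolding s_def using ic by auto
        have zd: "?z \<in> snd d ` fst d" using d by blast
        have comp: "((\<lambda>y. metric_rep A d g (s y) a b) has_derivative (\<lambda>h. dmetric d ?z (?s h) a b)) (at ?y)" for a b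
        proof -
          have "(s has_derivative ?s) (at ?y)" using Ds[OF yV(1)] unfolding s'_eq .
          from has_derivative_compose[OF this, of "\<lambda>z. metric_rep A d g z a b"] dmetric_has_derivative[OF sd zd]
          show ?thesis unfolding sy by blast
        qed
        have "((\<lambda>y. metric_rep A d g (s y) (frechet_derivative s (at y) v) (frechet_derivative s (at y) w)) has_derivative
         (\<lambda>h. frechet_derivative (\<lambda>y. metric_rep A d g (s y) (frechet_derivative s (at ?y) v) (frechet_derivative s (at ?y) w)) (at ?y) h
           + metric_rep A d g (s ?y) (S h v) (frechet_derivative s (at ?y) w) + metric_rep A d g (s ?y) (frechet_derivative s (at ?y) v) (S h w))) (at ?y)"
        proof (rule has_derivative_bilinear_family[OF V(1) yV(1) _ _ D1 D1])
          show "bilinear (metric_rep A d g (s y))" if "y \<in> ?V" for y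
            by (rule bilinear_metric_rep[OF sd]) (use im that in blast)
          show "(\<lambda>y. metric_rep A d g (s y) a b) differentiable (at ?y)" for a b
            by (rule differentiableI[OF comp])
        qed
        then show ?thesis
        proof (rule has_derivative_eq_rhs)
          have m: "metric_rep A d g ?z a b = g x a b" for a b
            using metric_rep_at[OF ic(2) d(2), of g a b] of_comp_self unfolding d_def by simp
          show "(\<lambda>h. frechet_derivative (\<lambda>y. metric_rep A d g (s y) (frechet_derivative s (at ?y) v) (frechet_derivative s (at ?y) w)) (at ?y) h
           + metric_rep A d g (s ?y) (S h v) (frechet_derivative s (at ?y) w) + metric_rep A d g (s ?y) (frechet_derivative s (at ?y) v) (S h w))
           = (\<lambda>h. dmetric d ?z (?s h) (?s v) (?s w) + g x (S h v) (?s w) + g x (?s v) (S h w))"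
            unfolding frechet_derivativeI[OF comp] s'_eq sy m ..
        qed
      qed
      then have "((\<lambda>y. metric_rep A c g y v w) has_derivative
         (\<lambda>h. dmetric d ?z (?s h) (?s v) (?s w) + g x (S h v) (?s w) + g x (?s v) (S h w))) (at ?y)"
      proof (rule has_derivative_transform_within_open[OF _ V(1) yV(1)])
        fix y assume "y \<in> ?V"
        then obtain a where a: "a \<in> fst c" "a \<in> fst d" "y = snd c a" by blast
        show "metric_rep A d g (s y) (frechet_derivative s (at y) v) (frechet_derivative s (at y) w) = metric_rep A c g y v w"
          using metric_rep_change[OF c d(1) a(1,2)] a ic unfolding s_def trans_deriv_def by simp
      qed
      from frechet_derivativeI[OF this]
      have "dmetric c ?y u v w = dmetric d ?z (?s u) (?s v) (?s w) + g x (S u v) (?s w) + g x (?s v) (S u w)"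
        unfolding dmetric_def by metis
      also have "dmetric d ?z (?s u) (?s v) (?s w) = g x (?\<Gamma> (?s u) (?s v)) (?s w) + g x (?s v) (?\<Gamma> (?s u) (?s w))"
        using christoffel_metric[of x "?s u" "?s v" "?s w"] unfolding posd .
      finally show ?thesis unfolding metric_y sG by (simp add: g_simps)
    qed
    show "?k (levi_civita A g X Y x) = frechet_derivative (vf_rep A c Y) (at ?y) (?k (X x)) + G (?k (X x)) (?k (Y x))"
      if Y: "vf_rep A c Y differentiable (at ?y)" for X Y
    proof -
      let ?DY = "frechet_derivative (vf_rep A c Y) (at ?y)"
      have DY: "(vf_rep A c Y has_derivative ?DY) (at ?y)" using Y frechet_derivative_works by blast
      have vy: "vf_rep A c Y ?y = ?k (Y x)" by (rule vf_rep_at[OF ic(1) x])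
      have 1: "((\<lambda>y. frechet_derivative s (at y) (vf_rep A c Y y)) has_derivative (\<lambda>h. S h (?k (Y x)) + ?s (?DY h))) (at ?y)"
        using has_derivative_linear_family[OF V(1) yV(1) linDs diffDs DY] unfolding S_def s'_eq vy .
      have kz: "k ?z = ?y" using ic x d unfolding k_def by simp
      have "(k has_derivative ?k) (at ?z)"
        unfolding k'_eq[symmetric] k_def 
        by (rule smooth_on_has_derivative[OF V(2) trans_smooth_on yV(2)]) (intro chart_rules c d)
      from has_derivative_compose[OF this, of "\<lambda>y. frechet_derivative s (at y) (vf_rep A c Y y)"] 1
      have "((\<lambda>z. frechet_derivative s (at (k z)) (vf_rep A c Y (k z))) has_derivative (\<lambda>h. S (?k h) (?k (Y x)) + ?s (?DY (?k h)))) (at ?z)"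
        unfolding kz by blast
      then have "(vf_rep A d Y has_derivative (\<lambda>h. S (?k h) (?k (Y x)) + ?s (?DY (?k h)))) (at ?z)"
      proof (rule has_derivative_transform_within_open[OF _ V(2) yV(2)])
        fix z assume "z \<in> ?V'"
        then obtain a where a: "a \<in> fst c" "a \<in> fst d" "z = snd d a" by blast
        have "trans_deriv c d a (trans_deriv d c a (vf_rep A d Y (snd d a))) = vf_rep A d Y (snd d a)"
          by (rule trans_deriv_inverse) (use a ic c d chart_rules in blast)+
        then show "frechet_derivative s (at (k z)) (vf_rep A c Y (k z)) = vf_rep A d Y z"
          using vf_rep_change[OF c d(1) a(1,2), of Y] a ic unfolding s_def k_def trans_deriv_def by simp
      qed
      from frechet_derivativeI[OF this]
      have "vf_deriv A Y x (X x) = S (?k (X x)) (?k (Y x)) + ?s (?DY (?k (X x)))"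
        unfolding vf_deriv_def posd by simp
      then have "levi_civita A g X Y x = ?s (?DY (?k (X x))) + ?s (G (?k (X x)) (?k (Y x)))"
        unfolding levi_civita_def sG by (simp add: add_ac)
      then show ?thesis by (simp add: linear_add[OF lk])
    qed
  qed
  then show ?thesis by (rule that)
qed

lemma smooth_section_differentiable:
  assumes "smooth_chart A c" "open U" "smooth_vf A U X" "x \<in> fst c" "x \<in> U"
  shows "vf_rep A c X differentiable (at (snd c x))"
  by (rule smooth_on_differentiable[OF is_chart_open_image smooth_on_vf_rep])
     (use assms smooth_chart_is_chart in auto)

text \<open>This is \<open>(L\<^sub>H g)(X, X) / 2\<close>. Written in this way it contains no Christoffel symbols.\<close>

lemma divergence_term:
  assumes c: "smooth_chart A c" and x: "x \<in> fst c" and H: "vf_rep A c H differentiable (at (snd c x))"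
  shows "g x (levi_civita A g X H x) (X x) =
    metric_rep A c g (snd c x) (frechet_derivative (vf_rep A c H) (at (snd c x)) (to_comp A c x (X x))) (to_comp A c x (X x))
    + dmetric c (snd c x) (to_comp A c x (H x)) (to_comp A c x (X x)) (to_comp A c x (X x)) / 2"
proof -
  let ?y = "snd c x" and ?e = "to_comp A c x (X x)" and ?h = "to_comp A c x (H x)" and ?M = "metric_rep A c g (snd c x)"
  obtain G where "chart_christoffel c x G" using levi_civita_in_chart[OF c x] .
  note G = chart_christoffelD[OF this]
  have y: "?y \<in> snd c ` fst c" using x by blast
  have l: "linear (\<lambda>u. ?M u v)" for v using bilinear_metric_rep[OF c y] unfolding bilinear_def by blast
  have "g x (levi_civita A g X H x) (X x) = ?M (to_comp A c x (levi_civita A g X H x)) ?e"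
    by (rule metric_rep_to_comp[OF c x, symmetric])
  also have "\<dots> = ?M (frechet_derivative (vf_rep A c H) (at ?y) ?e) ?e + ?M (G ?e ?h) ?e"
    unfolding G(3)[OF H] by (rule linear_add[OF l])
  also have "?M (G ?e ?h) ?e = dmetric c ?y ?h ?e ?e / 2"
    unfolding G(2) G(1)[of ?e ?h] using metric_rep_sym[of c ?y ?e "G ?h ?e"] by simp
  finally show ?thesis .
qed

end

locale orthogonal_foliation = riemannian A g
  for A :: "('m::topological_space, 'e::euclidean_space) chart set" and g :: "('m, 'e) tensor2" +
  fixes D P :: "'m \<Rightarrow> 'e set" and n p :: nat
  assumes D: "distribution A D n" and P: "distribution A P p"
    and complementary: "complementary D P" and orthogonal: "orthogonal_dists g D P"
begin

lemma subspace_D [simp]: "subspace (D x)" and dim_D [simp]: "dim (D x) = n"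
  and subspace_P [simp]: "subspace (P x)" and dim_P [simp]: "dim (P x) = p"
  using D P unfolding distribution_def by blast+

lemma D_Int_P: "u \<in> D x \<Longrightarrow> u \<in> P x \<Longrightarrow> u = 0"
  using complementary unfolding complementary_def by blast

lemma g_D_P: "u \<in> D x \<Longrightarrow> v \<in> P x \<Longrightarrow> g x u v = 0" "u \<in> D x \<Longrightarrow> v \<in> P x \<Longrightarrow> g x v u = 0"
  using orthogonal g_sym unfolding orthogonal_dists_def by auto

lemma perp_part: "perp_part D P x u \<in> P x" "u - perp_part D P x u \<in> D x"
  and perp_part_unique: "w \<in> P x \<Longrightarrow> u - w \<in> D x \<Longrightarrow> perp_part D P x u = w"
proof -
  have ex: "\<exists>w. w \<in> P x \<and> u - w \<in> D x"
  proof -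
    have "u \<in> {u + v | u v. u \<in> D x \<and> v \<in> P x}" using complementary unfolding complementary_def by blast
    then obtain a b where "u = a + b" "a \<in> D x" "b \<in> P x" by blast
    then show ?thesis by (intro exI[of _ b]) simp
  qed
  have un: "w = w'" if "w \<in> P x \<and> u - w \<in> D x" "w' \<in> P x \<and> u - w' \<in> D x" for w w'
  proof -
    have "w - w' \<in> P x" using that by (simp add: subspace_diff)
    moreover have "(u - w') - (u - w) \<in> D x" by (rule subspace_diff) (use that in auto)
    ultimately have "w - w' = 0" by (intro D_Int_P) auto
    then show ?thesis by simp
  qed
  have u1: "\<exists>!w. w \<in> P x \<and> u - w \<in> D x" using ex un by blast
  from theI'[OF u1] have "perp_part D P x u \<in> P x \<and> u - perp_part D P x u \<in> D x" unfolding perp_part_def .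
  then show "perp_part D P x u \<in> P x" "u - perp_part D P x u \<in> D x" by simp_all
  show "perp_part D P x u = w" if "w \<in> P x" "u - w \<in> D x"
    unfolding perp_part_def by (rule the1_equality[OF u1 conjI[OF that]])
qed

lemma g_perp_part: "\<xi> \<in> P x \<Longrightarrow> g x (perp_part D P x u) \<xi> = g x u \<xi>"
  using g_D_P(1)[OF perp_part(2), of \<xi> x u] linear_diff[OF linear_g(2)[where v=\<xi> and x=x], of u "perp_part D P x u"] by simp

lemma perp_part_eqI:
  assumes "a \<in> P x" "b \<in> P x" "\<And>\<xi>. \<xi> \<in> P x \<Longrightarrow> g x a \<xi> = g x b \<xi>" shows "a = b"
proof -
  have "a - b \<in> P x" using assms by (simp add: subspace_diff)
  then have "g x (a - b) (a - b) = 0" using assms(3)[of "a - b"] by (simp add: g_simps)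
  then show ?thesis using g_pos[of "a - b" x] by force
qed

lemma second_fund_in_P: "second_fund A D P g X Y x \<in> P x"
  unfolding second_fund_def by (intro subspace_scale perp_part) simp

text \<open>In a flat chart a vector of \<open>W\<close>, taken as a constant field \<open>\<xi>\<close>, is tangent to \<open>P\<close> everywhere, so
  \<open>g (Y, \<xi>) = 0\<close> can be differentiated along \<open>X\<close>. This removes the derivatives of \<open>X\<close> and \<open>Y\<close>, and the
  symmetric part of \<open>g (\<nabla>\<^sub>X Y, \<xi>)\<close> is the Koszul term \<open>- \<partial>\<^sub>\<xi> g (X, Y) / 2\<close>.\<close>

lemma second_fund_flat:
  assumes fc: "flat_chart A P c W" and x: "x \<in> fst c" "x \<in> U" and U: "open U"
    and X: "smooth_section A D U X" and Y: "smooth_section A D U Y" and \<xi>: "\<xi> \<in> P x"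
  shows "2 * g x (second_fund A D P g X Y x) \<xi> = 
    - dmetric c (snd c x) (to_comp A c x \<xi>) (to_comp A c x (X x)) (to_comp A c x (Y x))"
proof -
  let ?y = "snd c x" and ?M = "metric_rep A c g (snd c x)" and ?t = "to_comp A c x"
  have c: "smooth_chart A c" and Wc: "\<And>x. x \<in> fst c \<Longrightarrow> to_comp A c x ` P x = W" using fc unfolding flat_chart_def by auto
  note ic = smooth_chart_is_chart[OF c]
  obtain G where "chart_christoffel c x G" using levi_civita_in_chart[OF c x(1)] .
  note G = chart_christoffelD[OF this]
  have y: "?y \<in> snd c ` fst c" using x by blast
  have l: "linear (\<lambda>u. ?M u v)" for v using bilinear_metric_rep[OF c y] unfolding bilinear_def by blast
  have part: "g x (levi_civita A g X Y x) \<xi> = ?M (G (?t (X x)) (?t (Y x))) (?t \<xi>) - dmetric c ?y (?t (X x)) (?t (Y x)) (?t \<xi>)"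
    if X: "smooth_section A D U X" and Y: "smooth_section A D U Y" for X Y
  proof -
    have dY: "vf_rep A c Y differentiable (at ?y)"
      using smooth_section_differentiable[OF c U _ x] Y unfolding smooth_section_def by blast
    let ?DY = "frechet_derivative (vf_rep A c Y) (at ?y)"
    have 1: "((\<lambda>z. metric_rep A c g z (vf_rep A c Y z) (?t \<xi>)) has_derivative
       (\<lambda>h. dmetric c ?y h (vf_rep A c Y ?y) (?t \<xi>) + ?M (?DY h) (?t \<xi>) + ?M (vf_rep A c Y ?y) 0)) (at ?y)"
      by (rule metric_has_derivative[OF c y _ has_derivative_const]) (use dY frechet_derivative_works in blast)
    have 2: "((\<lambda>z. metric_rep A c g z (vf_rep A c Y z) (?t \<xi>)) has_derivative (\<lambda>h. 0)) (at ?y)"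
    proof (rule has_derivative_transform_within_open[OF has_derivative_const])
      show "open (snd c ` (fst c \<inter> U))" by (rule is_chart_open_image[OF ic U])
      show "?y \<in> snd c ` (fst c \<inter> U)" using x by blast
      fix z assume "z \<in> snd c ` (fst c \<inter> U)"
      then obtain a where a: "a \<in> fst c" "a \<in> U" "z = snd c a" by blast
      have "?t \<xi> \<in> to_comp A c a ` P a" using Wc[OF a(1)] Wc[OF x(1)] \<xi> by blast
      then obtain \<eta> where \<eta>: "\<eta> \<in> P a" "?t \<xi> = to_comp A c a \<eta>" by blast
      have "metric_rep A c g z (vf_rep A c Y z) (?t \<xi>) = g a (Y a) \<eta>"
        unfolding a(3) vf_rep_at[OF ic a(1)] \<eta>(2) by (rule metric_rep_to_comp[OF c a(1)])
      then show "0 = metric_rep A c g z (vf_rep A c Y z) (?t \<xi>)"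
        using g_D_P(1)[OF _ \<eta>(1)] Y a(2) unfolding smooth_section_def by simp
    qed
    have vy: "vf_rep A c Y ?y = ?t (Y x)" by (rule vf_rep_at[OF ic x(1)])
    have l0: "?M v 0 = 0" for v using metric_rep_sym[of c ?y v 0] linear_0[OF l] by simp
    have "dmetric c ?y (?t (X x)) (?t (Y x)) (?t \<xi>) + ?M (?DY (?t (X x))) (?t \<xi>) = 0"
      using fun_cong[OF has_derivative_unique[OF 1 2], of "?t (X x)"] unfolding vy l0 by simp
    moreover have "g x (levi_civita A g X Y x) \<xi> = ?M (?t (levi_civita A g X Y x)) (?t \<xi>)"
      by (rule metric_rep_to_comp[OF c x(1), symmetric])
    ultimately show ?thesis unfolding G(3)[OF dY] linear_add[OF l] by simp
  qed
  have "2 * g x (second_fund A D P g X Y x) \<xi> = g x (levi_civita A g X Y x) \<xi> + g x (levi_civita A g Y X x) \<xi>"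
    unfolding second_fund_def by (simp add: g_simps g_perp_part[OF \<xi>])
  also have "\<dots> = 2 * ?M (G (?t (X x)) (?t (Y x))) (?t \<xi>) - dmetric c ?y (?t (X x)) (?t (Y x)) (?t \<xi>) - dmetric c ?y (?t (Y x)) (?t (X x)) (?t \<xi>)"
    unfolding part[OF X Y] part[OF Y X] G(1)[of "?t (Y x)"] by simp
  also have "\<dots> = - dmetric c ?y (?t \<xi>) (?t (X x)) (?t (Y x))"
    unfolding G(2) G(1)[of "?t (Y x)" "?t (X x)"] G(1)[of "?t \<xi>"]
    using metric_rep_sym[of c ?y "G (?t (X x)) (?t \<xi>)" "?t (Y x)"] by simp
  finally show ?thesis .
qed

end

section \<open>Local sections and orthonormal frames\<close>

lemma span_image_sum:
  assumes I: "finite I" and v: "v \<in> span (f ` I)"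
  shows "\<exists>u. v = (\<Sum>i\<in>I. u i *\<^sub>R f i)"
proof -
  let ?S = "{v. \<exists>u. v = (\<Sum>i\<in>I. u i *\<^sub>R f i)}"
  have "subspace ?S"
  proof (rule subspaceI)
    show "0 \<in> ?S" by (intro CollectI exI[of _ "\<lambda>i. 0"]) simp
  next
    fix x y assume "x \<in> ?S" "y \<in> ?S"
    then obtain u w where "x = (\<Sum>i\<in>I. u i *\<^sub>R f i)" "y = (\<Sum>i\<in>I. w i *\<^sub>R f i)" by blast
    then show "x + y \<in> ?S"
      by (intro CollectI exI[of _ "\<lambda>i. u i + w i"]) (simp add: scaleR_add_left sum.distrib)
  next
    fix x r assume "x \<in> ?S"
    then obtain u where "x = (\<Sum>i\<in>I. u i *\<^sub>R f i)" by blast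
    then show "r *\<^sub>R x \<in> ?S"
      by (intro CollectI exI[of _ "\<lambda>i. r * u i"]) (simp add: scaleR_sum_right)
  qed
  moreover have "f ` I \<subseteq> ?S"
  proof clarify
    fix i assume "i \<in> I"
    have "(\<Sum>j\<in>I. (if j = i then 1 else 0) *\<^sub>R f j) = (\<Sum>j\<in>I. if j = i then f j else 0)" by (rule sum.cong) auto
    also have "\<dots> = f i" using \<open>i \<in> I\<close> I by simp
    finally show "\<exists>u. f i = (\<Sum>j\<in>I. u j *\<^sub>R f j)" by metis
  qed
  ultimately show ?thesis using span_minimal[of "f ` I" ?S] v by blast
qed

context atlas
begin

definition smooth_fun :: "'m set \<Rightarrow> ('m \<Rightarrow> real) \<Rightarrow> bool" where
  "smooth_fun U f \<longleftrightarrow> (\<forall>c\<in>A. smooth_on (snd c ` (fst c \<inter> U)) (\<lambda>z. f (cinv c z)))"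

lemma atlas_open_image: "open U \<Longrightarrow> c \<in> A \<Longrightarrow> open (snd c ` (fst c \<inter> U))"
  by (rule is_chart_open_image[OF atlas_chart])

lemma chart_imageE:
  assumes "z \<in> snd c ` (fst c \<inter> U)" "c \<in> A"
  obtains a where "a \<in> fst c" "a \<in> U" "z = snd c a" "cinv c z = a"
  using assms cinv_chart[OF atlas_chart] by blast

lemma smooth_vf_add:
  assumes U: "open U" and X: "smooth_vf A U X" and Y: "smooth_vf A U Y"
  shows "smooth_vf A U (\<lambda>x. X x + Y x)"
  unfolding smooth_vf_def
proof
  fix c assume c: "c \<in> A"
  let ?V = "snd c ` (fst c \<inter> U)"
  have "smooth_on ?V (\<lambda>z. vf_rep A c X z + vf_rep A c Y z)"
    using X Y c atlas_open_image[OF U c] unfolding smooth_vf_def by (intro smooth_on_add) auto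
  then show "smooth_on ?V (vf_rep A c (\<lambda>x. X x + Y x))"
  proof (rule smooth_on_eqI)
    fix z assume "z \<in> ?V"
    then obtain a where a: "a \<in> fst c" "a \<in> U" "z = snd c a" "cinv c z = a" using c by (rule chart_imageE)
    show "vf_rep A c (\<lambda>x. X x + Y x) z = vf_rep A c X z + vf_rep A c Y z"
      unfolding vf_rep_def a(4) by (rule linear_add[OF linear_to_comp[OF atlas_smooth_chart[OF c] a(1)]])
  qed
qed

lemma smooth_vf_scale:
  assumes U: "open U" and f: "smooth_fun U f" and X: "smooth_vf A U X"
  shows "smooth_vf A U (\<lambda>x. f x *\<^sub>R X x)"
  unfolding smooth_vf_def
proof
  fix c assume c: "c \<in> A"
  let ?V = "snd c ` (fst c \<inter> U)"
  have "smooth_on ?V (\<lambda>z. f (cinv c z) *\<^sub>R vf_rep A c X z)"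
    using f X c atlas_open_image[OF U c] unfolding smooth_vf_def smooth_fun_def by (intro smooth_on_scaleR) auto
  then show "smooth_on ?V (vf_rep A c (\<lambda>x. f x *\<^sub>R X x))"
  proof (rule smooth_on_eqI)
    fix z assume "z \<in> ?V"
    then obtain a where a: "a \<in> fst c" "a \<in> U" "z = snd c a" "cinv c z = a" using c by (rule chart_imageE)
    show "vf_rep A c (\<lambda>x. f x *\<^sub>R X x) z = f (cinv c z) *\<^sub>R vf_rep A c X z"
      unfolding vf_rep_def a(4) by (rule linear_cmul[OF linear_to_comp[OF atlas_smooth_chart[OF c] a(1)]])
  qed
qed

lemma smooth_fun_const: "open U \<Longrightarrow> smooth_fun U (\<lambda>x. r)"
  unfolding smooth_fun_def using atlas_open_image smooth_on_const by blast

lemma smooth_fun_powr: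
  assumes "open U" "smooth_fun U f" "\<And>x. x \<in> U \<Longrightarrow> f x > 0"
  shows "smooth_fun U (\<lambda>x. f x powr a)"
  unfolding smooth_fun_def
proof
  fix c assume c: "c \<in> A"
  have "smooth_on (snd c ` (fst c \<inter> U)) (\<lambda>z. f (cinv c z) powr a)"
  proof (rule smooth_on_powr[OF atlas_open_image[OF assms(1) c]])
    show "f (cinv c z) > 0" if "z \<in> snd c ` (fst c \<inter> U)" for z
      using that assms(3) cinv_chart[OF atlas_chart[OF c]] by auto
  qed (use assms(2) c in \<open>auto simp: smooth_fun_def\<close>)
  then show "smooth_on (snd c ` (fst c \<inter> U)) (\<lambda>z. f (cinv c z) powr a)" .
qed

lemma smooth_vf_zero: "open U \<Longrightarrow> smooth_vf A U (\<lambda>x. 0)"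
  unfolding smooth_vf_def
proof
  fix c assume U: "open U" and c: "c \<in> A"
  show "smooth_on (snd c ` (fst c \<inter> U)) (vf_rep A c (\<lambda>x. 0))"
  proof (rule smooth_on_eqI[OF smooth_on_const[OF atlas_open_image[OF U c], of 0]])
    fix z assume "z \<in> snd c ` (fst c \<inter> U)"
    then obtain a where a: "a \<in> fst c" "a \<in> U" "z = snd c a" "cinv c z = a" using c by (rule chart_imageE)
    show "vf_rep A c (\<lambda>x. 0) z = 0"
      unfolding vf_rep_def a(4) by (rule linear_0[OF linear_to_comp[OF atlas_smooth_chart[OF c] a(1)]])
  qed
qed

lemma smooth_vf_sum:
  "open U \<Longrightarrow> finite I \<Longrightarrow> (\<And>i. i \<in> I \<Longrightarrow> smooth_vf A U (X i)) \<Longrightarrow> smooth_vf A U (\<lambda>x. \<Sum>i\<in>I. X i x)"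
  by (rotate_tac 1, induction rule: finite_induct) (auto intro: smooth_vf_zero smooth_vf_add)

lemma smooth_vf_diff:
  assumes "open U" "smooth_vf A U X" "smooth_vf A U Y" shows "smooth_vf A U (\<lambda>x. X x - Y x)"
  using smooth_vf_add[OF assms(1,2) smooth_vf_scale[OF assms(1) smooth_fun_const[OF assms(1), of "-1"] assms(3)]] by simp

text \<open>Extend with constant coefficients with respect to a local spanning family.\<close>

lemma distribution_section:
  assumes E: "distribution A E k" and v: "v \<in> E x"
  obtains U X where "open U" "x \<in> U" "smooth_section A E U X" "X x = v"
proof -
  obtain U X where U: "open U" "x \<in> U" and X: "\<And>i. i < k \<Longrightarrow> smooth_vf A U (X i)"
    and E': "\<And>y. y \<in> U \<Longrightarrow> E y = span ((\<lambda>i. X i y) ` {..<k})"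
    using E unfolding distribution_def by metis
  have "v \<in> span ((\<lambda>i. X i x) ` {..<k})" using v E' U by blast
  then obtain u where u: "v = (\<Sum>i<k. u i *\<^sub>R X i x)"
    using span_image_sum[of "{..<k}" v "\<lambda>i. X i x"] by auto
  have "smooth_vf A U (\<lambda>y. \<Sum>i<k. u i *\<^sub>R X i y)"
    by (intro smooth_vf_sum smooth_vf_scale smooth_fun_const U X) auto
  moreover have "(\<Sum>i<k. u i *\<^sub>R X i y) \<in> E y" if "y \<in> U" for y
    unfolding E'[OF that] by (intro span_sum span_scale span_base) auto
  ultimately show ?thesis using that[OF U, of "\<lambda>y. \<Sum>i<k. u i *\<^sub>R X i y"] u unfolding smooth_section_def by simp
qed

end

context riemannian
begin

lemma smooth_fun_metric:
  assumes U: "open U" and X: "smooth_vf A U X" and Y: "smooth_vf A U Y"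
  shows "smooth_fun U (\<lambda>x. g x (X x) (Y x))"
  unfolding smooth_fun_def
proof
  fix c assume c: "c \<in> A"
  let ?V = "snd c ` (fst c \<inter> U)"
  note sc = atlas_smooth_chart[OF c]
  have "smooth_on ?V (\<lambda>z. metric_rep A c g z (vf_rep A c X z) (vf_rep A c Y z))"
  proof (rule smooth_on_bilinear_family[where B="metric_rep A c g", OF atlas_open_image[OF U c]])
    show "bilinear (metric_rep A c g y)" if "y \<in> ?V" for y by (rule bilinear_metric_rep[OF sc]) (use that in blast)
    show "smooth_on ?V (\<lambda>y. metric_rep A c g y u v)" for u v
      by (rule smooth_on_subset[OF smooth_on_metric_rep[OF sc]]) blast
  qed (use X Y c in \<open>auto simp: smooth_vf_def\<close>)
  then show "smooth_on ?V (\<lambda>z. g (cinv c z) (X (cinv c z)) (Y (cinv c z)))"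
  proof (rule smooth_on_eqI)
    fix z assume "z \<in> ?V"
    then obtain a where a: "a \<in> fst c" "a \<in> U" "z = snd c a" "cinv c z = a" using c by (rule chart_imageE)
    show "g (cinv c z) (X (cinv c z)) (Y (cinv c z)) = metric_rep A c g z (vf_rep A c X z) (vf_rep A c Y z)"
      unfolding vf_rep_def a(4) unfolding a(3) by (rule metric_rep_to_comp[OF sc a(1), symmetric])
  qed
qed

lemma gram_schmidt:
  fixes X :: "nat \<Rightarrow> 'm \<Rightarrow> 'e"
  assumes U: "open U" and X: "\<And>i. i < k \<Longrightarrow> smooth_vf A U (X i)"
    and indep: "\<And>i y. i < k \<Longrightarrow> y \<in> U \<Longrightarrow> X i y \<notin> span ((\<lambda>l. X l y) ` {..<i})" and "j \<le> k"
  shows "\<exists>e. (\<forall>i<j. smooth_vf A U (e i)) \<and> (\<forall>y\<in>U. (\<lambda>i. e i y) ` {..<j} \<subseteq> span ((\<lambda>i. X i y) ` {..<j}) \<and>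
      (\<forall>i<j. \<forall>l<j. g y (e i y) (e l y) = (if i = l then 1 else 0)))"
  using \<open>j \<le> k\<close>
proof (induction j)
  case 0
  then show ?case by simp
next
  case (Suc j)
  from Suc.IH[OF Suc_leD[OF Suc.prems]] obtain e where e0: "\<forall>i<j. smooth_vf A U (e i)"
    and e1: "\<forall>y\<in>U. (\<lambda>i. e i y) ` {..<j} \<subseteq> span ((\<lambda>i. X i y) ` {..<j}) \<and>
      (\<forall>i<j. \<forall>l<j. g y (e i y) (e l y) = (if i = l then 1 else 0))" by (elim exE conjE)
  have e: "\<And>i. i < j \<Longrightarrow> smooth_vf A U (e i)" using e0 by blast
  have sp: "\<And>y. y \<in> U \<Longrightarrow> (\<lambda>i. e i y) ` {..<j} \<subseteq> span ((\<lambda>i. X i y) ` {..<j})" using e1 by blast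
  have on: "\<And>y i l. y \<in> U \<Longrightarrow> i < j \<Longrightarrow> l < j \<Longrightarrow> g y (e i y) (e l y) = (if i = l then 1 else 0)" using e1 by blast
  have jk: "j < k" using Suc by simp
  define v where "v y = X j y - (\<Sum>i<j. g y (X j y) (e i y) *\<^sub>R e i y)" for y
  have v: "smooth_vf A U v"
    unfolding v_def by (intro smooth_vf_diff smooth_vf_sum smooth_vf_scale smooth_fun_metric U X e jk) auto
  have sum_span: "(\<Sum>i<j. g y (X j y) (e i y) *\<^sub>R e i y) \<in> span ((\<lambda>i. X i y) ` {..<j})" if "y \<in> U" for y
    by (intro span_sum span_scale) (use sp[OF that] in auto)
  have v0: "v y \<noteq> 0" if "y \<in> U" for y
    using indep[OF jk that] sum_span[OF that] unfolding v_def by auto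
  have pos: "g y (v y) (v y) > 0" if "y \<in> U" for y using g_pos v0[OF that] by blast
  have orth: "g y (v y) (e l y) = 0" if "y \<in> U" "l < j" for y l
  proof -
    have "(\<Sum>i<j. g y (X j y) (e i y) * g y (e i y) (e l y)) = (\<Sum>i<j. if i = l then g y (X j y) (e i y) else 0)"
      by (rule sum.cong) (use on that in auto)
    then show ?thesis using that(2) unfolding v_def by (simp add: g_simps)
  qed
  define w where "w y = (g y (v y) (v y)) powr (-1/2) *\<^sub>R v y" for y
  have w: "smooth_vf A U w"
    unfolding w_def by (intro smooth_vf_scale smooth_fun_powr smooth_fun_metric U v pos)
  have ww: "g y (w y) (w y) = 1" if "y \<in> U" for y
  proof -
    have "(g y (v y) (v y)) powr (-1/2) * ((g y (v y) (v y)) powr (-1/2) * g y (v y) (v y)) = 1"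
      using pos[OF that] by (simp add: powr_minus powr_half_sqrt field_simps)
    then show ?thesis unfolding w_def by (simp add: g_simps)
  qed
  have wo: "g y (w y) (e l y) = 0" "g y (e l y) (w y) = 0" if "y \<in> U" "l < j" for y l
    using orth[OF that] g_sym[of y "e l y" "w y"] unfolding w_def by (simp_all add: g_simps)
  have wsp: "w y \<in> span ((\<lambda>i. X i y) ` {..<Suc j})" if "y \<in> U" for y
  proof -
    have "span ((\<lambda>i. X i y) ` {..<j}) \<subseteq> span ((\<lambda>i. X i y) ` {..<Suc j})" by (intro span_mono) auto
    then show ?thesis using sum_span[OF that] unfolding w_def v_def
      by (intro span_scale span_diff) (auto intro: span_base)
  qed
  let ?e = "e(j := w)"
  show ?case
  proof (intro exI[of _ ?e] conjI allI impI ballI)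
    show "smooth_vf A U (?e i)" if "i < Suc j" for i using that e w by (cases "i = j") auto
    show "(\<lambda>i. ?e i y) ` {..<Suc j} \<subseteq> span ((\<lambda>i. X i y) ` {..<Suc j})" if y: "y \<in> U" for y
    proof
      fix a assume "a \<in> (\<lambda>i. ?e i y) ` {..<Suc j}"
      then obtain i where i: "i < Suc j" "a = ?e i y" by auto
      show "a \<in> span ((\<lambda>i. X i y) ` {..<Suc j})"
      proof (cases "i = j")
        case False
        then have "a \<in> span ((\<lambda>i. X i y) ` {..<j})" using i sp[OF y] by auto
        moreover have "span ((\<lambda>i. X i y) ` {..<j}) \<subseteq> span ((\<lambda>i. X i y) ` {..<Suc j})" by (intro span_mono) auto
        ultimately show ?thesis by blast
      qed (use i wsp[OF y] in simp)
    qed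
    show "g y (?e i y) (?e l y) = (if i = l then 1 else 0)" if "y \<in> U" "i < Suc j" "l < Suc j" for y i l
      using that on ww wo by (cases "i = j"; cases "l = j") auto
  qed
qed

lemma orthonormal_frame_exists:
  assumes E: "distribution A E k"
  shows "\<exists>e U. x \<in> U \<and> orthonormal_frame A g E k U e"
proof -
  obtain U X where U: "open U" "x \<in> U" and X: "\<And>i. i < k \<Longrightarrow> smooth_vf A U (X i)"
    and E': "\<And>y. y \<in> U \<Longrightarrow> E y = span ((\<lambda>i. X i y) ` {..<k})"
    using E unfolding distribution_def by metis
  have indep: "X i y \<notin> span ((\<lambda>l. X l y) ` {..<i})" if i: "i < k" and y: "y \<in> U" for i y
  proof
    let ?S = "(\<lambda>l. X l y) ` {..<k}"
    assume *: "X i y \<in> span ((\<lambda>l. X l y) ` {..<i})"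
    have "?S \<subseteq> span ((\<lambda>l. X l y) ` ({..<k} - {i}))"
    proof
      fix a assume "a \<in> ?S"
      then obtain l where l: "l < k" "a = X l y" by auto
      show "a \<in> span ((\<lambda>l. X l y) ` ({..<k} - {i}))"
      proof (cases "l = i")
        case True
        have "span ((\<lambda>l. X l y) ` {..<i}) \<subseteq> span ((\<lambda>l. X l y) ` ({..<k} - {i}))" using i by (intro span_mono) auto
        then show ?thesis using * l True by blast
      qed (use l in \<open>auto intro!: span_base\<close>)
    qed
    then have "E y \<subseteq> span ((\<lambda>l. X l y) ` ({..<k} - {i}))" unfolding E'[OF y] by (simp add: span_minimal)
    then have "dim (E y) \<le> card ((\<lambda>l. X l y) ` ({..<k} - {i}))" by (intro dim_le_card) auto
    also have "\<dots> \<le> card ({..<k} - {i})" by (rule card_image_le) simp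
    also have "\<dots> < k" using i by simp
    finally show False using E unfolding distribution_def by simp
  qed
  have "\<exists>e. (\<forall>i<k. smooth_vf A U (e i)) \<and> (\<forall>y\<in>U. (\<lambda>i. e i y) ` {..<k} \<subseteq> span ((\<lambda>i. X i y) ` {..<k}) \<and>
      (\<forall>i<k. \<forall>l<k. g y (e i y) (e l y) = (if i = l then 1 else 0)))"
    by (rule gram_schmidt[OF U(1) X indep order_refl])
  then obtain e where e0: "\<forall>i<k. smooth_vf A U (e i)"
    and e1: "\<forall>y\<in>U. (\<lambda>i. e i y) ` {..<k} \<subseteq> span ((\<lambda>i. X i y) ` {..<k}) \<and>
      (\<forall>i<k. \<forall>l<k. g y (e i y) (e l y) = (if i = l then 1 else 0))" by (elim exE conjE)
  have sp: "e i y \<in> E y" if "y \<in> U" "i < k" for i y using e1 E' that by blast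
  have "orthonormal_frame A g E k U e"
    unfolding orthonormal_frame_def smooth_section_def using U(1) e0 sp e1 by simp
  then show ?thesis using U(2) by blast
qed

text \<open>The mean curvature and the divergence are sums over a chosen frame; this says that the choice is not
  void.\<close>

lemma frame_at:
  assumes "distribution A E k"
  obtains U where "x \<in> U" "orthonormal_frame A g E k U (frame_at A g E x)"
proof -
  have "dim (E x) = k" using assms unfolding distribution_def by blast
  then show ?thesis
    using someI_ex[OF orthonormal_frame_exists[OF assms, of x]] that unfolding frame_at_def by blast
qed

lemma orthonormal_expansion:
  assumes E: "subspace E" "dim E = k" and e: "\<And>i. i < k \<Longrightarrow> e i \<in> E"
    and on: "\<And>i l. i < k \<Longrightarrow> l < k \<Longrightarrow> g x (e i) (e l) = (if i = l then 1 else 0)" and v: "v \<in> E"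
  shows "v = (\<Sum>i<k. g x v (e i) *\<^sub>R e i)"
proof -
  have inj: "inj_on e {..<k}"
  proof (rule inj_onI)
    fix i l assume "i \<in> {..<k}" "l \<in> {..<k}" "e i = e l"
    then show "i = l" using on[of i l] on[of i i] by (auto split: if_splits)
  qed
  have sub0: "subspace {v. g x v a = 0}" for a by (auto simp: subspace_def g_simps)
  have indep: "independent (e ` {..<k})"
    unfolding dependent_def
  proof
    assume "\<exists>a\<in>e ` {..<k}. a \<in> span (e ` {..<k} - {a})"
    then obtain i where i: "i < k" "e i \<in> span (e ` {..<k} - {e i})" by auto
    have "e ` {..<k} - {e i} \<subseteq> {v. g x v (e i) = 0}" using on i(1) by auto
    then have "span (e ` {..<k} - {e i}) \<subseteq> {v. g x v (e i) = 0}" by (rule span_minimal) (rule sub0)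
    then show False using i on[of i i] by auto
  qed
  have "E \<subseteq> span (e ` {..<k})"
    by (rule card_ge_dim_independent) (use e indep E inj in \<open>auto simp: card_image\<close>)
  have "g x (v - (\<Sum>i<k. g x v (e i) *\<^sub>R e i)) (e l) = 0" if "l < k" for l
  proof -
    have "(\<Sum>i<k. g x v (e i) * g x (e i) (e l)) = (\<Sum>i<k. if i = l then g x v (e i) else 0)"
      by (rule sum.cong) (use on that in auto)
    then show ?thesis using that by (simp add: g_simps)
  qed
  then have orth: "e ` {..<k} \<subseteq> {w. g x w (v - (\<Sum>i<k. g x v (e i) *\<^sub>R e i)) = 0}" by (auto simp: g_sym)
  have "E \<subseteq> {w. g x w (v - (\<Sum>i<k. g x v (e i) *\<^sub>R e i)) = 0}"
    using \<open>E \<subseteq> span (e ` {..<k})\<close> span_minimal[OF orth sub0] by blast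
  moreover have "v - (\<Sum>i<k. g x v (e i) *\<^sub>R e i) \<in> E"
    by (intro subspace_diff subspace_sum subspace_scale E v e) auto
  ultimately have "v - (\<Sum>i<k. g x v (e i) *\<^sub>R e i) = 0"
    using g_pos[of "v - (\<Sum>i<k. g x v (e i) *\<^sub>R e i)" x] by force
  then show ?thesis by simp
qed

end

section \<open>The second fundamental tensor in a flat chart\<close>

text \<open>The component in \<open>D\<close>, along \<open>P\<close>, of the vector which is constantly \<open>v\<close> in the chart \<open>c\<close>. It does not
  depend on a metric, so it is the same for the whole evolution.\<close>

definition hor :: "('m, 'e::euclidean_space) chart set \<Rightarrow> ('m \<Rightarrow> 'e set) \<Rightarrow> ('m \<Rightarrow> 'e set) \<Rightarrow> ('m, 'e) chart \<Rightarrow> 'e \<Rightarrow> 'e \<Rightarrow> 'e" where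
  "hor A D P c v z = to_comp A c (cinv c z)
     (of_comp A c (cinv c z) v - perp_part D P (cinv c z) (of_comp A c (cinv c z) v))"

text \<open>A closedness argument without limits: derivatives of functions with values in a subspace stay in it,
  because linear functionals vanishing on the subspace can be applied first.\<close>

lemma in_subspaceI:
  fixes S :: "'a::euclidean_space set"
  assumes S: "subspace S" and a: "\<And>w. (\<And>y. y \<in> S \<Longrightarrow> y \<bullet> w = 0) \<Longrightarrow> a \<bullet> w = 0"
  shows "a \<in> S"
proof -
  obtain y w where yw: "y \<in> span S" "\<And>u. u \<in> span S \<Longrightarrow> orthogonal w u" "a = y + w"
    using orthogonal_subspace_decomp_exists[of S a] by metis
  have "a \<bullet> w = 0" by (rule a) (use yw(2) in \<open>auto simp: orthogonal_def inner_commute intro: span_base\<close>)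
  moreover have "y \<bullet> w = 0" using yw(2)[OF yw(1)] by (simp add: orthogonal_def inner_commute)
  ultimately have "w = 0" using yw(3) by (simp add: inner_add_left)
  then show ?thesis using yw(1,3) span_eq_iff[THEN iffD2, OF S] by simp
qed

locale flat_foliation = orthogonal_foliation A g D P n p
  for A :: "('m::topological_space, 'e::euclidean_space) chart set" and g :: "('m, 'e) tensor2"
    and D P :: "'m \<Rightarrow> 'e set" and n p :: nat +
  fixes c :: "('m, 'e) chart" and W :: "'e set"
  assumes flat: "flat_chart A P c W"
begin

abbreviation M where "M \<equiv> metric_rep A c g"
abbreviation \<Omega> where "\<Omega> \<equiv> snd c ` fst c"
abbreviation T where "T \<equiv> to_comp A c"
abbreviation V where "V \<equiv> hor A D P c"

lemma sc: "smooth_chart A c" and subspace_W [simp]: "subspace W" and to_comp_P: "x \<in> fst c \<Longrightarrow> T x ` P x = W"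
  using flat unfolding flat_chart_def by auto

lemmas ic = smooth_chart_is_chart[OF sc]
lemmas open_\<Omega> = smooth_chart_open[OF sc]
lemmas lT = linear_to_comp[OF sc]

lemma T_inj: "x \<in> fst c \<Longrightarrow> T x u = T x v \<longleftrightarrow> u = v"
  using of_to_comp[OF sc] by metis

lemma to_comp_in_W: "x \<in> fst c \<Longrightarrow> T x u \<in> W \<longleftrightarrow> u \<in> P x"
  using to_comp_P[of x] T_inj by (auto simp: image_iff)

lemma of_comp_in_P: "x \<in> fst c \<Longrightarrow> w \<in> W \<Longrightarrow> of_comp A c x w \<in> P x"
  using to_comp_in_W[of x "of_comp A c x w"] sc by simp

lemma linear_M: "z \<in> \<Omega> \<Longrightarrow> linear (M z u)" "z \<in> \<Omega> \<Longrightarrow> linear (\<lambda>u. M z u v)"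
  using bilinear_metric_rep[OF sc] unfolding bilinear_def by blast+

lemma M_T: "x \<in> fst c \<Longrightarrow> M (snd c x) (T x u) (T x v) = g x u v"
  by (rule metric_rep_to_comp[OF sc])

lemma smooth_M: "smooth_on \<Omega> (\<lambda>z. M z u v)" by (rule smooth_on_metric_rep[OF sc])

lemma V_at: "x \<in> fst c \<Longrightarrow> V v (snd c x) = T x (of_comp A c x v - perp_part D P x (of_comp A c x v))"
  unfolding hor_def using ic by simp

lemma V_D: "x \<in> fst c \<Longrightarrow> \<exists>u\<in>D x. V v (snd c x) = T x u"
  using V_at perp_part(2) by blast

lemma V_of_D: "x \<in> fst c \<Longrightarrow> u \<in> D x \<Longrightarrow> V (T x u) (snd c x) = T x u"
  using perp_part_unique[of 0 x u] by (simp add: V_at sc subspace_0)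

lemma V_W: assumes "z \<in> \<Omega>" shows "v - V v z \<in> W"
proof -
  obtain x where x: "x \<in> fst c" "z = snd c x" using assms by blast
  have "v - V v z = T x (perp_part D P x (of_comp A c x v))"
    unfolding x(2) V_at[OF x(1)] linear_diff[OF lT[OF x(1)]] using x sc by simp
  then show ?thesis using to_comp_in_W[OF x(1)] perp_part(1) by simp
qed

lemma V_eq_if:
  assumes x: "x \<in> fst c" and u: "u \<in> D x" and d: "v - T x u \<in> W"
  shows "V v (snd c x) = T x u"
proof -
  have "T x (of_comp A c x v - u) \<in> W" using d x sc by (simp add: linear_diff[OF lT])
  then have "of_comp A c x v - u \<in> P x" using to_comp_in_W[OF x] by simp
  then have "perp_part D P x (of_comp A c x v) = of_comp A c x v - u" using u by (intro perp_part_unique) auto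
  then show ?thesis by (simp add: V_at x)
qed

lemma V_eq_0_iff: assumes "z \<in> \<Omega>" shows "V v z = 0 \<longleftrightarrow> v \<in> W"
proof -
  obtain x where x: "x \<in> fst c" "z = snd c x" using assms by blast
  show ?thesis
  proof
    assume "V v z = 0" then show "v \<in> W" using V_W[OF assms, of v] by simp
  next
    assume "v \<in> W"
    then show "V v z = 0" using V_eq_if[OF x(1) subspace_0[OF subspace_D], of v] linear_0[OF lT[OF x(1)]] x(2) by simp
  qed
qed

lemma M_D_W: assumes "x \<in> fst c" "u \<in> D x" "w \<in> W" shows "M (snd c x) w (T x u) = 0" "M (snd c x) (T x u) w = 0"
proof -
  obtain \<eta> where "\<eta> \<in> P x" "w = T x \<eta>" using assms to_comp_P by blast
  then show "M (snd c x) w (T x u) = 0" using assms by (simp add: M_T g_D_P)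
  then show "M (snd c x) (T x u) w = 0" using metric_rep_sym by metis
qed

lemma M_V_W:
  assumes z: "z \<in> \<Omega>" and w: "w \<in> W" shows "M z w (V v z) = 0" "M z (V v z) w = 0"
proof -
  obtain x where x: "x \<in> fst c" "z = snd c x" using z by blast
  obtain u where u: "u \<in> D x" "V v z = T x u" using V_D[OF x(1)] x(2) by blast
  show "M z w (V v z) = 0" "M z (V v z) w = 0" unfolding u(2) unfolding x(2) by (intro M_D_W x u w)+
qed

text \<open>In terms of a local orthonormal frame \<open>e\<close> of \<open>P\<close>, the component is \<open>v - \<Sum> g (v, e\<^sub>i) e\<^sub>i\<close>.\<close>

lemma smooth_V: "smooth_on \<Omega> (V v)"
proof (rule smooth_on_local)
  fix z0 assume "z0 \<in> \<Omega>"
  then obtain x0 where x0: "x0 \<in> fst c" "z0 = snd c x0" by blast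
  obtain e U where U: "x0 \<in> U" and fr: "orthonormal_frame A g P p U e" using orthonormal_frame_exists[OF P] by blast
  have oU: "open U" and e: "\<And>i. i < p \<Longrightarrow> smooth_vf A U (e i)" "\<And>i x. i < p \<Longrightarrow> x \<in> U \<Longrightarrow> e i x \<in> P x"
    and on: "\<And>x i j. x \<in> U \<Longrightarrow> i < p \<Longrightarrow> j < p \<Longrightarrow> g x (e i x) (e j x) = (if i = j then 1 else 0)"
    using fr unfolding orthonormal_frame_def smooth_section_def by blast+
  let ?V = "snd c ` (fst c \<inter> U)"
  have oV: "open ?V" by (rule is_chart_open_image[OF ic oU])
  have se: "smooth_on ?V (vf_rep A c (e i))" if "i < p" for i by (rule smooth_on_vf_rep[OF sc oU e(1)[OF that]])
  have sM: "smooth_on ?V (\<lambda>z. M z v (vf_rep A c (e i) z))" if "i < p" for i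
  proof (rule smooth_on_linear_family[where L="\<lambda>z. M z v", OF oV _ _ se[OF that]])
    show "linear (M y v)" if "y \<in> ?V" for y by (rule linear_M) (use that in blast)
    show "smooth_on ?V (\<lambda>y. M y v u)" for u by (rule smooth_on_subset[OF smooth_M]) blast
  qed
  have "smooth_on ?V (\<lambda>z. v - (\<Sum>i<p. M z v (vf_rep A c (e i) z) *\<^sub>R vf_rep A c (e i) z))"
    by (intro smooth_on_diff smooth_on_sum smooth_on_scaleR oV smooth_on_const se sM) auto
  then have "smooth_on ?V (V v)"
  proof (rule smooth_on_eqI)
    fix z assume "z \<in> ?V"
    then obtain x where x: "x \<in> fst c" "x \<in> U" "z = snd c x" by blast
    let ?u = "of_comp A c x v"
    have "perp_part D P x ?u = (\<Sum>i<p. g x (perp_part D P x ?u) (e i x) *\<^sub>R e i x)"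
      by (rule orthonormal_expansion[where E="P x"]) (use e x on perp_part in auto)
    also have "\<dots> = (\<Sum>i<p. g x ?u (e i x) *\<^sub>R e i x)"
      by (rule sum.cong) (use g_perp_part e x in auto)
    finally have "T x (perp_part D P x ?u) = (\<Sum>i<p. g x ?u (e i x) *\<^sub>R T x (e i x))"
      by (simp add: linear_sum[OF lT[OF x(1)]] linear_cmul[OF lT[OF x(1)]])
    moreover have "g x ?u (e i x) = M z v (T x (e i x))" for i
      using M_T[OF x(1), of ?u "e i x"] x sc by simp
    ultimately show "V v z = v - (\<Sum>i<p. M z v (vf_rep A c (e i) z) *\<^sub>R vf_rep A c (e i) z)"
      unfolding x(3) V_at[OF x(1)] linear_diff[OF lT[OF x(1)]] vf_rep_at[OF ic x(1)] using x sc by simp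
  qed
  then have "smooth_on (\<Omega> \<inter> ?V) (V v)" by (rule smooth_on_subset) blast
  then show "\<exists>V'. open V' \<and> z0 \<in> V' \<and> smooth_on (\<Omega> \<inter> V') (V v)" using oV x0 U by blast
qed

text \<open>The squared length of the \<open>D\<close>-component of a constant vector; its derivative along the leaves is
  \<open>-2\<close> times the second fundamental tensor.\<close>

definition Q :: "'e \<Rightarrow> 'e \<Rightarrow> real" where "Q v z = M z (V v z) (V v z)"

lemma smooth_Q: "smooth_on \<Omega> (Q v)"
  unfolding Q_def[abs_def]
  by (rule smooth_on_bilinear_family[where B=M, OF open_\<Omega> bilinear_metric_rep[OF sc] smooth_M smooth_V smooth_V])

lemma Q_pos: "z \<in> \<Omega> \<Longrightarrow> v \<notin> W \<Longrightarrow> Q v z > 0"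
  unfolding Q_def using metric_rep_pos[OF sc] V_eq_0_iff by blast

lemma DV_in_W:
  assumes z: "z \<in> \<Omega>" shows "frechet_derivative (V v) (at z) h \<in> W"
proof (rule in_subspaceI[OF subspace_W])
  fix w assume w: "\<And>y. y \<in> W \<Longrightarrow> y \<bullet> w = 0"
  note D = smooth_on_has_derivative[OF open_\<Omega> smooth_V z, of v]
  have "((\<lambda>z. v \<bullet> w) has_derivative (\<lambda>h. frechet_derivative (V v) (at z) h \<bullet> w)) (at z)"
  proof (rule has_derivative_transform_within_open[OF has_derivative_inner_left[OF D] open_\<Omega> z])
    show "V v y \<bullet> w = v \<bullet> w" if "y \<in> \<Omega>" for y using w[OF V_W[OF that, of v]] by (simp add: inner_diff_left)
  qed
  from fun_cong[OF has_derivative_unique[OF this has_derivative_const]]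
  show "frechet_derivative (V v) (at z) h \<bullet> w = 0" .
qed

text \<open>\<open>V v\<close> and the constant \<open>v\<close> differ by a function with values in \<open>W\<close>. Hence the derivative of \<open>V v\<close> lies
  in \<open>W\<close> and is orthogonal to \<open>V v\<close>.\<close>

lemma Q_derivative:
  assumes z: "z \<in> \<Omega>"
  shows "frechet_derivative (Q v) (at z) h = dmetric c z h (V v z) (V v z)"
proof -
  note DV = smooth_on_has_derivative[OF open_\<Omega> smooth_V z, of v]
  from metric_has_derivative[OF sc z DV DV]
  have "(Q v has_derivative (\<lambda>h. dmetric c z h (V v z) (V v z))) (at z)"
    unfolding Q_def[abs_def] using M_V_W[OF z DV_in_W[OF z]] by simp
  from frechet_derivativeI[OF this] show ?thesis by simp
qed

lemma Q_derivative_second_fund: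
  assumes x: "x \<in> fst c" "x \<in> U" and U: "open U" and X: "smooth_section A D U X" and \<xi>: "\<xi> \<in> P x"
  shows "frechet_derivative (Q (T x (X x))) (at (snd c x)) (T x \<xi>) = - 2 * g x (second_fund A D P g X X x) \<xi>"
proof -
  have "X x \<in> D x" using X x unfolding smooth_section_def by blast
  then show ?thesis
    using second_fund_flat[OF flat x U X X \<xi>] Q_derivative[of "snd c x" "T x (X x)"] V_of_D[OF x(1)] x(1) by simp
qed

text \<open>The \<open>a i\<close> are the components of an orthonormal frame of \<open>D\<close> at \<open>x\<close>.\<close>

lemma mean_curvature_Q:
  assumes x: "x \<in> fst c" and \<xi>: "\<xi> \<in> P x"
  obtains a where "\<forall>i<n. Q (a i) (snd c x) = 1"
    "g x (mean_curvature A D P g x) \<xi> = - (1/2) * (\<Sum>i<n. frechet_derivative (Q (a i)) (at (snd c x)) (T x \<xi>))"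
proof -
  obtain U where U: "x \<in> U" "orthonormal_frame A g D n U (frame_at A g D x)" using frame_at[OF D] .
  let ?e = "frame_at A g D x"
  have oU: "open U" and e: "\<And>i. i < n \<Longrightarrow> smooth_section A D U (?e i)" "\<And>i. i < n \<Longrightarrow> g x (?e i x) (?e i x) = 1"
    using U unfolding orthonormal_frame_def by auto
  have eD: "?e i x \<in> D x" if "i < n" for i using e(1)[OF that] U(1) unfolding smooth_section_def by blast
  have 1: "Q (T x (?e i x)) (snd c x) = 1" if "i < n" for i
    unfolding Q_def V_of_D[OF x eD[OF that]] M_T[OF x] by (rule e(2)[OF that])
  have "g x (mean_curvature A D P g x) \<xi> = (\<Sum>i<n. g x (second_fund A D P g (?e i) (?e i) x) \<xi>)"
    unfolding mean_curvature_def by (simp add: linear_sum[OF linear_g(2)])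
  also have "\<dots> = (\<Sum>i<n. - (1/2) * frechet_derivative (Q (T x (?e i x))) (at (snd c x)) (T x \<xi>))"
    by (rule sum.cong) (use Q_derivative_second_fund[OF x U(1) oU e(1) \<xi>] in auto)
  finally show ?thesis using that[of "\<lambda>i. T x (?e i x)"] 1 by (simp add: sum_distrib_left)
qed

lemma mean_curvature_in_P: "mean_curvature A D P g x \<in> P x"
  unfolding mean_curvature_def by (intro subspace_sum second_fund_in_P subspace_P)

text \<open>Here umbilicity enters. As \<open>b = (1 / n) g H\<close> on \<open>D\<close>, the factor in front of \<open>Q v\<close> is the same for all \<open>v\<close>.\<close>

lemma umbilical_Q:
  assumes umb: "umbilical A D P g" and n: "n > 0" and x: "x \<in> fst c" and \<xi>: "\<xi> \<in> P x"
  shows "frechet_derivative (Q v) (at (snd c x)) (T x \<xi>) = - (2 / n) * g x (mean_curvature A D P g x) \<xi> * Q v (snd c x)"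
proof -
  have z: "snd c x \<in> \<Omega>" using x by blast
  obtain u where u: "u \<in> D x" "V v (snd c x) = T x u" using V_D[OF x] by blast
  obtain U X where U: "open U" "x \<in> U" "smooth_section A D U X" "X x = u" using distribution_section[OF D u(1)] .
  have "real n *\<^sub>R second_fund A D P g X X x = g x u u *\<^sub>R mean_curvature A D P g x"
    using umb U unfolding umbilical_def by simp
  then have "g x (real n *\<^sub>R second_fund A D P g X X x) \<xi> = g x (g x u u *\<^sub>R mean_curvature A D P g x) \<xi>" by simp
  then have 1: "real n * g x (second_fund A D P g X X x) \<xi> = g x u u * g x (mean_curvature A D P g x) \<xi>"
    by (simp add: linear_cmul[OF linear_g(2)])
  have "frechet_derivative (Q v) (at (snd c x)) (T x \<xi>) = frechet_derivative (Q (T x (X x))) (at (snd c x)) (T x \<xi>)"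
    unfolding Q_derivative[OF z] u(2) U(4) V_of_D[OF x u(1)] ..
  also have "\<dots> = - 2 * g x (second_fund A D P g X X x) \<xi>" by (rule Q_derivative_second_fund[OF x U(2,1,3) \<xi>])
  also have "g x (second_fund A D P g X X x) \<xi> = g x u u * g x (mean_curvature A D P g x) \<xi> / n" using 1 n by (simp add: field_simps)
  also have "g x u u = Q v (snd c x)" unfolding Q_def u(2) M_T[OF x] ..
  finally show ?thesis by simp
qed

end

section \<open>The evolution of the metric\<close>

context riemannian
begin

text \<open>Uniform bounds near a point, from the compactness of \<open>K\<close> times the unit sphere.\<close>

lemma metric_bounds:
  assumes c: "smooth_chart A c" and K: "compact K" "K \<subseteq> snd c ` fst c"
  obtains l L B where "l > 0" "L > 0" "B \<ge> 0"
    "\<forall>z\<in>K. \<forall>u. l * (norm u)\<^sup>2 \<le> metric_rep A c g z u u \<and> metric_rep A c g z u u \<le> L * (norm u)\<^sup>2"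
    "\<forall>z\<in>K. \<forall>u v w. \<bar>dmetric c z u v w\<bar> \<le> B * norm u * norm v * norm w"
proof -
  let ?M = "metric_rep A c g" and ?S = "sphere (0::'e) 1"
  note o = smooth_chart_open[OF c]
  have bil: "bilinear (?M z)" if "z \<in> K" for z using bilinear_metric_rep[OF c] K(2) that by blast
  have contM: "continuous_on K (\<lambda>z. ?M z i j)" for i j
    by (rule continuous_on_subset[OF smooth_on_imp_continuous_on[OF smooth_on_metric_rep[OF c]] K(2)])
  have hom: "?M z (r *\<^sub>R u) (r *\<^sub>R u) = r\<^sup>2 * ?M z u u" if "z \<in> K" for z r u
  proof -
    have l: "linear (?M z w)" "linear (\<lambda>u. ?M z u w)" for w using bil[OF that] unfolding bilinear_def by auto
    show ?thesis unfolding linear_cmul[OF l(1)] linear_cmul[OF l(2)] by (simp add: power2_eq_square)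
  qed
  have "continuous_on (K \<times> ?S) (\<lambda>x. \<Sum>i\<in>Basis. \<Sum>j\<in>Basis. (snd x \<bullet> i) *\<^sub>R (snd x \<bullet> j) *\<^sub>R ?M (fst x) i j)"
    by (intro continuous_intros continuous_on_compose2[OF contM]) auto
  then have cont: "continuous_on (K \<times> ?S) (\<lambda>x. ?M (fst x) (snd x) (snd x))"
    by (rule continuous_on_eq) (use bilinear_basis_sum[OF bil] in auto)
  have comp: "compact (K \<times> ?S)" using K(1) by (intro compact_Times) auto
  obtain l L where lL: "l > 0" "L > 0" "\<And>z u. z \<in> K \<Longrightarrow> u \<in> ?S \<Longrightarrow> l \<le> ?M z u u \<and> ?M z u u \<le> L"
  proof (cases "K \<times> ?S = {}")
    case True
    then show ?thesis using that[of 1 1] by auto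
  next
    case False
    obtain a where a: "a \<in> K \<times> ?S" "\<And>b. b \<in> K \<times> ?S \<Longrightarrow> ?M (fst a) (snd a) (snd a) \<le> ?M (fst b) (snd b) (snd b)"
      using continuous_attains_inf[OF comp False cont] by blast
    obtain b where b: "b \<in> K \<times> ?S" "\<And>a. a \<in> K \<times> ?S \<Longrightarrow> ?M (fst a) (snd a) (snd a) \<le> ?M (fst b) (snd b) (snd b)"
      using continuous_attains_sup[OF comp False cont] by blast
    have "?M (fst a) (snd a) (snd a) > 0" 
      by (rule metric_rep_pos[OF c]) (use a(1) K(2) in auto)
    moreover have "?M (fst b) (snd b) (snd b) > 0"
      by (rule metric_rep_pos[OF c]) (use b(1) K(2) in auto)
    ultimately show ?thesis
      by (rule that) (use a(2) b(2) in fastforce)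
  qed
  have dcont: "continuous_on K (\<lambda>z. dmetric c z i j k)" for i j k
    unfolding dmetric_def
    by (rule continuous_on_subset[OF smooth_on_imp_continuous_on[OF smooth_on_deriv[OF o smooth_on_metric_rep[OF c]]] K(2)])
  have "\<exists>B\<ge>0. \<forall>z\<in>K. \<bar>dmetric c z i j k\<bar> \<le> B" for i j k
  proof -
    have "bounded ((\<lambda>z. dmetric c z i j k) ` K)" by (intro compact_imp_bounded compact_continuous_image dcont K)
    then obtain B where "B > 0" "\<forall>y\<in>(\<lambda>z. dmetric c z i j k) ` K. norm y \<le> B" unfolding bounded_pos by blast
    then show ?thesis by (intro exI[of _ B]) auto
  qed
  then obtain b where b: "\<And>i j k. b i j k \<ge> 0" "\<And>i j k z. z \<in> K \<Longrightarrow> \<bar>dmetric c z i j k\<bar> \<le> b i j k" by metis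
  define B where "B = (\<Sum>i\<in>Basis. \<Sum>j\<in>Basis. \<Sum>k\<in>Basis. b i j k)"
  have "\<bar>dmetric c z u v w\<bar> \<le> B * norm u * norm v * norm w" if z: "z \<in> K" for z u v w
  proof -
    have z': "z \<in> snd c ` fst c" using z K(2) by blast
    have "dmetric c z u v w = (\<Sum>i\<in>Basis. (u \<bullet> i) *\<^sub>R dmetric c z i v w)"
      by (rule linear_basis_sum[OF linear_dmetric1[OF c z']])
    also have "\<dots> = (\<Sum>i\<in>Basis. \<Sum>j\<in>Basis. \<Sum>k\<in>Basis. (u \<bullet> i) * (v \<bullet> j) * (w \<bullet> k) * dmetric c z i j k)"
      by (subst bilinear_basis_sum[OF bilinear_dmetric[OF c z']]) (simp add: sum_distrib_left mult_ac)
    also have "\<bar>\<dots>\<bar> \<le> (\<Sum>i\<in>Basis. \<Sum>j\<in>Basis. \<Sum>k\<in>Basis. norm u * norm v * norm w * b i j k)"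
    proof (rule order_trans[OF sum_abs sum_mono], rule order_trans[OF sum_abs sum_mono], rule order_trans[OF sum_abs sum_mono])
      fix i j k :: 'e assume "i \<in> Basis" "j \<in> Basis" "k \<in> Basis"
      then show "\<bar>(u \<bullet> i) * (v \<bullet> j) * (w \<bullet> k) * dmetric c z i j k\<bar> \<le> norm u * norm v * norm w * b i j k"
        unfolding abs_mult using b z by (intro mult_mono Basis_le_norm mult_nonneg_nonneg) auto
    qed
    also have "\<dots> = B * norm u * norm v * norm w" unfolding B_def by (simp add: sum_distrib_left sum_distrib_right mult_ac)
    finally show ?thesis .
  qed
  moreover have "l * (norm u)\<^sup>2 \<le> ?M z u u \<and> ?M z u u \<le> L * (norm u)\<^sup>2" if z: "z \<in> K" for z u
  proof (cases "u = 0")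
    case True
    then show ?thesis using hom[OF z, of 0 0] by simp
  next
    case False
    define w where "w = (1 / norm u) *\<^sub>R u"
    have u: "u = norm u *\<^sub>R w" and w: "w \<in> ?S" using False unfolding w_def by auto
    have "?M z u u = (norm u)\<^sup>2 * ?M z w w" by (subst (1 2) u) (rule hom[OF z])
    moreover have "l \<le> ?M z w w" "?M z w w \<le> L" using lL(3)[OF z w] by auto
    ultimately show ?thesis by (metis mult.commute mult_right_mono zero_le_power2)
  qed
  moreover have "B \<ge> 0" unfolding B_def using b by (intro sum_nonneg) auto
  ultimately show ?thesis using that[OF lL(1,2)] by simp
qed

end

locale umbilical_flow =
  fixes A :: "('m::topological_space, 'e::euclidean_space) chart set"
    and D P :: "'m \<Rightarrow> 'e set" and n p :: nat and gt :: "real \<Rightarrow> ('m, 'e) tensor2"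
  assumes smooth_atlas: "smooth_atlas A" and distribution_D: "distribution A D n" and distribution_P: "distribution A P p"
    and complementary: "complementary D P" and evolution: "evolution_solution A D P n gt"
    and umbilical: "umbilical A D P (gt 0)" and n_pos: "n > 0"
begin

lemma orthogonal_foliation_at: "t \<ge> 0 \<Longrightarrow> orthogonal_foliation A (gt t) D P n p"
  using smooth_atlas distribution_D distribution_P complementary evolution
  unfolding evolution_solution_def smooth_metric_family_def
  by unfold_locales auto

abbreviation H where "H t \<equiv> mean_curvature A D P (gt t)"

lemma time_derivative: "t \<ge> 0 \<Longrightarrow> ((\<lambda>s. gt s x u v) has_real_derivative
        - (2 / real n) * div_perp A P (gt t) (H t) x * truncated_metric D P (gt t) x u v) (at t within {0..})"
  using evolution unfolding evolution_solution_def by blast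

lemma perp_part_P: "u \<in> P x \<Longrightarrow> perp_part D P x u = u" and perp_part_D: "u \<in> D x \<Longrightarrow> perp_part D P x u = 0"
proof -
  interpret orthogonal_foliation A "gt 0" D P n p by (rule orthogonal_foliation_at) simp
  show "u \<in> P x \<Longrightarrow> perp_part D P x u = u" by (rule perp_part_unique) (auto intro: subspace_0)
  show "u \<in> D x \<Longrightarrow> perp_part D P x u = 0" by (rule perp_part_unique) (auto intro: subspace_0)
qed

lemma constant_if_derivative_zero:
  assumes "\<And>t. t \<ge> 0 \<Longrightarrow> (f has_real_derivative 0) (at t within {0..})" "t \<ge> 0"
  shows "f t = (f 0 :: real)"
proof -
  have "\<exists>k. \<forall>t\<in>{0..}. f t = k" by (rule has_field_derivative_zero_constant) (use assms in auto)
  then show ?thesis using assms(2) by force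
qed

text \<open>The truncated metric vanishes on \<open>P\<close>, so the evolution does not change the metric there.\<close>

lemma gt_P:
  assumes "u \<in> P x" "t \<ge> 0" shows "gt t x u v = gt 0 x u v"
proof (rule constant_if_derivative_zero[OF _ assms(2)])
  fix s :: real assume s: "s \<ge> 0"
  interpret orthogonal_foliation A "gt s" D P n p by (rule orthogonal_foliation_at[OF s])
  have "truncated_metric D P (gt s) x u v = 0"
    unfolding truncated_metric_def perp_part_P[OF assms(1)] using linear_0[OF linear_g(2)] by simp
  then show "((\<lambda>t. gt t x u v) has_real_derivative 0) (at s within {0..})" using time_derivative[OF s, of x u v] by simp
qed

lemma gt_D_derivative:
  assumes "h \<in> D x" "t \<ge> 0"
  shows "((\<lambda>s. gt s x h h) has_real_derivative - (2 / real n) * div_perp A P (gt t) (H t) x * gt t x h h) (at t within {0..})"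
  using time_derivative[OF assms(2), of x h h] unfolding truncated_metric_def perp_part_D[OF assms(1)] by simp

text \<open>On \<open>D\<close> the evolution is conformal: at each point all squared lengths satisfy the same linear equation
  in time, so their quotients are constant.\<close>

lemma gt_D_ratio:
  assumes h: "h \<in> D x" and k: "k \<in> D x" "k \<noteq> 0" and t: "t \<ge> 0"
  shows "gt t x h h * gt 0 x k k = gt 0 x h h * gt t x k k"
proof -
  have pos: "gt s x k k > 0" if "s \<ge> 0" for s
  proof -
    interpret orthogonal_foliation A "gt s" D P n p by (rule orthogonal_foliation_at[OF that])
    show ?thesis by (rule g_pos[OF k(2)])
  qed
  have "gt t x h h / gt t x k k = gt 0 x h h / gt 0 x k k"
  proof (rule constant_if_derivative_zero[OF _ t])
    fix s :: real assume s: "s \<ge> 0"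
    from DERIV_divide[OF gt_D_derivative[OF h s] gt_D_derivative[OF k(1) s]] pos[OF s]
    show "((\<lambda>s. gt s x h h / gt s x k k) has_real_derivative 0) (at s within {0..})" by (simp add: algebra_simps)
  qed
  then show ?thesis using pos[OF t] pos[of 0] by (simp add: field_simps)
qed

end

locale flat_umbilical_flow = umbilical_flow A D P n p gt
  for A :: "('m::topological_space, 'e::euclidean_space) chart set"
    and D P :: "'m \<Rightarrow> 'e set" and n p :: nat and gt :: "real \<Rightarrow> ('m, 'e) tensor2" +
  fixes c :: "('m, 'e) chart" and W :: "'e set"
  assumes flat: "flat_chart A P c W"
begin

lemma flat_foliation_at: "t \<ge> 0 \<Longrightarrow> flat_foliation A (gt t) D P n p c W"
  using orthogonal_foliation_at flat by (simp add: flat_foliation_def flat_foliation_axioms_def)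

abbreviation M where "M t \<equiv> metric_rep A c (gt t)"
abbreviation \<Omega> where "\<Omega> \<equiv> snd c ` fst c"
abbreviation T where "T \<equiv> to_comp A c"
abbreviation V where "V \<equiv> hor A D P c"

definition q where "q t v z = M t z (V v z) (V v z)"

lemma q_eq: "t \<ge> 0 \<Longrightarrow> flat_foliation.Q A (gt t) D P c v = q t v"
  unfolding q_def[abs_def] using flat_foliation.Q_def[OF flat_foliation_at] by (auto simp: fun_eq_iff)

lemma q_ratio:
  assumes t: "t \<ge> 0" and z: "z \<in> \<Omega>" and v: "v \<notin> W"
  shows "q t a z * q 0 v z = q 0 a z * q t v z"
proof -
  interpret g0: flat_foliation A "gt 0" D P n p c W by (rule flat_foliation_at) simp
  interpret gt: flat_foliation A "gt t" D P n p c W by (rule flat_foliation_at[OF t])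
  obtain x where x: "x \<in> fst c" "z = snd c x" using z by blast
  obtain h where h: "h \<in> D x" "V a z = T x h" using g0.V_D[OF x(1)] x(2) by blast
  obtain k where k: "k \<in> D x" "V v z = T x k" using g0.V_D[OF x(1)] x(2) by blast
  have "k \<noteq> 0" using g0.V_eq_0_iff[OF z, of v] v k(2) linear_0[OF g0.lT[OF x(1)]] by auto
  from gt_D_ratio[OF h(1) k(1) this t] show ?thesis
    unfolding q_def h(2) k(2) unfolding x(2) g0.M_T[OF x(1)] gt.M_T[OF x(1)] .
qed

lemma M_W: assumes "t \<ge> 0" "z \<in> \<Omega>" "a \<in> W" shows "M t z a b = M 0 z a b"
proof -
  interpret g0: flat_foliation A "gt 0" D P n p c W by (rule flat_foliation_at) simp
  obtain x where x: "x \<in> fst c" "z = snd c x" using assms by blast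
  show ?thesis unfolding metric_rep_def
    by (rule gt_P[OF _ assms(1)]) (use g0.of_comp_in_P[OF x(1) assms(3)] x g0.ic in simp)
qed

lemma dmetric_W: assumes "t \<ge> 0" "z \<in> \<Omega>" "a \<in> W"
  shows "riemannian.dmetric A (gt t) c z u a b = riemannian.dmetric A (gt 0) c z u a b"
proof -
  interpret g0: flat_foliation A "gt 0" D P n p c W by (rule flat_foliation_at) simp
  interpret gt: flat_foliation A "gt t" D P n p c W by (rule flat_foliation_at[OF assms(1)])
  have "frechet_derivative (\<lambda>z. M t z a b) (at z) = frechet_derivative (\<lambda>z. M 0 z a b) (at z)"
    by (rule frechet_derivative_cong_open[OF g0.open_\<Omega> assms(2)]) (rule M_W[OF assms(1) _ assms(3)])
  then show ?thesis unfolding gt.dmetric_def g0.dmetric_def by simp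
qed

text \<open>Umbilicity is preserved. Initially \<open>q 0 a\<close> and \<open>q 0 v\<close> have the same logarithmic derivative along the leaf
  by umbilicity, and \<open>q t a / q t v\<close> does not depend on \<open>t\<close>.\<close>

lemma q_log_derivative:
  assumes t: "t \<ge> 0" and z: "z \<in> \<Omega>" and v: "v \<notin> W" and \<xi>: "\<xi> \<in> W"
  shows "frechet_derivative (q t a) (at z) \<xi> * q t v z = q t a z * frechet_derivative (q t v) (at z) \<xi>"
proof -
  interpret g0: flat_foliation A "gt 0" D P n p c W by (rule flat_foliation_at) simp
  interpret gt: flat_foliation A "gt t" D P n p c W by (rule flat_foliation_at[OF t])
  obtain x where x: "x \<in> fst c" "z = snd c x" using z by blast
  obtain \<eta> where \<eta>: "\<eta> \<in> P x" "\<xi> = T x \<eta>" using g0.to_comp_P[OF x(1)] \<xi> by blast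
  have Dt: "(q t a has_derivative frechet_derivative (q t a) (at z)) (at z)" for a
    using smooth_on_has_derivative[OF g0.open_\<Omega> gt.smooth_Q z] unfolding q_eq[OF t] .
  have D0: "(q 0 a has_derivative frechet_derivative (q 0 a) (at z)) (at z)" for a
    using smooth_on_has_derivative[OF g0.open_\<Omega> g0.smooth_Q z] unfolding q_eq[OF order_refl] .
  have "((\<lambda>z. q 0 a z * q t v z) has_derivative
      (\<lambda>h. q t a z * frechet_derivative (q 0 v) (at z) h + frechet_derivative (q t a) (at z) h * q 0 v z)) (at z)"
    by (rule has_derivative_transform_within_open[OF has_derivative_mult[OF Dt D0] g0.open_\<Omega> z]) (rule q_ratio[OF t _ v])
  from fun_cong[OF has_derivative_unique[OF has_derivative_mult[OF D0 Dt] this], of \<xi>]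
  have 1: "q 0 a z * frechet_derivative (q t v) (at z) \<xi> + frechet_derivative (q 0 a) (at z) \<xi> * q t v z
     = q t a z * frechet_derivative (q 0 v) (at z) \<xi> + frechet_derivative (q t a) (at z) \<xi> * q 0 v z" .
  define k where "k = - (2 / n) * gt 0 x (H 0 x) \<eta>"
  have umb: "frechet_derivative (q 0 a) (at z) \<xi> = k * q 0 a z" for a
    using g0.umbilical_Q[OF umbilical n_pos x(1) \<eta>(1), of a] unfolding q_eq[OF order_refl] \<eta>(2) x(2) k_def by simp
  have r: "q t a z * q 0 v z = q 0 a z * q t v z" by (rule q_ratio[OF t z v])
  have pos: "q 0 v z > 0" using g0.Q_pos[OF z v] unfolding q_eq[OF order_refl] .
  have "q 0 a z * frechet_derivative (q t v) (at z) \<xi> = frechet_derivative (q t a) (at z) \<xi> * q 0 v z"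
    using 1 r unfolding umb by (simp add: algebra_simps)
  then have "q 0 a z * q t v z * frechet_derivative (q t v) (at z) \<xi> = frechet_derivative (q t a) (at z) \<xi> * q 0 v z * q t v z"
    by (simp add: algebra_simps)
  then have "q 0 v z * (q t a z * frechet_derivative (q t v) (at z) \<xi>) = q 0 v z * (frechet_derivative (q t a) (at z) \<xi> * q t v z)"
    unfolding r[symmetric] by (simp add: algebra_simps)
  then show ?thesis using pos by simp
qed

text \<open>So \<open>H\<^sub>t = - (n / 2) grad (ln q)\<close> on the leaves: each of the \<open>n\<close> summands of the trace contributes the same
  logarithmic derivative.\<close>

lemma mean_curvature_q:
  assumes t: "t \<ge> 0" and x: "x \<in> fst c" and v: "v \<notin> W" and \<eta>: "\<eta> \<in> P x"
  shows "gt t x (H t x) \<eta> = - (n / 2) * frechet_derivative (q t v) (at (snd c x)) (T x \<eta>) / q t v (snd c x)"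
proof -
  interpret gt: flat_foliation A "gt t" D P n p c W by (rule flat_foliation_at[OF t])
  have z: "snd c x \<in> \<Omega>" using x by blast
  have W: "T x \<eta> \<in> W" using gt.to_comp_P[OF x] \<eta> by blast
  obtain a where a: "\<forall>i<n. q t (a i) (snd c x) = 1"
    "gt t x (H t x) \<eta> = - (1/2) * (\<Sum>i<n. frechet_derivative (q t (a i)) (at (snd c x)) (T x \<eta>))"
    by (rule gt.mean_curvature_Q[OF x \<eta>, unfolded q_eq[OF t]])
  have pos: "q t v (snd c x) > 0" using gt.Q_pos[OF z v] unfolding q_eq[OF t] .
  have "frechet_derivative (q t (a i)) (at (snd c x)) (T x \<eta>) = frechet_derivative (q t v) (at (snd c x)) (T x \<eta>) / q t v (snd c x)"
    if "i < n" for i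
    using q_log_derivative[OF t z v W, of "a i"] a(1) that pos by (simp add: field_simps)
  then show ?thesis unfolding a(2) by simp
qed

end

section \<open>The evolution as a parabolic equation along the leaves\<close>

context flat_umbilical_flow
begin

abbreviation Hc where "Hc t \<equiv> vf_rep A c (H t)"
abbreviation Dq where "Dq t v z \<equiv> frechet_derivative (q t v) (at z)"
abbreviation D2q where "D2q t v z e \<equiv> frechet_derivative (\<lambda>z. frechet_derivative (q t v) (at z) e) (at z) e"
abbreviation dM where "dM t \<equiv> riemannian.dmetric A (gt t) c"

lemma smooth_q: assumes "t \<ge> 0" shows "smooth_on \<Omega> (q t v)"
  using flat_foliation.smooth_Q[OF flat_foliation_at[OF assms]] unfolding q_eq[OF assms] .

lemma q_pos: assumes "t \<ge> 0" shows "z \<in> \<Omega> \<Longrightarrow> v \<notin> W \<Longrightarrow> q t v z > 0"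
  using flat_foliation.Q_pos[OF flat_foliation_at[OF assms]] unfolding q_eq[OF assms] .

lemma Hc_W: assumes "t \<ge> 0" "z \<in> \<Omega>" shows "Hc t z \<in> W"
proof -
  interpret gt: flat_foliation A "gt t" D P n p c W by (rule flat_foliation_at[OF assms(1)])
  obtain x where x: "x \<in> fst c" "z = snd c x" using assms by blast
  show ?thesis unfolding x(2) gt.vf_rep_at[OF gt.ic x(1)] gt.to_comp_in_W[OF x(1)] by (rule gt.mean_curvature_in_P)
qed

lemma M_Hc:
  assumes t: "t \<ge> 0" and z: "z \<in> \<Omega>" and v: "v \<notin> W" and \<xi>: "\<xi> \<in> W"
  shows "M t z (Hc t z) \<xi> = - (n / 2) * Dq t v z \<xi> / q t v z"
proof -
  interpret gt: flat_foliation A "gt t" D P n p c W by (rule flat_foliation_at[OF t])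
  obtain x where x: "x \<in> fst c" "z = snd c x" using z by blast
  obtain \<eta> where \<eta>: "\<eta> \<in> P x" "\<xi> = T x \<eta>" using gt.to_comp_P[OF x(1)] \<xi> by blast
  show ?thesis
    using mean_curvature_q[OF t x(1) v \<eta>(1)] unfolding x(2) \<eta>(2) gt.vf_rep_at[OF gt.ic x(1)] gt.M_T[OF x(1)] .
qed

text \<open>The gradient formula expresses \<open>H\<close> in a smooth orthonormal frame of \<open>P\<close> by first derivatives of \<open>q\<close>.\<close>

lemma smooth_Hc:
  assumes t: "t \<ge> 0" and v: "v \<notin> W" shows "smooth_on \<Omega> (Hc t)"
proof (rule smooth_on_local)
  interpret gt: flat_foliation A "gt t" D P n p c W by (rule flat_foliation_at[OF t])
  fix z0 assume "z0 \<in> \<Omega>"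
  then obtain x0 where x0: "x0 \<in> fst c" "z0 = snd c x0" by blast
  obtain e U where U: "x0 \<in> U" and fr: "orthonormal_frame A (gt t) P p U e"
    using gt.orthonormal_frame_exists[OF distribution_P] by blast
  have oU: "open U" and e: "\<And>i. i < p \<Longrightarrow> smooth_vf A U (e i)" "\<And>i x. i < p \<Longrightarrow> x \<in> U \<Longrightarrow> e i x \<in> P x"
    and on: "\<And>x i j. x \<in> U \<Longrightarrow> i < p \<Longrightarrow> j < p \<Longrightarrow> gt t x (e i x) (e j x) = (if i = j then 1 else 0)"
    using fr unfolding orthonormal_frame_def smooth_section_def by blast+
  let ?V = "snd c ` (fst c \<inter> U)"
  have oV: "open ?V" by (rule is_chart_open_image[OF gt.ic oU])
  have se: "smooth_on ?V (vf_rep A c (e i))" if "i < p" for i by (rule gt.smooth_on_vf_rep[OF gt.sc oU e(1)[OF that]])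
  have sq: "smooth_on ?V (q t v)" by (rule smooth_on_subset[OF smooth_q[OF t]]) blast
  have sD: "smooth_on ?V (\<lambda>z. Dq t v z (vf_rep A c (e i) z))" if "i < p" for i
  proof (rule smooth_on_linear_family[where L="Dq t v", OF oV _ smooth_on_deriv[OF oV sq] se[OF that]])
    show "linear (Dq t v y)" if "y \<in> ?V" for y
      using smooth_on_has_derivative[OF oV sq that] has_derivative_linear by blast
  qed
  have "smooth_on ?V (\<lambda>z. \<Sum>i<p. (- (n / 2) * Dq t v z (vf_rep A c (e i) z) * q t v z powr (-1)) *\<^sub>R vf_rep A c (e i) z)"
    by (intro smooth_on_sum smooth_on_scaleR smooth_on_mult smooth_on_powr oV smooth_on_const se sD sq) (use q_pos[OF t _ v] in auto)
  then have "smooth_on ?V (Hc t)"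
  proof (rule smooth_on_eqI)
    fix z assume "z \<in> ?V"
    then obtain x where x: "x \<in> fst c" "x \<in> U" "z = snd c x" by blast
    have qp: "q t v z > 0" using q_pos[OF t _ v] x by blast
    have "H t x = (\<Sum>i<p. gt t x (H t x) (e i x) *\<^sub>R e i x)"
      by (rule gt.orthonormal_expansion[where E="P x"]) (use e x on gt.mean_curvature_in_P in auto)
    then have "T x (H t x) = T x (\<Sum>i<p. gt t x (H t x) (e i x) *\<^sub>R e i x)" by simp
    also have "\<dots> = (\<Sum>i<p. gt t x (H t x) (e i x) *\<^sub>R T x (e i x))"
      by (simp add: linear_sum[OF gt.lT[OF x(1)]] linear_cmul[OF gt.lT[OF x(1)]])
    also have "\<dots> = (\<Sum>i<p. (- (n / 2) * Dq t v z (T x (e i x)) * q t v z powr (-1)) *\<^sub>R T x (e i x))"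
    proof (rule sum.cong[OF refl])
      fix i assume "i \<in> {..<p}"
      then have "i < p" by simp
      from mean_curvature_q[OF t x(1) v e(2)[OF this x(2)]]
      have "gt t x (H t x) (e i x) = - (n / 2) * Dq t v z (T x (e i x)) / q t v z" unfolding x(3) .
      also have "\<dots> = - (n / 2) * Dq t v z (T x (e i x)) * q t v z powr (-1)" unfolding powr_neg_one[OF qp] by simp
      finally show "gt t x (H t x) (e i x) *\<^sub>R T x (e i x) = (- (n / 2) * Dq t v z (T x (e i x)) * q t v z powr (-1)) *\<^sub>R T x (e i x)"
        by (rule arg_cong)
    qed
    finally show "Hc t z = (\<Sum>i<p. (- (n / 2) * Dq t v z (vf_rep A c (e i) z) * q t v z powr (-1)) *\<^sub>R vf_rep A c (e i) z)"
      unfolding x(3) gt.vf_rep_at[OF gt.ic x(1)] .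
  qed
  then have "smooth_on (\<Omega> \<inter> ?V) (Hc t)" by (rule smooth_on_subset) blast
  then show "\<exists>V'. open V' \<and> z0 \<in> V' \<and> smooth_on (\<Omega> \<inter> V') (Hc t)" using oV x0 U by blast
qed

text \<open>Differentiate \<open>g (H, e\<^sub>i) = - (n / 2) Dq e\<^sub>i / q\<close> along the constant field \<open>e\<^sub>i\<close>. This replaces the
  derivative of \<open>H\<close> in the divergence by second derivatives of \<open>q\<close>, up to terms linear in \<open>H\<close>.\<close>

lemma divergence_formula:
  assumes t: "t \<ge> 0" and x: "x \<in> fst c" and v: "v \<notin> W"
  defines "z \<equiv> snd c x"
  obtains e where "\<forall>i<p. e i \<in> W \<and> M t z (e i) (e i) = 1" "\<forall>\<xi>\<in>W. \<xi> = (\<Sum>i<p. M t z \<xi> (e i) *\<^sub>R e i)"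
    "\<forall>\<xi>\<in>W. M t z \<xi> \<xi> = (\<Sum>i<p. (M t z \<xi> (e i))\<^sup>2)"
    "div_perp A P (gt t) (H t) x = (\<Sum>i<p. - (n / 2) * (D2q t v z (e i) / q t v z - (Dq t v z (e i))\<^sup>2 / (q t v z)\<^sup>2)
       - dM t z (e i) (Hc t z) (e i) + dM t z (Hc t z) (e i) (e i) / 2)"
proof -
  interpret gt: flat_foliation A "gt t" D P n p c W by (rule flat_foliation_at[OF t])
  have z: "z \<in> \<Omega>" unfolding z_def using x by blast
  obtain U where U: "x \<in> U" "orthonormal_frame A (gt t) P p U (frame_at A (gt t) P x)" using gt.frame_at[OF distribution_P] .
  let ?\<epsilon> = "frame_at A (gt t) P x"
  have \<epsilon>: "\<And>i. i < p \<Longrightarrow> ?\<epsilon> i x \<in> P x" "\<And>i j. i < p \<Longrightarrow> j < p \<Longrightarrow> gt t x (?\<epsilon> i x) (?\<epsilon> j x) = (if i = j then 1 else 0)"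
    using U unfolding orthonormal_frame_def smooth_section_def by auto
  define e where "e i = T x (?\<epsilon> i x)" for i
  have M_T: "M t z (T x a) (T x b) = gt t x a b" for a b unfolding z_def by (rule gt.M_T[OF x])
  have eW: "e i \<in> W" if "i < p" for i using \<epsilon>(1)[OF that] gt.to_comp_P[OF x] unfolding e_def by blast
  have Mee: "M t z (e i) (e i) = 1" if "i < p" for i unfolding e_def M_T using \<epsilon>(2) that by simp
  have exp: "\<xi> = (\<Sum>i<p. M t z \<xi> (e i) *\<^sub>R e i)" if \<xi>: "\<xi> \<in> W" for \<xi>
  proof -
    obtain \<eta> where \<eta>: "\<eta> \<in> P x" "\<xi> = T x \<eta>" using gt.to_comp_P[OF x] \<xi> by blast
    have "\<eta> = (\<Sum>i<p. gt t x \<eta> (?\<epsilon> i x) *\<^sub>R ?\<epsilon> i x)"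
      by (rule gt.orthonormal_expansion[where E="P x"]) (use \<epsilon> \<eta> in auto)
    then have "T x \<eta> = T x (\<Sum>i<p. gt t x \<eta> (?\<epsilon> i x) *\<^sub>R ?\<epsilon> i x)" by simp
    then show ?thesis unfolding e_def \<eta>(2) M_T by (simp add: linear_sum[OF gt.lT[OF x]] linear_cmul[OF gt.lT[OF x]])
  qed
  have norm: "M t z \<xi> \<xi> = (\<Sum>i<p. (M t z \<xi> (e i))\<^sup>2)" if "\<xi> \<in> W" for \<xi>
  proof -
    have "M t z \<xi> \<xi> = M t z \<xi> (\<Sum>i<p. M t z \<xi> (e i) *\<^sub>R e i)" using exp[OF that] by simp
    then show ?thesis by (simp add: linear_sum[OF gt.linear_M(1)[OF z]] linear_cmul[OF gt.linear_M(1)[OF z]] power2_eq_square)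
  qed
  note DH = smooth_on_has_derivative[OF gt.open_\<Omega> smooth_Hc[OF t v] z]
  have qp: "q t v z > 0" by (rule q_pos[OF t z v])
  have diffH: "Hc t differentiable (at z)" using DH differentiableI by blast
  have Hx: "T x (H t x) = Hc t z" unfolding z_def gt.vf_rep_at[OF gt.ic x] ..
  have l0: "M t z u 0 = 0" for u using linear_0[OF gt.linear_M(1)[OF z]] .
  have "gt t x (levi_civita A (gt t) (?\<epsilon> i) (H t) x) (?\<epsilon> i x) = 
      - (n / 2) * (D2q t v z (e i) / q t v z - (Dq t v z (e i))\<^sup>2 / (q t v z)\<^sup>2)
       - dM t z (e i) (Hc t z) (e i) + dM t z (Hc t z) (e i) (e i) / 2" if i: "i < p" for i
  proof -
    have 1: "gt t x (levi_civita A (gt t) (?\<epsilon> i) (H t) x) (?\<epsilon> i x) = 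
       M t z (frechet_derivative (Hc t) (at z) (e i)) (e i) + dM t z (Hc t z) (e i) (e i) / 2"
      using gt.divergence_term[OF gt.sc x diffH[unfolded z_def], of "?\<epsilon> i"] unfolding e_def Hx[symmetric] unfolding z_def .
    have D1: "((\<lambda>z. M t z (Hc t z) (e i)) has_derivative
       (\<lambda>h. dM t z h (Hc t z) (e i) + M t z (frechet_derivative (Hc t) (at z) h) (e i) + M t z (Hc t z) 0)) (at z)"
      by (rule gt.metric_has_derivative[OF gt.sc z DH has_derivative_const])
    have Dd: "((\<lambda>z. Dq t v z (e i)) has_derivative (frechet_derivative (\<lambda>z. Dq t v z (e i)) (at z))) (at z)"
      by (rule smooth_on_has_derivative[OF gt.open_\<Omega> smooth_on_deriv[OF gt.open_\<Omega> smooth_q[OF t]] z])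
    have Dqq: "(q t v has_derivative Dq t v z) (at z)" by (rule smooth_on_has_derivative[OF gt.open_\<Omega> smooth_q[OF t] z])
    have "((\<lambda>z. - (n / 2) * (Dq t v z (e i) / q t v z)) has_derivative
       (\<lambda>h. - (n / 2) * (- Dq t v z (e i) * (inverse (q t v z) * Dq t v z h * inverse (q t v z))
          + frechet_derivative (\<lambda>z. Dq t v z (e i)) (at z) h / q t v z))) (at z)"
      by (intro has_derivative_mult_right has_derivative_divide Dd Dqq) (use qp in simp)
    then have D2: "((\<lambda>z. M t z (Hc t z) (e i)) has_derivative
       (\<lambda>h. - (n / 2) * (- Dq t v z (e i) * (inverse (q t v z) * Dq t v z h * inverse (q t v z))
          + frechet_derivative (\<lambda>z. Dq t v z (e i)) (at z) h / q t v z))) (at z)"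
      by (rule has_derivative_transform_within_open[OF _ gt.open_\<Omega> z]) (simp add: M_Hc[OF t _ v eW[OF i]])
    from fun_cong[OF has_derivative_unique[OF D1 D2], of "e i"]
    have "M t z (frechet_derivative (Hc t) (at z) (e i)) (e i) = 
      - (n / 2) * (- Dq t v z (e i) * (inverse (q t v z) * Dq t v z (e i) * inverse (q t v z)) + D2q t v z (e i) / q t v z)
      - dM t z (e i) (Hc t z) (e i)" unfolding l0 by simp
    also have "- Dq t v z (e i) * (inverse (q t v z) * Dq t v z (e i) * inverse (q t v z)) = - (Dq t v z (e i))\<^sup>2 / (q t v z)\<^sup>2"
      by (simp add: power2_eq_square divide_inverse)
    finally show ?thesis unfolding 1 by (simp add: algebra_simps)
  qed
  then have "div_perp A P (gt t) (H t) x = (\<Sum>i<p. - (n / 2) * (D2q t v z (e i) / q t v z - (Dq t v z (e i))\<^sup>2 / (q t v z)\<^sup>2)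
       - dM t z (e i) (Hc t z) (e i) + dM t z (Hc t z) (e i) (e i) / 2)"
    unfolding div_perp_def by simp
  then show ?thesis using that[of e] eW Mee exp norm by blast
qed

lemma q_time_derivative:
  assumes t: "t > 0" and x: "x \<in> fst c"
  shows "((\<lambda>s. q s v (snd c x)) has_real_derivative - (2 / n) * div_perp A P (gt t) (H t) x * q t v (snd c x)) (at t)"
proof -
  interpret g0: flat_foliation A "gt 0" D P n p c W by (rule flat_foliation_at) simp
  obtain h where h: "h \<in> D x" "V v (snd c x) = T x h" using g0.V_D[OF x] by blast
  have q: "q s v (snd c x) = gt s x h h" for s
    unfolding q_def h(2) metric_rep_def using g0.ic x g0.sc by simp
  have "t \<in> interior {0..}" using t by simp
  from gt_D_derivative[OF h(1), of t] show ?thesis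
    unfolding q at_within_interior[OF \<open>t \<in> interior {0..}\<close>] using t by simp
qed

text \<open>The evolution equation says that \<open>\<partial>\<^sub>t (ln q)\<close> is the leafwise Laplacian of \<open>ln q\<close>. The quadratic gradient
  terms contribute \<open>- (Dq e\<^sub>i)\<^sup>2 / q\<close>, which has the good sign, so \<open>q\<close> itself is a subsolution. The first order
  coefficients only involve the metric on \<open>P\<close> and its derivatives along \<open>P\<close>; these are independent of \<open>t\<close>,
  which makes \<open>C\<close> uniform in time.\<close>

theorem q_subsolution:
  assumes z0: "z0 \<in> \<Omega>" and v: "v \<notin> W"
  obtains r C where "r > 0" "C > 0" "ball z0 r \<subseteq> \<Omega>"
    "\<forall>t>0. \<forall>z\<in>ball z0 r. \<exists>\<tau> e. ((\<lambda>s. q s v z) has_real_derivative \<tau>) (at t) \<and> subsolution_frame p W C (q t v) z \<tau> e"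
proof -
  interpret g0: flat_foliation A "gt 0" D P n p c W by (rule flat_foliation_at) simp
  obtain r where r: "r > 0" "cball z0 r \<subseteq> \<Omega>" using g0.open_\<Omega> z0 open_contains_cball by blast
  obtain l L B where l: "l > 0" "L > 0" "B \<ge> 0"
    and lLM: "\<forall>z\<in>cball z0 r. \<forall>u. l * (norm u)\<^sup>2 \<le> M 0 z u u \<and> M 0 z u u \<le> L * (norm u)\<^sup>2"
    and dMB0: "\<forall>z\<in>cball z0 r. \<forall>u v w. \<bar>dM 0 z u v w\<bar> \<le> B * norm u * norm v * norm w"
    using g0.metric_bounds[OF g0.sc compact_cball r(2)] .
  have lM: "l * (norm u)\<^sup>2 \<le> M 0 z u u" and uM: "M 0 z u u \<le> L * (norm u)\<^sup>2" if "z \<in> cball z0 r" for z u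
    using lLM that by blast+
  have dMB: "\<bar>dM 0 z u v w\<bar> \<le> B * norm u * norm v * norm w" if "z \<in> cball z0 r" for z u v w
    using dMB0 that by blast
  define C where "C = sqrt (1 / l) + L + real p * (3 * B / (2 * l\<^sup>2)) + 1"
  have "real p * (3 * B / (2 * l\<^sup>2)) \<ge> 0" using l by simp
  then have C: "C > 0" "sqrt (1 / l) \<le> C" "L \<le> C" "real p * (3 * B / (2 * l\<^sup>2)) \<le> C"
    using l unfolding C_def by (auto intro!: add_nonneg_nonneg add_nonneg_pos)
  have main: "\<exists>\<tau> e. ((\<lambda>s. q s v z) has_real_derivative \<tau>) (at t) \<and> subsolution_frame p W C (q t v) z \<tau> e"
    if t: "t > 0" and zr: "z \<in> ball z0 r" for t z
  proof -
    have t0: "t \<ge> 0" using t by simp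
    have zc: "z \<in> cball z0 r" and z: "z \<in> \<Omega>" using zr r(2) by auto
    interpret gt: flat_foliation A "gt t" D P n p c W by (rule flat_foliation_at[OF t0])
    obtain x where x: "x \<in> fst c" "z = snd c x" using z by blast
    obtain e where e0: "\<forall>i<p. e i \<in> W \<and> M t z (e i) (e i) = 1" and exp0: "\<forall>\<xi>\<in>W. \<xi> = (\<Sum>i<p. M t z \<xi> (e i) *\<^sub>R e i)"
      and sq0: "\<forall>\<xi>\<in>W. M t z \<xi> \<xi> = (\<Sum>i<p. (M t z \<xi> (e i))\<^sup>2)"
      and div: "div_perp A P (gt t) (H t) x = (\<Sum>i<p. - (n / 2) * (D2q t v z (e i) / q t v z - (Dq t v z (e i))\<^sup>2 / (q t v z)\<^sup>2)
       - dM t z (e i) (Hc t z) (e i) + dM t z (Hc t z) (e i) (e i) / 2)"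
      using divergence_formula[OF t0 x(1) v] unfolding x(2) .
    let ?h = "Hc t z" and ?q = "q t v z"
    have hW: "?h \<in> W" by (rule Hc_W[OF t0 z])
    have qp: "?q > 0" by (rule q_pos[OF t0 z v])
    have eW: "e i \<in> W" if "i < p" for i using e0 that by blast
    have norm_e: "(norm (e i))\<^sup>2 \<le> 1 / l" if "i < p" for i
    proof -
      have "M 0 z (e i) (e i) = 1" using e0 that M_W[OF t0 z eW[OF that], of "e i"] by simp
      then have "l * (norm (e i))\<^sup>2 \<le> 1" using lM[OF zc, of "e i"] by simp
      then show ?thesis using l(1) by (simp add: field_simps)
    qed
    define \<tau> where "\<tau> = - (2 / n) * div_perp A P (gt t) (H t) x * ?q"
    have \<tau>: "((\<lambda>s. q s v z) has_real_derivative \<tau>) (at t)"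
      unfolding \<tau>_def x(2) by (rule q_time_derivative[OF t x(1)])
    have "subsolution_frame p W C (q t v) z \<tau> e"
      unfolding subsolution_frame_def
    proof (intro conjI allI impI ballI)
      show "e i \<in> W" if "i < p" for i by (rule eW[OF that])
      show "norm (e i) \<le> C" if "i < p" for i
        using real_le_rsqrt[OF norm_e[OF that]] C(2) by simp
      \<comment> \<open>Cauchy-Schwarz for \<open>|\<xi>|\<^sup>2 = \<Sum> g (\<xi>, e\<^sub>i) (\<xi> \<bullet> e\<^sub>i)\<close>, where \<open>\<Sum> g (\<xi>, e\<^sub>i)\<^sup>2 = g (\<xi>, \<xi>)\<close>.\<close>
      show "(norm \<xi>)\<^sup>2 \<le> C * (\<Sum>i<p. (\<xi> \<bullet> e i)\<^sup>2)" if \<xi>: "\<xi> \<in> W" for \<xi>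
      proof -
        let ?S = "\<Sum>i<p. (\<xi> \<bullet> e i)\<^sup>2"
        have "(norm \<xi>)\<^sup>2 = \<xi> \<bullet> (\<Sum>i<p. M t z \<xi> (e i) *\<^sub>R e i)"
          using exp0 \<xi> by (simp add: power2_norm_eq_inner)
        also have "\<dots> = (\<Sum>i<p. M t z \<xi> (e i) * (\<xi> \<bullet> e i))" by (simp add: inner_sum_right)
        finally have "((norm \<xi>)\<^sup>2)\<^sup>2 \<le> (\<Sum>i<p. (M t z \<xi> (e i))\<^sup>2) * ?S"
          using Cauchy_Schwarz_ineq_sum[of "\<lambda>i. M t z \<xi> (e i)" "\<lambda>i. \<xi> \<bullet> e i" "{..<p}"] by simp
        also have "(\<Sum>i<p. (M t z \<xi> (e i))\<^sup>2) = M 0 z \<xi> \<xi>" using sq0[rule_format, OF \<xi>] M_W[OF t0 z \<xi>, of \<xi>] by argo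
        also have "M 0 z \<xi> \<xi> * ?S \<le> (C * (norm \<xi>)\<^sup>2) * ?S"
        proof (rule mult_right_mono)
          have "L * (norm \<xi>)\<^sup>2 \<le> C * (norm \<xi>)\<^sup>2" using C(3) by (intro mult_right_mono) auto
          then show "M 0 z \<xi> \<xi> \<le> C * (norm \<xi>)\<^sup>2" using uM[OF zc, of \<xi>] by simp
        qed (auto intro: sum_nonneg)
        finally have *: "(norm \<xi>)\<^sup>2 * (norm \<xi>)\<^sup>2 \<le> (norm \<xi>)\<^sup>2 * (C * ?S)" by (simp add: power2_eq_square mult_ac)
        show ?thesis
        proof (cases "\<xi> = 0")
          case False
          then have "(norm \<xi>)\<^sup>2 > 0" by simp
          from mult_left_le_imp_le[OF * this] show ?thesis .
        qed (use C(1) in \<open>simp add: sum_nonneg\<close>)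
      qed
      show "\<tau> \<le> (\<Sum>i<p. D2q t v z (e i)) + C * N" if N: "N \<ge> 0" and DN: "\<forall>a\<in>W. \<bar>Dq t v z a\<bar> \<le> N * norm a" for N
      proof -
        \<comment> \<open>The mean curvature is controlled by the leafwise gradient of \<open>q\<close>.\<close>
        have qh: "?q * norm ?h \<le> n * N / (2 * l)"
        proof (cases "?h = 0")
          case False
          then have hp: "norm ?h > 0" by simp
          have "l * (norm ?h)\<^sup>2 \<le> M 0 z ?h ?h" by (rule lM[OF zc])
          also have "\<dots> = - (n / 2) * Dq t v z ?h / ?q" using M_W[OF t0 z hW] M_Hc[OF t0 z v hW] by simp
          also have "\<dots> \<le> (n / 2) * (N * norm ?h) / ?q"
          proof (rule divide_right_mono)
            have "- Dq t v z ?h \<le> N * norm ?h" using DN hW by (meson abs_le_D2)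
            from mult_left_mono[OF this, of "n / 2"] show "- (n / 2) * Dq t v z ?h \<le> (n / 2) * (N * norm ?h)" by simp
          qed (use qp in simp)
          finally have "(l * norm ?h) * norm ?h \<le> ((n / 2) * N / ?q) * norm ?h" by (simp add: power2_eq_square mult_ac)
          then have "l * norm ?h \<le> (n / 2) * N / ?q" using mult_right_le_imp_le hp by blast
          then show ?thesis using l(1) qp by (simp add: field_simps)
        qed (use N l in simp)
        have drift: "(2 / n) * ?q * (dM t z (e i) ?h (e i) - dM t z ?h (e i) (e i) / 2) \<le> 3 * B / (2 * l\<^sup>2) * N" if i: "i < p" for i
        proof -
          have "dM t z (e i) ?h (e i) \<le> B * norm (e i) * norm ?h * norm (e i)"
            using dMB[OF zc, of "e i" ?h "e i"] unfolding dmetric_W[OF t0 z hW] by simp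
          moreover have "- dM t z ?h (e i) (e i) \<le> B * norm ?h * norm (e i) * norm (e i)"
            using dMB[OF zc, of ?h "e i" "e i"] unfolding dmetric_W[OF t0 z eW[OF i]] by simp
          ultimately have "dM t z (e i) ?h (e i) - dM t z ?h (e i) (e i) / 2 \<le> 3 / 2 * (B * norm ?h) * (norm (e i))\<^sup>2"
            by (simp add: power2_eq_square algebra_simps)
          also have "\<dots> \<le> 3 / 2 * (B * norm ?h) * (1 / l)"
            by (rule mult_left_mono[OF norm_e[OF i]]) (use l in simp)
          finally have "(2 / n) * ?q * (dM t z (e i) ?h (e i) - dM t z ?h (e i) (e i) / 2) \<le> (2 / n) * ?q * (3 / 2 * (B * norm ?h) * (1 / l))"
            using qp by (intro mult_left_mono) auto
          also have "\<dots> = (3 * B / (n * l)) * (?q * norm ?h)" by (simp add: mult_ac)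
          also have "\<dots> \<le> (3 * B / (n * l)) * (n * N / (2 * l))"
            by (rule mult_left_mono[OF qh]) (use l in simp)
          also have "\<dots> = 3 * B / (2 * l\<^sup>2) * N" using n_pos by (simp add: power2_eq_square)
          finally show ?thesis .
        qed
        have "\<tau> = (\<Sum>i<p. D2q t v z (e i) - (Dq t v z (e i))\<^sup>2 / ?q + (2 / n) * ?q * (dM t z (e i) ?h (e i) - dM t z ?h (e i) (e i) / 2))"
          unfolding \<tau>_def div sum_distrib_left sum_distrib_right
        proof (rule sum.cong[OF refl])
          fix i
          have "- (2 / n) * (- (n / 2) * (a / ?q - b / ?q\<^sup>2) - c1 + c2 / 2) * ?q = a - b / ?q + (2 / n) * ?q * (c1 - c2 / 2)" for a b c1 c2
            using n_pos qp by (simp add: field_simps power2_eq_square)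
          then show "- (2 / n) * (- (n / 2) * (D2q t v z (e i) / ?q - (Dq t v z (e i))\<^sup>2 / ?q\<^sup>2)
              - dM t z (e i) ?h (e i) + dM t z ?h (e i) (e i) / 2) * ?q
            = D2q t v z (e i) - (Dq t v z (e i))\<^sup>2 / ?q + (2 / n) * ?q * (dM t z (e i) ?h (e i) - dM t z ?h (e i) (e i) / 2)" .
        qed
        also have "\<dots> \<le> (\<Sum>i<p. D2q t v z (e i) + 3 * B / (2 * l\<^sup>2) * N)"
        proof (rule sum_mono)
          fix i assume "i \<in> {..<p}"
          then have "(2 / n) * ?q * (dM t z (e i) ?h (e i) - dM t z ?h (e i) (e i) / 2) \<le> 3 * B / (2 * l\<^sup>2) * N" by (intro drift) simp
          moreover have "(Dq t v z (e i))\<^sup>2 / ?q \<ge> 0" using qp by simp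
          ultimately show "D2q t v z (e i) - (Dq t v z (e i))\<^sup>2 / ?q + (2 / n) * ?q * (dM t z (e i) ?h (e i) - dM t z ?h (e i) (e i) / 2)
            \<le> D2q t v z (e i) + 3 * B / (2 * l\<^sup>2) * N" by linarith
        qed
        also have "\<dots> = (\<Sum>i<p. D2q t v z (e i)) + real p * (3 * B / (2 * l\<^sup>2)) * N" by (simp add: sum.distrib)
        also have "\<dots> \<le> (\<Sum>i<p. D2q t v z (e i)) + C * N" using mult_right_mono[OF C(4) N] by simp
        finally show ?thesis .
      qed
    qed
    then show ?thesis using \<tau> by blast
  qed
  have "ball z0 r \<subseteq> \<Omega>" using r(2) ball_subset_cball by blast
  then show ?thesis using that[OF r(1) C(1)] main by blast
qed

end

section \<open>Plaques, leaves and fibers\<close>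

context atlas
begin

text \<open>Flat charts need not belong to the atlas, so the coordinate change between two of them is factored
  through the chart at \<open>x\<close>.\<close>

lemma smooth_charts_derivative:
  assumes c: "smooth_chart A c" "smooth_chart A c'" and x: "x \<in> fst c" "x \<in> fst c'"
  shows "((snd c' \<circ> cinv c) has_derivative (\<lambda>v. to_comp A c' x (of_comp A c x v))) (at (snd c x))"
proof -
  let ?d = "chart_at A x"
  note d = chart_at[of x]
  note ic = smooth_chart_is_chart[OF c(1)] smooth_chart_is_chart[OF c(2)] atlas_chart[OF d(1)]
  have 1: "((snd ?d \<circ> cinv c) has_derivative of_comp A c x) (at (snd c x))"
    unfolding of_comp_eq by (rule trans_has_derivative[OF ic(1,3) smooth_chart_compatible(1)[OF c(1) d(1)] x(1) d(2)])
  have 2: "((snd c' \<circ> cinv ?d) has_derivative to_comp A c' x) (at ((snd ?d \<circ> cinv c) (snd c x)))"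
    using trans_has_derivative[OF ic(3,2) smooth_chart_compatible(2)[OF c(2) d(1)] d(2) x(2)] ic x unfolding to_comp_eq by simp
  have "((snd c' \<circ> cinv ?d \<circ> (snd ?d \<circ> cinv c)) has_derivative (\<lambda>v. to_comp A c' x (of_comp A c x v))) (at (snd c x))"
    using diff_chain_at[OF 1 2] by (simp add: o_def)
  then show ?thesis
  proof (rule has_derivative_transform_within_open)
    show "open (snd c ` (fst c \<inter> fst c' \<inter> fst ?d))"
      unfolding Int_assoc by (rule is_chart_open_image[OF ic(1)]) (use ic in \<open>auto simp: is_chart_def\<close>)
    show "snd c x \<in> snd c ` (fst c \<inter> fst c' \<inter> fst ?d)" using x d by blast
    fix z assume "z \<in> snd c ` (fst c \<inter> fst c' \<inter> fst ?d)"
    then obtain a where "a \<in> fst c" "a \<in> fst c'" "a \<in> fst ?d" "z = snd c a" by blast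
    then show "(snd c' \<circ> cinv ?d \<circ> (snd ?d \<circ> cinv c)) z = (snd c' \<circ> cinv c) z" using ic by simp
  qed
qed

lemma flat_chart_restrict:
  assumes fc: "flat_chart A P c W" and S: "open S"
  shows "flat_chart A P (fst c \<inter> snd c -` S, snd c) W"
proof -
  let ?c = "(fst c \<inter> snd c -` S, snd c)"
  have c: "smooth_chart A c" and W: "subspace W" "\<forall>x\<in>fst c. to_comp A c x ` P x = W" using fc unfolding flat_chart_def by auto
  note ic = smooth_chart_is_chart[OF c]
  have o: "open (fst ?c)" using is_chart_open_preimage[OF ic S] by simp
  have im: "snd ?c ` fst ?c = snd c ` fst c \<inter> S" by auto
  have ic': "is_chart ?c"
  proof -
    obtain \<psi> where "homeomorphism (fst c) (snd c ` fst c) (snd c) \<psi>" using ic unfolding is_chart_def by blast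
    from homeomorphism_of_subsets[OF this, of "fst ?c" "snd ?c ` fst ?c" "snd ?c ` fst ?c"]
    have "homeomorphism (fst ?c) (snd ?c ` fst ?c) (snd ?c) \<psi>" by auto
    moreover have "open (snd ?c ` fst ?c)" unfolding im using ic S by (auto simp: is_chart_def)
    ultimately show ?thesis unfolding is_chart_def using o by blast
  qed
  have eq: "cinv ?c y = cinv c y" if "y \<in> snd ?c ` fst ?c" for y
    using that cinv_chart[OF ic'] cinv_chart[OF ic] by auto
  have "compatible ?c d" if d: "d \<in> A" for d
  proof -
    have cd: "compatible c d" by (rule smooth_chart_compatible(1)[OF c d])
    have 1: "smooth_on (snd c ` (fst c \<inter> fst d)) (snd d \<circ> cinv c)" "smooth_on (snd d ` (fst c \<inter> fst d)) (snd c \<circ> cinv d)"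
      using cd unfolding compatible_def by auto
    have "smooth_on (snd ?c ` (fst ?c \<inter> fst d)) (snd d \<circ> cinv c)" by (rule smooth_on_subset[OF 1(1)]) auto
    then have "smooth_on (snd ?c ` (fst ?c \<inter> fst d)) (snd d \<circ> cinv ?c)" by (rule smooth_on_eqI) (use eq in auto)
    moreover have "smooth_on (snd d ` (fst ?c \<inter> fst d)) (snd c \<circ> cinv d)" by (rule smooth_on_subset[OF 1(2)]) auto
    ultimately show ?thesis unfolding compatible_def by simp
  qed
  then have sc: "smooth_chart A ?c" unfolding smooth_chart_def using ic' by blast
  have "to_comp A ?c x = to_comp A c x" for x unfolding to_comp_def by simp
  then show ?thesis unfolding flat_chart_def using sc W by simp
qed

text \<open>Restricting a flat chart to a smaller domain gives a flat chart; so small plaques are open in the leaf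
  topology as well.\<close>

lemma openin_plaque:
  assumes fc: "flat_chart A P c W" and S: "open S"
  shows "openin (leaf_topology A P) {x \<in> fst c. snd c x \<in> S \<and> snd c x - a \<in> W}"
proof -
  have "{x \<in> fst c. snd c x \<in> S \<and> snd c x - a \<in> W} = {y \<in> fst (fst c \<inter> snd c -` S, snd c). snd (fst c \<inter> snd c -` S, snd c) y - a \<in> W}" by auto
  also have "openin (leaf_topology A P) \<dots>"
    unfolding leaf_topology_def by (rule topology_generated_by_Basis) (use flat_chart_restrict[OF fc S] in blast)
  finally show ?thesis .
qed

text \<open>The derivative of the path lies in \<open>P\<close>, so in any other flat chart the path stays, for a short time, in
  one plaque.\<close>

lemma plaque_path_continuous:
  assumes fc: "flat_chart A P c W" and seg: "\<And>s. s \<in> {0..1} \<Longrightarrow> y + s *\<^sub>R \<xi> \<in> snd c ` fst c" and \<xi>: "\<xi> \<in> W"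
  shows "continuous_map (top_of_set {0..1}) (leaf_topology A P) (\<lambda>s::real. cinv c (y + s *\<^sub>R \<xi>))"
proof -
  let ?\<gamma> = "\<lambda>s::real. cinv c (y + s *\<^sub>R \<xi>)"
  have c: "smooth_chart A c" and Wc: "\<And>x. x \<in> fst c \<Longrightarrow> to_comp A c x ` P x = W" using fc unfolding flat_chart_def by auto
  note ic = smooth_chart_is_chart[OF c]
  define I where "I = {s. y + s *\<^sub>R \<xi> \<in> snd c ` fst c}"
  have oI: "open I"
  proof -
    have "open ((\<lambda>s. y + s *\<^sub>R \<xi>) -` (snd c ` fst c))"
      by (rule open_vimage) (use ic in \<open>auto simp: is_chart_def intro!: continuous_intros\<close>)
    then show ?thesis unfolding I_def vimage_def .
  qed
  have cont: "continuous_on I ?\<gamma>"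
    by (rule continuous_on_compose2[OF is_chart_continuous_cinv[OF ic]]) (auto simp: I_def intro!: continuous_intros)
  have local: "\<exists>e>0. \<forall>s. dist s s0 < e \<longrightarrow> ?\<gamma> s \<in> fst c' \<and> snd c' (?\<gamma> s) - a \<in> W'"
    if fc': "flat_chart A P c' W'" and s0: "s0 \<in> I" "?\<gamma> s0 \<in> fst c'" "snd c' (?\<gamma> s0) - a \<in> W'" for c' W' a s0
  proof -
    have c': "smooth_chart A c'" and W': "subspace W'" and Wc': "\<And>x. x \<in> fst c' \<Longrightarrow> to_comp A c' x ` P x = W'"
      using fc' unfolding flat_chart_def by auto
    note ic' = smooth_chart_is_chart[OF c']
    have "open (I \<inter> ?\<gamma> -` fst c')"
      by (rule continuous_open_preimage[OF cont oI]) (use ic' in \<open>simp add: is_chart_def\<close>)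
    then obtain e where e: "e > 0" "ball s0 e \<subseteq> I \<inter> ?\<gamma> -` fst c'" using s0 openE by (metis IntI vimageI)
    have D: "((\<lambda>s. snd c' (?\<gamma> s)) has_derivative (\<lambda>h. h *\<^sub>R to_comp A c' (?\<gamma> s) (of_comp A c (?\<gamma> s) \<xi>))) (at s)"
      if "s \<in> ball s0 e" for s
    proof -
      have s: "y + s *\<^sub>R \<xi> \<in> snd c ` fst c" "?\<gamma> s \<in> fst c'" using that e unfolding I_def by auto
      note g = chart_cinv[OF s(1)]
      have 1: "((\<lambda>s. y + s *\<^sub>R \<xi>) has_derivative (\<lambda>h. h *\<^sub>R \<xi>)) (at s)" by (auto intro!: derivative_eq_intros)
      have 2: "((snd c' \<circ> cinv c) has_derivative (\<lambda>v. to_comp A c' (?\<gamma> s) (of_comp A c (?\<gamma> s) v))) (at (y + s *\<^sub>R \<xi>))"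
        using smooth_charts_derivative[OF c c' g(2) s(2)] unfolding g(1) .
      from has_derivative_compose[OF 1 2] show ?thesis
        using linear_cmul[OF linear_compose[OF linear_of_comp[OF c g(2)] linear_to_comp[OF c' s(2)]]] by (simp add: o_def)
    qed
    have dW: "to_comp A c' (?\<gamma> s) (of_comp A c (?\<gamma> s) \<xi>) \<in> W'" if "s \<in> ball s0 e" for s
    proof -
      have "y + s *\<^sub>R \<xi> \<in> snd c ` fst c" using that e(2) unfolding I_def by blast
      from chart_cinv(2)[OF this] have s: "?\<gamma> s \<in> fst c" "?\<gamma> s \<in> fst c'" using that e(2) by auto
      obtain u where u: "u \<in> P (?\<gamma> s)" "\<xi> = to_comp A c (?\<gamma> s) u" using Wc[OF s(1)] \<xi> by blast
      then have "of_comp A c (?\<gamma> s) \<xi> = u" using of_to_comp[OF c s(1)] by metis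
      then show ?thesis using Wc'[OF s(2)] u(1) by blast
    qed
    have "?\<gamma> s \<in> fst c' \<and> snd c' (?\<gamma> s) - a \<in> W'" if s: "dist s s0 < e" for s
    proof -
      have sb: "s \<in> ball s0 e" using s by (simp add: dist_commute)
      have "snd c' (?\<gamma> s) - snd c' (?\<gamma> s0) \<in> W'"
      proof (rule in_subspaceI[OF W'])
        fix w assume w: "\<And>y. y \<in> W' \<Longrightarrow> y \<bullet> w = 0"
        have "\<exists>k. \<forall>s\<in>ball s0 e. snd c' (?\<gamma> s) \<bullet> w = k"
        proof (rule has_field_derivative_zero_constant)
          fix s assume s: "s \<in> ball s0 e"
          have "((\<lambda>s. snd c' (?\<gamma> s) \<bullet> w) has_derivative (\<lambda>h. (h *\<^sub>R to_comp A c' (?\<gamma> s) (of_comp A c (?\<gamma> s) \<xi>)) \<bullet> w)) (at s)"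
            by (rule has_derivative_inner_left[OF D[OF s]])
          then have "((\<lambda>s. snd c' (?\<gamma> s) \<bullet> w) has_derivative (\<lambda>h. 0)) (at s)" using w[OF dW[OF s]] by simp
          then have "((\<lambda>s. snd c' (?\<gamma> s) \<bullet> w) has_field_derivative 0) (at s)"
            unfolding has_field_derivative_def by (rule has_derivative_eq_rhs) (simp add: fun_eq_iff)
          then show "((\<lambda>s. snd c' (?\<gamma> s) \<bullet> w) has_field_derivative 0) (at s within ball s0 e)"
            by (rule has_field_derivative_at_within)
        qed simp
        then show "(snd c' (?\<gamma> s) - snd c' (?\<gamma> s0)) \<bullet> w = 0" using sb e(1) by (auto simp: inner_diff_left)
      qed
      from subspace_add[OF W' this s0(3)] show ?thesis using sb e(2) by auto
    qed
    then show ?thesis using e(1) by blast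
  qed
  have I01: "{0..1} \<subseteq> I" using seg unfolding I_def by blast
  show ?thesis
    unfolding leaf_topology_def continuous_on_generated_topo_iff
  proof (intro conjI allI impI)
    fix U assume "U \<in> {{y \<in> fst c. snd c y - a \<in> W} |c W a. flat_chart A P c W}"
    then obtain c' W' a where U: "U = {y \<in> fst c'. snd c' y - a \<in> W'}" "flat_chart A P c' W'" by blast
    have "\<exists>e>0. \<forall>s\<in>{0..1}. dist s s0 < e \<longrightarrow> s \<in> ?\<gamma> -` U" if "s0 \<in> {0..1}" "s0 \<in> ?\<gamma> -` U" for s0
    proof -
      have "s0 \<in> I" "?\<gamma> s0 \<in> fst c'" "snd c' (?\<gamma> s0) - a \<in> W'" using that I01 unfolding U(1) by auto
      from local[OF U(2) this] obtain e where "e > 0"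
        and e: "\<forall>s. dist s s0 < e \<longrightarrow> ?\<gamma> s \<in> fst c' \<and> snd c' (?\<gamma> s) - a \<in> W'" by (elim exE conjE)
      show ?thesis by (rule exI[of _ e]) (use \<open>e > 0\<close> e in \<open>simp add: U(1)\<close>)
    qed
    then show "openin (top_of_set {0..1}) (?\<gamma> -` U \<inter> topspace (top_of_set {0..1}))"
      unfolding openin_euclidean_subtopology_iff by auto
  next
    show "?\<gamma> ` topspace (top_of_set {0..1}) \<subseteq> \<Union> {{y \<in> fst c. snd c y - a \<in> W} |c W a. flat_chart A P c W}"
    proof
      fix x assume "x \<in> ?\<gamma> ` topspace (top_of_set {0..1})"
      then obtain s where s: "s \<in> {0..1}" "x = ?\<gamma> s" by auto
      have "x \<in> fst c" unfolding s(2) by (rule chart_cinv(2)[OF seg[OF s(1)]])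
      moreover have "0 \<in> W" using fc subspace_0 unfolding flat_chart_def by blast
      ultimately have "x \<in> {y \<in> fst c. snd c y - snd c x \<in> W}" by simp
      then show "x \<in> \<Union> {{y \<in> fst c. snd c y - a \<in> W} |c W a. flat_chart A P c W}" using fc by blast
    qed
  qed
qed

end


locale fibered_foliation = orthogonal_foliation A g D P n p
  for A :: "('m::topological_space, 'e::euclidean_space) chart set" and g :: "('m, 'e) tensor2"
    and D P :: "'m \<Rightarrow> 'e set" and n p :: nat +
  fixes AB :: "('b::topological_space, 'k::euclidean_space) chart set"
    and AF :: "('f::topological_space, 'l::euclidean_space) chart set"
    and \<pi> :: "'m \<Rightarrow> 'b"
  assumes base_atlas: "smooth_atlas AB" and fiber_atlas: "smooth_atlas AF" and dim_base: "DIM('k) = n"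
    and fiber_bundle: "smooth_fiber_bundle A AB AF \<pi>"
    and leaves_fibers: "leaves A P = {\<pi> -` {b} | b. True}" and integrable: "integrable_dist A P"
begin

text \<open>The segment is a connected set in the leaf topology, so it lies in one leaf, which is a fiber.\<close>

lemma plaque_in_fiber:
  assumes fc: "flat_chart A P c W" and b: "ball y0 r \<subseteq> snd c ` fst c"
    and y: "y \<in> ball y0 r" "y' \<in> ball y0 r" "y' - y \<in> W"
  shows "\<pi> (cinv c y') = \<pi> (cinv c y)"
proof -
  let ?\<gamma> = "\<lambda>s::real. cinv c (y + s *\<^sub>R (y' - y))"
  have seg: "y + s *\<^sub>R (y' - y) \<in> snd c ` fst c" if "s \<in> {0..1}" for s
  proof -
    have "y + s *\<^sub>R (y' - y) = (1 - s) *\<^sub>R y + s *\<^sub>R y'" by (simp add: algebra_simps)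
    also have "\<dots> \<in> ball y0 r" using convexD_alt[OF convex_ball y(1,2)] that by simp
    finally show ?thesis using b by blast
  qed
  have "connectedin (top_of_set {0..1}) {0..1::real}" by (simp add: convex_connected)
  from connectedin_continuous_map_image[OF plaque_path_continuous[OF fc seg y(3)] this]
  have conn: "connectedin (leaf_topology A P) (?\<gamma> ` {0..1})" .
  have leaf: "\<pi> -` {\<pi> (cinv c y)} \<in> connected_components_of (leaf_topology A P)"
    using leaves_fibers unfolding leaves_def by blast
  have end0: "cinv c y \<in> ?\<gamma> ` {0..1}" by (rule image_eqI[of _ _ 0]) auto
  have end1: "cinv c y' \<in> ?\<gamma> ` {0..1}" by (rule image_eqI[of _ _ 1]) auto
  have "\<not> disjnt (\<pi> -` {\<pi> (cinv c y)}) (?\<gamma> ` {0..1})" using end0 unfolding disjnt_def by blast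
  from connected_components_of_maximal[OF leaf conn this] end1 show ?thesis by blast
qed

text \<open>The differential of the projection at \<open>x\<close>, with values expressed in a chart \<open>d\<close> of the base.\<close>

definition dproj :: "('b, 'k) chart \<Rightarrow> 'm \<Rightarrow> 'e \<Rightarrow> 'k" where
  "dproj d x = frechet_derivative (snd d \<circ> \<pi> \<circ> cinv (chart_at A x)) (at (pos A x))"

lemma continuous_proj: "continuous_on UNIV \<pi>"
  using fiber_bundle unfolding smooth_fiber_bundle_def smooth_map_def by blast

lemma base_chart: "d \<in> AB \<Longrightarrow> is_chart d" using base_atlas unfolding smooth_atlas_def by blast

lemma open_proj_preimage: "open S \<Longrightarrow> open (\<pi> -` S)"
  by (rule open_vimage[OF _ continuous_proj])

lemma dproj_has_derivative:
  assumes d: "d \<in> AB" and c: "smooth_chart A c" and x: "x \<in> fst c" "\<pi> x \<in> fst d"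
  shows "((snd d \<circ> \<pi> \<circ> cinv c) has_derivative (\<lambda>v. dproj d x (of_comp A c x v))) (at (snd c x))"
proof -
  let ?a = "chart_at A x"
  note a = chart_at[of x]
  note ic = smooth_chart_is_chart[OF c] atlas_chart[OF a(1)]
  have od: "open (fst d)" using base_chart[OF d] unfolding is_chart_def by blast
  let ?S = "snd ?a ` (fst ?a \<inter> UNIV \<inter> \<pi> -` fst d)"
  have oS: "open ?S" unfolding Int_assoc by (rule is_chart_open_image[OF ic(2)]) (use open_proj_preimage[OF od] in simp)
  have sm: "smooth_on ?S (snd d \<circ> \<pi> \<circ> cinv ?a)"
    using fiber_bundle d a(1) unfolding smooth_fiber_bundle_def smooth_map_def by blast
  have xS: "snd ?a x \<in> ?S" using x a by blast
  have 1: "((snd d \<circ> \<pi> \<circ> cinv ?a) has_derivative dproj d x) (at (snd ?a x))"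
    using smooth_on_has_derivative[OF oS sm xS] unfolding dproj_def pos_def .
  have 2: "((snd ?a \<circ> cinv c) has_derivative of_comp A c x) (at (snd c x))"
    unfolding of_comp_eq by (rule trans_has_derivative[OF ic smooth_chart_compatible(1)[OF c a(1)] x(1) a(2)])
  have "((snd d \<circ> \<pi> \<circ> cinv ?a \<circ> (snd ?a \<circ> cinv c)) has_derivative (\<lambda>v. dproj d x (of_comp A c x v))) (at (snd c x))"
    using diff_chain_at[OF 2, of "snd d \<circ> \<pi> \<circ> cinv ?a" "dproj d x"] 1 ic x by (simp add: o_def)
  then show ?thesis
  proof (rule has_derivative_transform_within_open)
    show "open (snd c ` (fst c \<inter> fst ?a))" by (rule trans_open[OF ic])
    show "snd c x \<in> snd c ` (fst c \<inter> fst ?a)" using x a by blast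
    fix z assume "z \<in> snd c ` (fst c \<inter> fst ?a)"
    then obtain b where "b \<in> fst c" "b \<in> fst ?a" "z = snd c b" by blast
    then show "(snd d \<circ> \<pi> \<circ> cinv ?a \<circ> (snd ?a \<circ> cinv c)) z = (snd d \<circ> \<pi> \<circ> cinv c) z" using ic by simp
  qed
qed

lemma linear_dproj:
  assumes d: "d \<in> AB" and x: "\<pi> x \<in> fst d" shows "linear (dproj d x)"
  using has_derivative_linear[OF dproj_has_derivative[OF d atlas_smooth_chart[OF chart_at(1)] chart_at(2) x]]
  by (simp add: of_comp_self)

text \<open>In a flat chart the projection is invariant under small translations by vectors of \<open>W\<close>, and so is its
  differential.\<close>

lemma dproj_plaque:
  assumes d: "d \<in> AB" and fc: "flat_chart A P c W" and r: "ball y0 r \<subseteq> snd c ` fst c"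
    and x: "x \<in> fst c" "\<pi> x \<in> fst d" "snd c x = y0"
    and x': "x' \<in> fst c" "snd c x' \<in> ball y0 r" "snd c x' - y0 \<in> W"
  shows "\<pi> x' = \<pi> x" "dproj d x' (of_comp A c x' v) = dproj d x (of_comp A c x v)"
proof -
  have c: "smooth_chart A c" using fc unfolding flat_chart_def by blast
  note ic = smooth_chart_is_chart[OF c]
  have rp: "r > 0" using x'(2) by (auto intro: le_less_trans[OF zero_le_dist])
  show pe: "\<pi> x' = \<pi> x"
    using plaque_in_fiber[OF fc r _ x'(2), of y0] x x' rp ic by auto
  let ?w = "snd c x' - y0" and ?h = "snd d \<circ> \<pi> \<circ> cinv c"
  let ?N = "ball y0 r \<inter> (\<lambda>y. y + ?w) -` ball y0 r"
  have oN: "open ?N" by (intro open_Int open_ball open_vimage continuous_intros)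
  have D: "(?h has_derivative (\<lambda>v. dproj d x (of_comp A c x v))) (at y0)"
    using dproj_has_derivative[OF d c x(1,2)] unfolding x(3) .
  have "(?h has_derivative (\<lambda>v. dproj d x' (of_comp A c x' v))) (at (y0 + ?w))"
    using dproj_has_derivative[OF d c x'(1)] pe x(2) by simp
  then have h': "(?h has_derivative (\<lambda>v. dproj d x' (of_comp A c x' v))) (at (y0 + ?w))" .
  have "((\<lambda>y. y + ?w) has_derivative (\<lambda>v. v)) (at y0)" by (auto intro!: derivative_eq_intros)
  from has_derivative_compose[OF this h']
  have "((\<lambda>y. ?h (y + ?w)) has_derivative (\<lambda>v. dproj d x' (of_comp A c x' v))) (at y0)" .
  then have D': "(?h has_derivative (\<lambda>v. dproj d x' (of_comp A c x' v))) (at y0)"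
  proof (rule has_derivative_transform_within_open[OF _ oN])
    show "y0 \<in> ?N" using x'(2) rp by simp
    show "?h (y + ?w) = ?h y" if "y \<in> ?N" for y
      using plaque_in_fiber[OF fc r, of y "y + ?w"] that x'(3) by simp
  qed
  from fun_cong[OF has_derivative_unique[OF D' D]]
  show "dproj d x' (of_comp A c x' v) = dproj d x (of_comp A c x v)" .
qed

end

section \<open>Horizontal lifts\<close>

context fibered_foliation
begin

lemma dproj_perp:
  assumes d: "d \<in> AB" and x: "\<pi> x \<in> fst d" and u: "u \<in> P x"
  shows "dproj d x u = 0"
proof -
  obtain c W where fc: "flat_chart A P c W" and xc: "x \<in> fst c" using integrable unfolding integrable_dist_def by blast
  have c: "smooth_chart A c" and Wc: "to_comp A c x ` P x = W" using fc xc unfolding flat_chart_def by auto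
  note ic = smooth_chart_is_chart[OF c]
  define \<xi> where "\<xi> = to_comp A c x u"
  have \<xi>: "\<xi> \<in> W" "of_comp A c x \<xi> = u" using Wc u c xc unfolding \<xi>_def by auto
  let ?y = "snd c x" and ?h = "snd d \<circ> \<pi> \<circ> cinv c"
  have "open (snd c ` fst c)" "?y \<in> snd c ` fst c" using ic xc unfolding is_chart_def by auto
  then obtain r where r: "r > 0" "ball ?y r \<subseteq> snd c ` fst c" using openE by blast
  have "((\<lambda>s::real. ?y + s *\<^sub>R \<xi>) has_derivative (\<lambda>s. s *\<^sub>R \<xi>)) (at 0)" by (auto intro!: derivative_eq_intros)
  from has_derivative_compose[OF this, of ?h] dproj_has_derivative[OF d c xc x]
  have 1: "((\<lambda>s. ?h (?y + s *\<^sub>R \<xi>)) has_derivative (\<lambda>s. dproj d x (of_comp A c x (s *\<^sub>R \<xi>)))) (at 0)" by simp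
  have 2: "((\<lambda>s. ?h (?y + s *\<^sub>R \<xi>)) has_derivative (\<lambda>s. 0)) (at 0)"
  proof (rule has_derivative_transform_within_open[OF has_derivative_const])
    show "open {s::real. ?y + s *\<^sub>R \<xi> \<in> ball ?y r}"
      using open_vimage[OF open_ball[of ?y r], of "\<lambda>s. ?y + s *\<^sub>R \<xi>"] by (simp add: vimage_def continuous_intros)
    show "0 \<in> {s::real. ?y + s *\<^sub>R \<xi> \<in> ball ?y r}" using r by simp
    fix s :: real assume "s \<in> {s. ?y + s *\<^sub>R \<xi> \<in> ball ?y r}"
    then have s: "?y + s *\<^sub>R \<xi> \<in> ball ?y r" by simp
    have "subspace W" using fc unfolding flat_chart_def by blast
    then have "(?y + s *\<^sub>R \<xi>) - ?y \<in> W" using subspace_scale[OF _ \<xi>(1)] by simp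
    from plaque_in_fiber[OF fc r(2) _ s this] r(1)
    show "?h ?y = ?h (?y + s *\<^sub>R \<xi>)" by simp
  qed
  from fun_cong[OF has_derivative_unique[OF 1 2], of 1] show ?thesis using \<xi>(2) by simp
qed

text \<open>Through every point passes a local section of the bundle: keep the fiber coordinate of a local
  trivialisation constant.\<close>

lemma dproj_surj:
  assumes d: "d \<in> AB" and x: "\<pi> x \<in> fst d"
  shows "\<exists>v. dproj d x v = w"
proof -
  obtain U \<Psi> where U: "open U" "\<pi> x \<in> U" and bij: "bij_betw \<Psi> (\<pi> -` U) (U \<times> UNIV)"
    and fst\<Psi>: "\<forall>x\<in>\<pi> -` U. fst (\<Psi> x) = \<pi> x"
    and sm: "smooth_map (prod_atlas AB AF) A (U \<times> UNIV) (inv_into (\<pi> -` U) \<Psi>)"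
    using fiber_bundle unfolding smooth_fiber_bundle_def by metis
  define \<Phi> where "\<Phi> = inv_into (\<pi> -` U) \<Psi>"
  have \<pi>\<Phi>: "\<pi> (\<Phi> (b, f)) = b" if "b \<in> U" for b f
  proof -
    have in_im: "(b, f) \<in> \<Psi> ` (\<pi> -` U)" using bij that unfolding bij_betw_def by auto
    have "\<Psi> (\<Phi> (b, f)) = (b, f)" "\<Phi> (b, f) \<in> \<pi> -` U"
      unfolding \<Phi>_def by (rule f_inv_into_f[OF in_im], rule inv_into_into[OF in_im])
    then show ?thesis using fst\<Psi> by (metis fst_conv)
  qed
  define f where "f = snd (\<Psi> x)"
  have xU: "x \<in> \<pi> -` U" using U by simp
  have "\<Psi> x = (\<pi> x, f)" using fst\<Psi> xU unfolding f_def by (metis prod.collapse)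
  then have \<Phi>x: "\<Phi> (\<pi> x, f) = x" unfolding \<Phi>_def using inv_into_f_f[OF bij_betw_imp_inj_on[OF bij] xU] by simp
  obtain e where e: "e \<in> AF" "f \<in> fst e" using fiber_atlas unfolding smooth_atlas_def by blast
  let ?a = "chart_at A x" and ?b = "(fst d \<times> fst e, map_prod (snd d) (snd e))"
  note a = chart_at[of x]
  have id: "is_chart d" by (rule base_chart[OF d])
  have ie: "is_chart e" using fiber_atlas e(1) unfolding smooth_atlas_def by blast
  have ia: "is_chart ?a" by (rule atlas_chart[OF a(1)])
  have pb: "?b \<in> prod_atlas AB AF" unfolding prod_atlas_def using d e(1) by blast
  let ?S = "snd ?b ` (fst ?b \<inter> (U \<times> UNIV) \<inter> \<Phi> -` fst ?a)" and ?F = "snd ?a \<circ> \<Phi> \<circ> cinv ?b"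
  have smF: "smooth_on ?S ?F" and cont\<Phi>: "continuous_on (U \<times> UNIV) \<Phi>"
    using sm pb a(1) unfolding smooth_map_def \<Phi>_def by blast+
  have cinvb: "cinv ?b (snd d b', snd e f) = (b', f)" if "b' \<in> fst d" for b'
  proof -
    have "inj_on (map_prod (snd d) (snd e)) (fst d \<times> fst e)"
      by (rule map_prod_inj_on[OF is_chart_inj[OF id] is_chart_inj[OF ie]])
    then have "inv_into (fst d \<times> fst e) (map_prod (snd d) (snd e)) (map_prod (snd d) (snd e) (b', f)) = (b', f)"
      by (rule inv_into_f_f) (use that e(2) in simp)
    then show ?thesis unfolding cinv_def by simp
  qed
  define N where "N = U \<inter> (\<lambda>b. \<Phi> (b, f)) -` fst ?a"
  have oN: "open N"
    unfolding N_def
  proof (rule continuous_open_preimage[OF _ U(1)])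
    show "continuous_on U (\<lambda>b. \<Phi> (b, f))"
      by (rule continuous_on_compose2[OF cont\<Phi>]) (auto intro!: continuous_intros)
    show "open (fst ?a)" using ia unfolding is_chart_def by blast
  qed
  have inS: "(snd d b', snd e f) \<in> ?S" if "b' \<in> fst d" "b' \<in> N" for b'
    by (rule image_eqI[of _ _ "(b', f)"]) (use that e(2) in \<open>auto simp: N_def\<close>)
  have xN: "\<pi> x \<in> N" using U(2) \<Phi>x a(2) unfolding N_def by simp
  let ?k0 = "snd d (\<pi> x)"
  \<comment> \<open>The domain of \<open>?F\<close> is just some set; smoothness supplies a differentiable extension \<open>F\<close>.\<close>
  from smooth_onE[OF smF inS[OF x xN]] obtain V F where V: "open V" "(?k0, snd e f) \<in> V"
    "\<forall>vs. \<forall>y\<in>V. iter_dderiv vs F differentiable (at y)" "\<forall>y\<in>?S \<inter> V. F y = ?F y" .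
  have "F differentiable (at (?k0, snd e f))" using V(3)[rule_format, of "(?k0, snd e f)" "[]"] V(2) by simp
  then obtain F' where F': "(F has_derivative F') (at (?k0, snd e f))" unfolding differentiable_def by blast
  have "((\<lambda>k. (k, snd e f)) has_derivative (\<lambda>h. (h, 0))) (at ?k0)" by (auto intro!: derivative_eq_intros)
  from has_derivative_compose[OF this F'] have \<sigma>': "((\<lambda>k. F (k, snd e f)) has_derivative (\<lambda>h. F' (h, 0))) (at ?k0)" .
  have F0: "F (?k0, snd e f) = snd ?a x"
    using V(4) V(2) inS[OF x xN] cinvb[OF x] \<Phi>x by simp
  let ?h = "snd d \<circ> \<pi> \<circ> cinv ?a"
  have "(?h has_derivative dproj d x) (at (F (?k0, snd e f)))"
    using dproj_has_derivative[OF d atlas_smooth_chart[OF a(1)] a(2) x] unfolding F0 by (simp add: of_comp_self)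
  from has_derivative_compose[OF \<sigma>' this]
  have 1: "((\<lambda>k. ?h (F (k, snd e f))) has_derivative (\<lambda>h. dproj d x (F' (h, 0)))) (at ?k0)" .
  have 2: "((\<lambda>k. ?h (F (k, snd e f))) has_derivative (\<lambda>h. h)) (at ?k0)"
  proof (rule has_derivative_transform_within_open[OF has_derivative_ident])
    show "open (snd d ` (fst d \<inter> N) \<inter> (\<lambda>k. (k, snd e f)) -` V)"
      by (intro open_Int is_chart_open_image[OF id oN] open_vimage V continuous_intros)
    show "?k0 \<in> snd d ` (fst d \<inter> N) \<inter> (\<lambda>k. (k, snd e f)) -` V" using V(2) x xN by simp
    fix k assume k: "k \<in> snd d ` (fst d \<inter> N) \<inter> (\<lambda>k. (k, snd e f)) -` V"
    then obtain b' where b': "b' \<in> fst d" "b' \<in> N" "k = snd d b'" by blast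
    have "F (k, snd e f) = snd ?a (\<Phi> (b', f))"
      using V(4) k inS[OF b'(1,2)] cinvb[OF b'(1)] unfolding b'(3) by simp
    moreover have "\<Phi> (b', f) \<in> fst ?a" "b' \<in> U" using b'(2) unfolding N_def by auto
    ultimately show "k = ?h (F (k, snd e f))" using ia \<pi>\<Phi> b'(3) by simp
  qed
  from fun_cong[OF has_derivative_unique[OF 1 2], of w] show ?thesis by blast
qed

text \<open>The differential of the projection maps \<open>D x\<close> onto a space of the same dimension,
  hence isomorphically.\<close>

lemma dproj_kernel:
  assumes d: "d \<in> AB" and x: "\<pi> x \<in> fst d" and u: "dproj d x u = 0"
  shows "u \<in> P x"
proof -
  note l = linear_dproj[OF d x]
  have hor: "dproj d x (v - perp_part D P x v) = dproj d x v" for v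
    using dproj_perp[OF d x perp_part(1)] linear_diff[OF l] by simp
  obtain j where j: "linear j" "j ` (UNIV :: 'k set) = D x" "inj_on j UNIV"
    using subspace_isomorphism[OF subspace_UNIV subspace_D, where 'a='k] dim_base by (metis dim_D dim_UNIV)
  have lj: "linear (dproj d x \<circ> j)" by (rule linear_compose[OF j(1) l])
  have "w \<in> range (dproj d x \<circ> j)" for w
  proof -
    obtain v where v: "dproj d x v = w" using dproj_surj[OF d x] by blast
    obtain k where "v - perp_part D P x v = j k" using perp_part(2)[of v x] j(2) by blast
    then have "(dproj d x \<circ> j) k = w" using hor[of v] v by simp
    then show ?thesis by blast
  qed
  then have "surj (dproj d x \<circ> j)" by blast
  then have inj: "inj (dproj d x \<circ> j)" by (rule linear_surjective_imp_injective[OF lj]) (rule refl)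
  obtain k where k: "u - perp_part D P x u = j k" using perp_part(2)[of u x] j(2) by blast
  then have "(dproj d x \<circ> j) k = (dproj d x \<circ> j) 0" using hor[of u] u linear_0[OF lj] by simp
  then have "k = 0" using inj by (simp only: inj_eq)
  then have "u = perp_part D P x u" using k linear_0[OF j(1)] by simp
  then show ?thesis using perp_part(1) by metis
qed

definition lift :: "('b, 'k) chart \<Rightarrow> 'k \<Rightarrow> 'm \<Rightarrow> 'e" where
  "lift d w x = (SOME h. h \<in> D x \<and> dproj d x h = w)"

lemma lift:
  assumes d: "d \<in> AB" and x: "\<pi> x \<in> fst d"
  shows lift_D: "lift d w x \<in> D x" and dproj_lift: "dproj d x (lift d w x) = w"
proof -
  obtain v where v: "dproj d x v = w" using dproj_surj[OF d x] by blast
  have "dproj d x (v - perp_part D P x v) = w"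
    using v dproj_perp[OF d x perp_part(1)] linear_diff[OF linear_dproj[OF d x]] by simp
  then have "\<exists>h. h \<in> D x \<and> dproj d x h = w" using perp_part(2) by blast
  from someI_ex[OF this] show "lift d w x \<in> D x" "dproj d x (lift d w x) = w" unfolding lift_def by auto
qed

lemma lift_eq: 
  assumes d: "d \<in> AB" and x: "\<pi> x \<in> fst d" and u: "u \<in> D x" shows "lift d (dproj d x u) x = u"
proof -
  have "dproj d x (lift d (dproj d x u) x - u) = 0"
    using dproj_lift[OF d x] linear_diff[OF linear_dproj[OF d x]] by simp
  then have "lift d (dproj d x u) x - u \<in> P x" by (rule dproj_kernel[OF d x])
  moreover have "lift d (dproj d x u) x - u \<in> D x" by (rule subspace_diff[OF subspace_D lift_D[OF d x] u])
  ultimately have "lift d (dproj d x u) x - u = 0" by (intro D_Int_P)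
  then show ?thesis by simp
qed

text \<open>Along a plaque the differential of the projection is constant in the flat chart, so the constant
  vector which starts as a horizontal lift keeps projecting to \<open>w\<close>. Hence \<open>hor\<close>, for which the evolution
  was analysed, agrees with a lift defined on the whole leaf.\<close>

lemma lift_plaque:
  assumes d: "d \<in> AB" and fc: "flat_chart A P c W" and r: "ball y0 r \<subseteq> snd c ` fst c"
    and x: "x \<in> fst c" "\<pi> x \<in> fst d" "snd c x = y0"
    and x': "x' \<in> fst c" "snd c x' \<in> ball y0 r" "snd c x' - y0 \<in> W"
  shows "hor A D P c (to_comp A c x (lift d w x)) (snd c x') = to_comp A c x' (lift d w x')"
proof -
  interpret flat_foliation A g D P n p c W using fc by unfold_locales
  let ?v = "to_comp A c x (lift d w x)"
  have x'd: "\<pi> x' \<in> fst d" using dproj_plaque(1)[OF d fc r x x'] x(2) by simp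
  have "dproj d x' (of_comp A c x' ?v) = dproj d x (of_comp A c x ?v)" by (rule dproj_plaque(2)[OF d fc r x x'])
  also have "\<dots> = w" using dproj_lift[OF d x(2)] sc x(1) by simp
  finally have "dproj d x' (of_comp A c x' ?v - lift d w x') = 0"
    using dproj_lift[OF d x'd] linear_diff[OF linear_dproj[OF d x'd]] by simp
  then have "of_comp A c x' ?v - lift d w x' \<in> P x'" by (rule dproj_kernel[OF d x'd])
  then have "to_comp A c x' (of_comp A c x' ?v - lift d w x') \<in> W" using to_comp_in_W[OF x'(1)] by blast
  then have "?v - to_comp A c x' (lift d w x') \<in> W" using sc x'(1) by (simp add: linear_diff[OF lT[OF x'(1)]])
  from V_eq_if[OF x'(1) lift_D[OF d x'd] this] show ?thesis .
qed

end

section \<open>Convergence to the limit metric\<close>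

lemma uniform_limit_sum_finite:
  fixes f :: "'i \<Rightarrow> 't \<Rightarrow> 'a \<Rightarrow> 'b::real_normed_vector"
  assumes "finite I" "\<And>i. i \<in> I \<Longrightarrow> uniform_limit S (f i) (l i) F"
  shows "uniform_limit S (\<lambda>t y. \<Sum>i\<in>I. f i t y) (\<lambda>y. \<Sum>i\<in>I. l i y) F"
  using assms by (induction rule: finite_induct) (simp_all add: uniform_limit_const uniform_limit_add)

locale fibered_umbilical_flow = umbilical_flow A D P n p gt
  for A :: "('m::topological_space, 'e::euclidean_space) chart set"
    and D P :: "'m \<Rightarrow> 'e set" and n p :: nat and gt :: "real \<Rightarrow> ('m, 'e) tensor2" +
  fixes AB :: "('b::topological_space, 'k::euclidean_space) chart set"
    and AF :: "('f::topological_space, 'l::euclidean_space) chart set"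
    and \<pi> :: "'m \<Rightarrow> 'b" and ginf :: "('m, 'e) tensor2"
  assumes base_atlas: "smooth_atlas AB" and fiber_atlas: "smooth_atlas AF" and dim_base: "DIM('k) = n"
    and fiber_bundle: "smooth_fiber_bundle A AB AF \<pi>"
    and leaves_fibers: "leaves A P = {\<pi> -` {b} | b. True}" and integrable: "integrable_dist A P"
    and compact_leaves: "\<And>L. L \<in> leaves A P \<Longrightarrow> compactin (leaf_topology A P) L"
    and limit_metric: "riemannian_metric A ginf" and converges: "Cinf_converges A gt ginf"
begin

lemma metric_tendsto: "((\<lambda>t. gt t x u v) \<longlongrightarrow> ginf x u v) at_top"
proof -
  interpret g0: orthogonal_foliation A "gt 0" D P n p by (rule orthogonal_foliation_at) simp
  let ?c = "chart_at A x"
  have K: "compact {snd ?c x}" "{snd ?c x} \<subseteq> snd ?c ` fst ?c" using g0.chart_at by auto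
  have "uniform_limit {snd ?c x} (\<lambda>t. iter_dderiv [] (\<lambda>y. metric_rep A ?c (gt t) y u v)) (iter_dderiv [] (\<lambda>y. metric_rep A ?c ginf y u v)) at_top"
    using converges g0.chart_at(1) K unfolding Cinf_converges_def by blast
  then have "((\<lambda>t. metric_rep A ?c (gt t) (snd ?c x) u v) \<longlongrightarrow> metric_rep A ?c ginf (snd ?c x) u v) at_top"
    by (intro tendsto_uniform_limitI[where S="{snd ?c x}"]) auto
  then show ?thesis by (simp add: g0.metric_rep_at g0.chart_at g0.of_comp_self)
qed

lemma limit_orthogonal: "orthogonal_dists ginf D P"
  unfolding orthogonal_dists_def
proof (intro allI ballI)
  fix x u v assume "u \<in> D x" "v \<in> P x"
  then have "gt t x u v = 0" if "t \<ge> 0" for t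
    using evolution that unfolding evolution_solution_def orthogonal_dists_def by blast
  then have "((\<lambda>t. gt t x u v) \<longlongrightarrow> 0) at_top"
    by (intro tendsto_eventually eventually_mono[OF eventually_ge_at_top[of 0]])
  then show "ginf x u v = 0" using tendsto_unique[OF _ metric_tendsto] by fastforce
qed

sublocale fib: fibered_foliation A "gt 0" D P n p AB AF \<pi>
  unfolding fibered_foliation_def fibered_foliation_axioms_def
  using orthogonal_foliation_at[of 0] base_atlas fiber_atlas dim_base fiber_bundle leaves_fibers integrable by simp

sublocale inf: orthogonal_foliation A ginf D P n p
  using smooth_atlas distribution_D distribution_P complementary limit_metric limit_orthogonal by unfold_locales

text \<open>Convergence and joint continuity are given in the charts of the atlas only. This formula transports
  them to a flat chart \<open>c\<close>.\<close>

lemma metric_in_chart: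
  assumes c: "smooth_chart A c" and e: "e \<in> A" and x: "x \<in> fst c" "x \<in> fst e"
    and bil: "\<And>y. y \<in> snd e ` fst e \<Longrightarrow> bilinear (metric_rep A e h y)"
  defines "k \<equiv> snd e \<circ> cinv c"
  shows "metric_rep A c h (snd c x) u u =
     (\<Sum>i\<in>Basis. \<Sum>j\<in>Basis. (frechet_derivative k (at (snd c x)) u \<bullet> i) * (frechet_derivative k (at (snd c x)) u \<bullet> j) * metric_rep A e h (k (snd c x)) i j)"
proof -
  have kx: "k (snd c x) = snd e x" unfolding k_def using x fib.smooth_chart_is_chart[OF c] by simp
  have "bilinear (metric_rep A e h (snd e x))" by (rule bil) (use x in blast)
  from bilinear_basis_sum[OF this, of "trans_deriv c e x u" "trans_deriv c e x u"] show ?thesis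
    unfolding fib.metric_rep_change[OF c e x] kx trans_deriv_def k_def[symmetric]
    by (simp only: real_scaleR_def mult.assoc)
qed

context
  fixes c :: "('m, 'e) chart" and e :: "('m, 'e) chart" and S :: "'e set" and U :: "'e \<Rightarrow> 'e"
  assumes c: "smooth_chart A c" and e: "e \<in> A" and S: "S \<subseteq> snd c ` (fst c \<inter> fst e)" and U: "continuous_on S U"
begin

lemma transition_continuous:
  defines "k \<equiv> snd e \<circ> cinv c"
  shows "continuous_on S k" "k ` S \<subseteq> snd e ` fst e" "continuous_on S (\<lambda>y. frechet_derivative k (at y) (U y))"
proof -
  note ic = fib.smooth_chart_is_chart[OF c] fib.atlas_chart[OF e]
  let ?V = "snd c ` (fst c \<inter> fst e)"
  have oV: "open ?V" by (rule trans_open[OF ic])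
  have k: "smooth_on ?V k" unfolding k_def by (rule trans_smooth_on[OF fib.smooth_chart_compatible(1)[OF c e]])
  show "continuous_on S k" by (rule continuous_on_subset[OF smooth_on_imp_continuous_on[OF k] S])
  show "k ` S \<subseteq> snd e ` fst e" using S ic unfolding k_def by auto
  have cD: "continuous_on S (\<lambda>y. frechet_derivative k (at y) i)" for i
    by (rule continuous_on_subset[OF smooth_on_imp_continuous_on[OF smooth_on_deriv[OF oV k]] S])
  have "continuous_on S (\<lambda>y. \<Sum>i\<in>Basis. (U y \<bullet> i) *\<^sub>R frechet_derivative k (at y) i)"
    by (intro continuous_on_sum continuous_on_scaleR continuous_on_inner continuous_on_const U cD)
  then show "continuous_on S (\<lambda>y. frechet_derivative k (at y) (U y))"
  proof (rule continuous_on_eq)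
    fix y assume "y \<in> S"
    then have "linear (frechet_derivative k (at y))"
      using smooth_on_has_derivative[OF oV k] S has_derivative_linear by blast
    then show "(\<Sum>i\<in>Basis. (U y \<bullet> i) *\<^sub>R frechet_derivative k (at y) i) = frechet_derivative k (at y) (U y)"
      by (rule linear_basis_sum[symmetric])
  qed
qed

lemma bilinear_gt: "t \<ge> 0 \<Longrightarrow> y \<in> snd e ` fst e \<Longrightarrow> bilinear (metric_rep A e (gt t) y)"
proof -
  assume t: "t \<ge> 0" and y: "y \<in> snd e ` fst e"
  interpret orthogonal_foliation A "gt t" D P n p by (rule orthogonal_foliation_at[OF t])
  show ?thesis by (rule bilinear_metric_rep[OF fib.atlas_smooth_chart[OF e] y])
qed

lemma metric_family_continuous:
  "continuous_on ({0..} \<times> S) (\<lambda>(t, y). metric_rep A c (gt t) y (U y) (U y))"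
proof -
  define k where "k = snd e \<circ> cinv c"
  note tc = transition_continuous[folded k_def]
  define Y where "Y y = frechet_derivative k (at y) (U y)" for y
  have cM: "continuous_on ({0..} \<times> snd e ` fst e) (\<lambda>(t, y). metric_rep A e (gt t) y i j)" for i j
    using evolution e unfolding evolution_solution_def smooth_metric_family_def
    by (intro smooth_on_imp_continuous_on) blast
  have "continuous_on ({0..} \<times> S) (\<lambda>x. (fst x, k (snd x)))"
    by (intro continuous_intros continuous_on_compose2[OF tc(1)]) auto
  then have 1: "continuous_on ({0..} \<times> S) (\<lambda>x. metric_rep A e (gt (fst x)) (k (snd x)) i j)" for i j
    using continuous_on_compose2[OF cM[of i j], of "{0..} \<times> S" "\<lambda>x. (fst x, k (snd x))"] tc(2) by force
  have 2: "continuous_on ({0..} \<times> S) (\<lambda>x. Y (snd x))"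
    unfolding Y_def by (rule continuous_on_compose2[OF tc(3)]) (auto intro: continuous_intros)
  have "continuous_on ({0..} \<times> S) (\<lambda>x. \<Sum>i\<in>Basis. \<Sum>j\<in>Basis. (Y (snd x) \<bullet> i) * (Y (snd x) \<bullet> j) * metric_rep A e (gt (fst x)) (k (snd x)) i j)"
    by (intro continuous_on_sum continuous_on_mult continuous_on_inner continuous_on_const 1 2)
  then show ?thesis
  proof (rule continuous_on_eq)
    fix x :: "real \<times> 'e" assume "x \<in> {0..} \<times> S"
    then obtain t y where ty: "x = (t, y)" "t \<ge> 0" "y \<in> S" by auto
    then obtain a where a: "a \<in> fst c" "a \<in> fst e" "y = snd c a" using S by blast
    show "(\<Sum>i\<in>Basis. \<Sum>j\<in>Basis. (Y (snd x) \<bullet> i) * (Y (snd x) \<bullet> j) * metric_rep A e (gt (fst x)) (k (snd x)) i j)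
       = (case x of (t, y) \<Rightarrow> metric_rep A c (gt t) y (U y) (U y))"
      unfolding ty(1) Y_def using metric_in_chart[OF c e a(1,2) bilinear_gt[OF ty(2)], of "U y"] unfolding k_def a(3) by simp
  qed
qed

lemma metric_family_uniform_limit:
  assumes K: "compact S"
  shows "uniform_limit S (\<lambda>t y. metric_rep A c (gt t) y (U y) (U y)) (\<lambda>y. metric_rep A c ginf y (U y) (U y)) at_top"
proof -
  define k where "k = snd e \<circ> cinv c"
  note tc = transition_continuous[folded k_def]
  define Y where "Y y = frechet_derivative k (at y) (U y)" for y
  have Kk: "compact (k ` S)" by (rule compact_continuous_image[OF tc(1) K])
  have lim: "uniform_limit S (\<lambda>t y. metric_rep A e (gt t) (k y) i j) (\<lambda>y. metric_rep A e ginf (k y) i j) at_top" for i j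
  proof -
    have "uniform_limit (k ` S) (\<lambda>t. iter_dderiv [] (\<lambda>y. metric_rep A e (gt t) y i j)) (iter_dderiv [] (\<lambda>y. metric_rep A e ginf y i j)) at_top"
      using converges e Kk tc(2) unfolding Cinf_converges_def by blast
    then show ?thesis unfolding uniform_limit_iff by simp
  qed
  have cont_inf: "continuous_on S (\<lambda>y. metric_rep A e ginf (k y) i j)" for i j
    by (rule continuous_on_compose2[OF smooth_on_imp_continuous_on[OF inf.smooth_on_metric_rep[OF fib.atlas_smooth_chart[OF e]]] tc(1,2)])
  have cY: "continuous_on S Y" unfolding Y_def by (rule tc(3))
  have uY: "uniform_limit S (\<lambda>t y. \<Sum>i\<in>Basis. \<Sum>j\<in>Basis. (Y y \<bullet> i) * (Y y \<bullet> j) * metric_rep A e (gt t) (k y) i j)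
     (\<lambda>y. \<Sum>i\<in>Basis. \<Sum>j\<in>Basis. (Y y \<bullet> i) * (Y y \<bullet> j) * metric_rep A e ginf (k y) i j) at_top"
    by (intro uniform_limit_sum_finite finite_Basis uniform_lim_mult uniform_limit_const lim compact_imp_bounded compact_continuous_image K cont_inf continuous_intros cY)
  have ev: "\<forall>\<^sub>F t in at_top. \<forall>y\<in>S. (\<Sum>i\<in>Basis. \<Sum>j\<in>Basis. (Y y \<bullet> i) * (Y y \<bullet> j) * metric_rep A e (gt t) (k y) i j) = metric_rep A c (gt t) y (U y) (U y)"
      using eventually_ge_at_top[of 0]
    proof eventually_elim
      case (elim t)
      show ?case
      proof
        fix y assume "y \<in> S"
        then obtain a where a: "a \<in> fst c" "a \<in> fst e" "y = snd c a" using S by blast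
        show "(\<Sum>i\<in>Basis. \<Sum>j\<in>Basis. (Y y \<bullet> i) * (Y y \<bullet> j) * metric_rep A e (gt t) (k y) i j) = metric_rep A c (gt t) y (U y) (U y)"
          unfolding Y_def using metric_in_chart[OF c e a(1,2) bilinear_gt[OF elim], of "U y"] unfolding k_def a(3) by simp
      qed
    qed
  have eq: "(\<Sum>i\<in>Basis. \<Sum>j\<in>Basis. (Y y \<bullet> i) * (Y y \<bullet> j) * metric_rep A e ginf (k y) i j) = metric_rep A c ginf y (U y) (U y)"
    if y: "y \<in> S" for y
  proof -
    obtain a where a: "a \<in> fst c" "a \<in> fst e" "y = snd c a" using S y by blast
    show "(\<Sum>i\<in>Basis. \<Sum>j\<in>Basis. (Y y \<bullet> i) * (Y y \<bullet> j) * metric_rep A e ginf (k y) i j) = metric_rep A c ginf y (U y) (U y)"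
      unfolding Y_def using metric_in_chart[OF c e a(1,2) inf.bilinear_metric_rep[OF fib.atlas_smooth_chart[OF e]], of "U y"] unfolding k_def a(3) by simp
  qed
  from iffD1[OF uniform_limit_cong[OF ev eq] uY] show ?thesis .
qed

end

end

section \<open>The limit metric\<close>

context fibered_umbilical_flow
begin

text \<open>The squared length, in the limit metric, of the horizontal lift of \<open>w\<close>: a function on the whole fiber
  over \<open>b\<close>, where \<open>w\<close> is a tangent vector at \<open>b\<close> in the chart \<open>d\<close>.\<close>

definition limit_length :: "('b, 'k) chart \<Rightarrow> 'k \<Rightarrow> 'm \<Rightarrow> real" where
  "limit_length d w x = ginf x (fib.lift d w x) (fib.lift d w x)"

text \<open>In a flat chart the horizontal lift is the \<open>D\<close>-component of a constant vector, so its squared length is a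
  limit of the functions \<open>q t\<close>, and the strong maximum principle applies to it.\<close>

lemma limit_length_local:
  assumes d: "d \<in> AB" and x0: "\<pi> x0 \<in> fst d" and w: "w \<noteq> 0"
  obtains c W r h where "flat_chart A P c W" "x0 \<in> fst c" "r > 0" "ball (snd c x0) r \<subseteq> snd c ` fst c" "continuous_on (ball (snd c x0) r) h"
    "\<forall>x\<in>fst c. snd c x \<in> ball (snd c x0) r \<and> snd c x - snd c x0 \<in> W \<longrightarrow> \<pi> x = \<pi> x0 \<and> limit_length d w x = h (snd c x)"
    "(\<forall>y\<in>ball (snd c x0) r. y - snd c x0 \<in> W \<longrightarrow> h y \<le> h (snd c x0)) \<longrightarrow>
      (\<forall>y\<in>ball (snd c x0) (r / 2). y - snd c x0 \<in> W \<longrightarrow> h y = h (snd c x0))"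
proof -
  obtain c W where fc: "flat_chart A P c W" and x0c: "x0 \<in> fst c" using integrable unfolding integrable_dist_def by blast
  interpret flow: flat_umbilical_flow A D P n p gt c W using fc by unfold_locales
  interpret lim: flat_foliation A ginf D P n p c W using fc by unfold_locales
  let ?y = "snd c x0" and ?e = "chart_at A x0"
  let ?v = "to_comp A c x0 (fib.lift d w x0)"
  have yO: "?y \<in> snd c ` fst c" using x0c by blast
  have lift0: "fib.lift d w x0 \<noteq> 0"
    using fib.dproj_lift[OF d x0, of w] linear_0[OF fib.linear_dproj[OF d x0]] w by auto
  have v: "?v \<notin> W"
    using fib.D_Int_P[OF fib.lift_D[OF d x0]] lift0 lim.to_comp_in_W[OF x0c] by blast
  obtain r1 C where r1: "r1 > 0" and C: "C > 0" and r1O: "ball ?y r1 \<subseteq> snd c ` fst c"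
    and sub: "\<forall>t>0. \<forall>z\<in>ball ?y r1. \<exists>\<tau> e. ((\<lambda>s. flow.q s ?v z) has_real_derivative \<tau>) (at t) \<and> subsolution_frame p W C (flow.q t ?v) z \<tau> e"
    using flow.q_subsolution[OF yO v] .
  have oV: "open (snd c ` (fst c \<inter> fst ?e))" by (rule trans_open[OF lim.ic]) simp
  have "?y \<in> snd c ` (fst c \<inter> fst ?e)" using x0c fib.chart_at(2) by blast
  then obtain r2 where r2: "r2 > 0" "ball ?y r2 \<subseteq> snd c ` (fst c \<inter> fst ?e)" using oV openE by blast
  define r where "r = min r1 r2"
  have r: "r > 0" "ball ?y r \<subseteq> ball ?y r1" "ball ?y r \<subseteq> ball ?y r2" using r1 r2 unfolding r_def by auto
  have rO: "ball ?y r \<subseteq> snd c ` fst c" using r(2) r1O by blast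
  have rV: "ball ?y r \<subseteq> snd c ` (fst c \<inter> fst ?e)" using r(3) r2(2) by blast
  define h where "h = lim.Q ?v"
  have h: "h y = metric_rep A c ginf y (hor A D P c ?v y) (hor A D P c ?v y)" for y
    unfolding h_def by (rule lim.Q_def)
  have conth: "continuous_on (ball ?y r) h"
    unfolding h_def by (rule continuous_on_subset[OF smooth_on_imp_continuous_on[OF lim.smooth_Q] rO])
  have contV: "continuous_on S (hor A D P c ?v)" if "S \<subseteq> ball ?y r" for S
    by (rule continuous_on_subset[OF smooth_on_imp_continuous_on[OF lim.smooth_V]]) (use that rO in blast)
  have loc: "\<pi> x = \<pi> x0 \<and> limit_length d w x = h (snd c x)"
    if x: "x \<in> fst c" "snd c x \<in> ball ?y r" "snd c x - ?y \<in> W" for x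
  proof
    show "\<pi> x = \<pi> x0" by (rule fib.dproj_plaque(1)[OF d fc rO x0c x0 refl x])
    show "limit_length d w x = h (snd c x)"
      unfolding h fib.lift_plaque[OF d fc rO x0c x0 refl x] lim.M_T[OF x(1)] limit_length_def ..
  qed
  have max: "h y = h ?y"
    if m: "\<forall>y\<in>ball ?y r. y - ?y \<in> W \<longrightarrow> h y \<le> h ?y" and y: "y \<in> ball ?y (r / 2)" "y - ?y \<in> W" for y
  proof (rule limit_strong_maximum_principle[where q="\<lambda>t. flow.q t ?v" and W=W and C=C and r=r and p=p])
    show "smooth_on (ball ?y r) (flow.q t ?v)" if "t \<ge> 0" for t
      by (rule smooth_on_subset[OF flow.smooth_q[OF that] rO])
    show "continuous_on ({0..} \<times> ball ?y r) (\<lambda>(t, y). flow.q t ?v y)"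
      unfolding flow.q_def by (rule metric_family_continuous[OF lim.sc fib.chart_at(1) rV contV[OF order_refl]])
    show "uniform_limit K (\<lambda>t. flow.q t ?v) h at_top" if K: "compact K" "K \<subseteq> ball ?y r" for K
      unfolding flow.q_def h[abs_def]
      by (rule metric_family_uniform_limit[OF lim.sc fib.chart_at(1) _ contV[OF K(2)] K(1)]) (use K(2) rV in blast)
    show "\<exists>\<tau> e. ((\<lambda>s. flow.q s ?v y) has_real_derivative \<tau>) (at t) \<and> subsolution_frame p W C (flow.q t ?v) y \<tau> e"
      if "t > 0" "y \<in> ball ?y r" for t y using sub that r(2) by blast
    show "h y \<le> h ?y" if "y \<in> ball ?y r" "y - ?y \<in> W" for y using m that by blast
  qed (use C r y in auto)
  show ?thesis
  proof (rule that[OF fc x0c r(1) rO conth])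
    show "\<forall>x\<in>fst c. snd c x \<in> ball ?y r \<and> snd c x - ?y \<in> W \<longrightarrow> \<pi> x = \<pi> x0 \<and> limit_length d w x = h (snd c x)"
      using loc by blast
    show "(\<forall>y\<in>ball ?y r. y - ?y \<in> W \<longrightarrow> h y \<le> h ?y) \<longrightarrow> (\<forall>y\<in>ball ?y (r / 2). y - ?y \<in> W \<longrightarrow> h y = h ?y)"
      using max by blast
  qed
qed

text \<open>The maximum over the compact leaf is attained. The set of maxima is closed, and open by the strong
  maximum principle, hence it is the whole leaf, which is connected. Compactness, openness and connectedness
  refer to the leaf topology.\<close>

lemma limit_length_constant:
  assumes d: "d \<in> AB" and b: "b \<in> fst d" and w: "w \<noteq> 0" and x: "\<pi> x = b" "\<pi> x' = b"
  shows "limit_length d w x = limit_length d w x'"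
proof -
  let ?X = "leaf_topology A P" and ?L = "\<pi> -` {b}"
  let ?Y = "subtopology ?X ?L" and ?f = "limit_length d w"
  have leaf: "?L \<in> leaves A P" using leaves_fibers by blast
  have conn: "connectedin ?X ?L" using leaf unfolding leaves_def by (rule connectedin_connected_components_of)
  have comp: "compactin ?X ?L" by (rule compact_leaves[OF leaf])
  have top: "topspace ?Y = ?L" using connectedin_subset_topspace[OF conn] by (simp add: Int_absorb1)
  have base: "\<pi> x0 \<in> fst d" if "\<pi> x0 = b" for x0 using b that by simp
  have plaque: "openin ?Y {x \<in> fst c. snd c x \<in> ball (snd c x0) s \<and> snd c x - snd c x0 \<in> W}"
    if fc: "flat_chart A P c W" and sr: "s \<le> r" and x0: "\<pi> x0 = b"
      and h: "\<forall>x\<in>fst c. snd c x \<in> ball (snd c x0) r \<and> snd c x - snd c x0 \<in> W \<longrightarrow> \<pi> x = \<pi> x0 \<and> ?f x = h (snd c x)" for c W x0 s r h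
  proof -
    let ?N = "{x \<in> fst c. snd c x \<in> ball (snd c x0) s \<and> snd c x - snd c x0 \<in> W}"
    have "?N \<subseteq> ?L"
    proof
      fix x assume x: "x \<in> ?N"
      then have "snd c x \<in> ball (snd c x0) r" using sr by simp
      then have "\<pi> x = \<pi> x0" using h[rule_format, of x] x by simp
      then show "x \<in> ?L" using x0 by simp
    qed
    then have "?L \<inter> ?N = ?N" by (rule Int_absorb1)
    with openin_subtopology_Int2[OF fib.openin_plaque[OF fc open_ball, of "snd c x0" s "snd c x0"], of ?L]
    show ?thesis by simp
  qed
  have cont: "continuous_map ?Y euclideanreal ?f"
    unfolding continuous_map_def
  proof (intro conjI allI impI)
    show "?f \<in> topspace ?Y \<rightarrow> topspace euclideanreal" by simp
    fix U :: "real set" assume "openin euclideanreal U"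
    then have U: "open U" by simp
    show "openin ?Y {x \<in> topspace ?Y. ?f x \<in> U}"
      unfolding top
    proof (subst openin_subopen, intro ballI)
      fix x0 assume "x0 \<in> {x \<in> ?L. ?f x \<in> U}"
      then have x0: "\<pi> x0 = b" "?f x0 \<in> U" by auto
      obtain c W r h where c: "flat_chart A P c W" "x0 \<in> fst c" "r > 0"
        and h: "continuous_on (ball (snd c x0) r) h"
          "\<forall>x\<in>fst c. snd c x \<in> ball (snd c x0) r \<and> snd c x - snd c x0 \<in> W \<longrightarrow> \<pi> x = \<pi> x0 \<and> ?f x = h (snd c x)"
        by (rule limit_length_local[OF d base[OF x0(1)] w])
      have W0: "0 \<in> W" using c(1) subspace_0 unfolding flat_chart_def by blast
      have fx: "?f x0 = h (snd c x0)" using h(2) c W0 by simp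
      have "open (ball (snd c x0) r \<inter> h -` U)" by (rule continuous_open_preimage[OF h(1) open_ball U])
      moreover have "snd c x0 \<in> ball (snd c x0) r \<inter> h -` U" using c(3) x0(2) fx by simp
      ultimately obtain s where s: "s > 0" "ball (snd c x0) s \<subseteq> ball (snd c x0) r \<inter> h -` U" using openE by blast
      define s' where "s' = min s r"
      have s': "s' > 0" "s' \<le> r" "s' \<le> s" using s(1) c(3) unfolding s'_def by auto
      let ?N = "{x \<in> fst c. snd c x \<in> ball (snd c x0) s' \<and> snd c x - snd c x0 \<in> W}"
      have "openin ?Y ?N" by (rule plaque[OF c(1) s'(2) x0(1) h(2)])
      moreover have "x0 \<in> ?N" using c(2) s'(1) W0 by simp
      moreover have "?N \<subseteq> {x \<in> ?L. ?f x \<in> U}"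
      proof
        fix x assume x: "x \<in> ?N"
        then have "snd c x \<in> ball (snd c x0) s" using s'(3) by auto
        then have "snd c x \<in> ball (snd c x0) r" "h (snd c x) \<in> U" using s(2) by blast+
        then show "x \<in> {x \<in> ?L. ?f x \<in> U}" using h(2) x x0(1) by auto
      qed
      ultimately show "\<exists>T. openin ?Y T \<and> x0 \<in> T \<and> T \<subseteq> {x \<in> ?L. ?f x \<in> U}" by blast
    qed
  qed
  have "compactin ?Y ?L" using comp by (simp add: compactin_subtopology)
  from image_compactin[OF this cont] have "compact (?f ` ?L)" by simp
  moreover have "?f ` ?L \<noteq> {}" using x by blast
  ultimately obtain s where "s \<in> ?f ` ?L" "\<forall>t\<in>?f ` ?L. t \<le> s" using compact_attains_sup by blast
  then obtain m where m: "\<pi> m = b" "\<And>x. \<pi> x = b \<Longrightarrow> ?f x \<le> ?f m" by auto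
  let ?S = "{x \<in> topspace ?Y. ?f x \<in> {?f m}}"
  have "closedin ?Y ?S" by (rule closedin_continuous_map_preimage[OF cont]) simp
  moreover have "openin ?Y ?S"
    unfolding top
  proof (subst openin_subopen, intro ballI)
    fix x0 assume "x0 \<in> {x \<in> ?L. ?f x \<in> {?f m}}"
    then have x0: "\<pi> x0 = b" "?f x0 = ?f m" by auto
    obtain c W r h where c: "flat_chart A P c W" "x0 \<in> fst c" "r > 0" "ball (snd c x0) r \<subseteq> snd c ` fst c"
      and h: "\<forall>x\<in>fst c. snd c x \<in> ball (snd c x0) r \<and> snd c x - snd c x0 \<in> W \<longrightarrow> \<pi> x = \<pi> x0 \<and> ?f x = h (snd c x)"
      and max: "(\<forall>y\<in>ball (snd c x0) r. y - snd c x0 \<in> W \<longrightarrow> h y \<le> h (snd c x0)) \<longrightarrow>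
      (\<forall>y\<in>ball (snd c x0) (r / 2). y - snd c x0 \<in> W \<longrightarrow> h y = h (snd c x0))"
      by (rule limit_length_local[OF d base[OF x0(1)] w])
    have W0: "0 \<in> W" using c(1) subspace_0 unfolding flat_chart_def by blast
    have fx: "?f x0 = h (snd c x0)" using h c W0 by simp
    have "h y \<le> h (snd c x0)" if y: "y \<in> ball (snd c x0) r" "y - snd c x0 \<in> W" for y
    proof -
      obtain a where a: "a \<in> fst c" "y = snd c a" using c(4) y(1) by blast
      have "\<pi> a = b" "?f a = h y" using h a y x0(1) by auto
      then show ?thesis using m(2)[of a] x0(2) fx by simp
    qed
    then have eq: "h y = h (snd c x0)" if "y \<in> ball (snd c x0) (r / 2)" "y - snd c x0 \<in> W" for y
      using max that by blast
    let ?N = "{x \<in> fst c. snd c x \<in> ball (snd c x0) (r / 2) \<and> snd c x - snd c x0 \<in> W}"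
    have "openin ?Y ?N" by (rule plaque[OF c(1) _ x0(1) h]) (use c(3) in simp)
    moreover have "x0 \<in> ?N" using c(2,3) W0 by simp
    moreover have "?N \<subseteq> {x \<in> ?L. ?f x \<in> {?f m}}"
    proof
      fix x assume x: "x \<in> ?N"
      then have "snd c x \<in> ball (snd c x0) r" using c(3) by auto
      then have "\<pi> x = \<pi> x0" "?f x = h (snd c x)" using h x by auto
      then show "x \<in> {x \<in> ?L. ?f x \<in> {?f m}}" using eq[of "snd c x"] x x0 fx by auto
    qed
    ultimately show "\<exists>T. openin ?Y T \<and> x0 \<in> T \<and> T \<subseteq> {x \<in> ?L. ?f x \<in> {?f m}}" by blast
  qed
  moreover have "connected_space ?Y" using conn by (rule connected_space_subtopology)
  moreover have "m \<in> ?S" unfolding top using m(1) by simp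
  ultimately have "?S = topspace ?Y" unfolding connected_space_clopen_in by blast
  then have S: "{x \<in> ?L. ?f x \<in> {?f m}} = ?L" unfolding top .
  have "?f a = ?f m" if "\<pi> a = b" for a
  proof -
    have "a \<in> {x \<in> ?L. ?f x \<in> {?f m}}" unfolding S using that by simp
    then show ?thesis by simp
  qed
  then show ?thesis using x by simp
qed

text \<open>Every vector of \<open>D x\<close> is a horizontal lift, so its squared length is constant along the plaque.\<close>

lemma limit_dmetric_zero:
  assumes fc: "flat_chart A P c W" and x: "x \<in> fst c" and u: "u \<in> D x" and \<xi>: "\<xi> \<in> W"
  shows "inf.dmetric c (snd c x) \<xi> (to_comp A c x u) (to_comp A c x u) = 0"
proof (cases "u = 0")
  case True
  interpret lim: flat_foliation A ginf D P n p c W using fc by unfold_locales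
  show ?thesis using True linear_0[OF lim.lT[OF x]] linear_0[OF inf.linear_dmetric2[OF lim.sc]] x by simp
next
  case False
  interpret lim: flat_foliation A ginf D P n p c W using fc by unfold_locales
  obtain d where d: "d \<in> AB" "\<pi> x \<in> fst d" using base_atlas unfolding smooth_atlas_def by blast
  let ?w = "fib.dproj d x u" and ?v = "to_comp A c x u"
  have lift: "fib.lift d ?w x = u" by (rule fib.lift_eq[OF d u])
  have w: "?w \<noteq> 0"
  proof
    assume "?w = 0"
    then have "u \<in> P x" by (rule fib.dproj_kernel[OF d])
    then show False using fib.D_Int_P[OF u] False by simp
  qed
  have z: "snd c x \<in> snd c ` fst c" using x by blast
  obtain r where r: "r > 0" "ball (snd c x) r \<subseteq> snd c ` fst c" using lim.open_\<Omega> z openE by blast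
  have const: "lim.Q ?v (snd c x + s *\<^sub>R \<xi>) = lim.Q ?v (snd c x)" if s: "snd c x + s *\<^sub>R \<xi> \<in> ball (snd c x) r" for s
  proof -
    obtain a where a: "a \<in> fst c" "snd c x + s *\<^sub>R \<xi> = snd c a" using r(2) s by blast
    have aW: "snd c a - snd c x \<in> W" using subspace_scale[OF lim.subspace_W \<xi>, of s] unfolding a(2)[symmetric] by simp
    have ab: "snd c a \<in> ball (snd c x) r" using s unfolding a(2) .
    have Q: "lim.Q ?v (snd c a) = limit_length d ?w a" if "a \<in> fst c" "snd c a \<in> ball (snd c x) r" "snd c a - snd c x \<in> W" for a
      using fib.lift_plaque[OF d(1) fc r(2) x d(2) refl that, of ?w] lim.M_T[OF that(1)]
      unfolding lift lim.Q_def limit_length_def by simp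
    have pa: "\<pi> a = \<pi> x" by (rule fib.dproj_plaque(1)[OF d(1) fc r(2) x d(2) refl a(1) ab aW])
    have "lim.Q ?v (snd c a) = limit_length d ?w a" by (rule Q[OF a(1) ab aW])
    also have "\<dots> = limit_length d ?w x" by (rule limit_length_constant[OF d w pa refl])
    also have "\<dots> = lim.Q ?v (snd c x)"
      by (rule Q[OF x, symmetric]) (use r(1) subspace_0[OF lim.subspace_W] in simp_all)
    finally show ?thesis unfolding a(2) .
  qed
  have "DERIV (\<lambda>s. lim.Q ?v (snd c x + s *\<^sub>R \<xi>)) 0 :> frechet_derivative (lim.Q ?v) (at (snd c x + 0 *\<^sub>R \<xi>)) \<xi>"
    by (rule DERIV_along_line[OF lim.open_\<Omega> lim.smooth_Q]) (use z in simp)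
  then have 1: "((\<lambda>s. lim.Q ?v (snd c x + s *\<^sub>R \<xi>)) has_derivative (\<lambda>h. frechet_derivative (lim.Q ?v) (at (snd c x)) \<xi> * h)) (at 0)"
    unfolding has_field_derivative_def by simp
  have 2: "((\<lambda>s. lim.Q ?v (snd c x + s *\<^sub>R \<xi>)) has_derivative (\<lambda>h. 0)) (at 0)"
  proof (rule has_derivative_transform_within_open[OF has_derivative_const])
    show "open {s::real. snd c x + s *\<^sub>R \<xi> \<in> ball (snd c x) r}"
      using open_vimage[OF open_ball[of "snd c x" r], of "\<lambda>s. snd c x + s *\<^sub>R \<xi>"] by (simp add: vimage_def continuous_intros)
    show "0 \<in> {s::real. snd c x + s *\<^sub>R \<xi> \<in> ball (snd c x) r}" using r by simp
    show "lim.Q ?v (snd c x) = lim.Q ?v (snd c x + s *\<^sub>R \<xi>)" if "s \<in> {s. snd c x + s *\<^sub>R \<xi> \<in> ball (snd c x) r}" for s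
      using const that by simp
  qed
  from fun_cong[OF has_derivative_unique[OF 1 2], of 1]
  have "frechet_derivative (lim.Q ?v) (at (snd c x)) \<xi> = 0" by simp
  then show ?thesis unfolding lim.Q_derivative[OF z] lim.V_of_D[OF x u] .
qed

text \<open>By polarisation, the derivative of the metric along the leaves vanishes on \<open>D\<close>, and this is the
  second fundamental tensor.\<close>

theorem limit_totally_geodesic: "totally_geodesic A D P ginf"
  unfolding totally_geodesic_def
proof (intro allI impI ballI)
  fix U X Y x
  assume "open U \<and> smooth_section A D U X \<and> smooth_section A D U Y" and x: "x \<in> U"
  then have U: "open U" and X: "smooth_section A D U X" and Y: "smooth_section A D U Y" by auto
  obtain c W where fc: "flat_chart A P c W" and xc: "x \<in> fst c" using integrable unfolding integrable_dist_def by blast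
  interpret lim: flat_foliation A ginf D P n p c W using fc by unfold_locales
  have z: "snd c x \<in> snd c ` fst c" using xc by blast
  have XY: "X x \<in> D x" "Y x \<in> D x" using X Y x unfolding smooth_section_def by auto
  show "second_fund A D P ginf X Y x = 0"
  proof (rule inf.perp_part_eqI)
    show "second_fund A D P ginf X Y x \<in> P x" by (rule inf.second_fund_in_P)
    show "0 \<in> P x" by (rule subspace_0[OF inf.subspace_P])
    fix \<xi> assume \<xi>: "\<xi> \<in> P x"
    let ?T = "to_comp A c x" and ?d = "inf.dmetric c (snd c x) (to_comp A c x \<xi>)"
    have \<xi>W: "?T \<xi> \<in> W" using lim.to_comp_in_W[OF xc] \<xi> by blast
    note zero = limit_dmetric_zero[OF fc xc _ \<xi>W]
    have "?d (?T (X x + Y x)) (?T (X x + Y x)) = 0" by (rule zero[OF subspace_add[OF inf.subspace_D XY]])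
    then have "?d (?T (X x)) (?T (X x)) + ?d (?T (X x)) (?T (Y x)) + (?d (?T (Y x)) (?T (X x)) + ?d (?T (Y x)) (?T (Y x))) = 0"
      unfolding linear_add[OF lim.lT[OF xc]] linear_add[OF inf.linear_dmetric2[OF lim.sc z]] linear_add[OF inf.linear_dmetric3[OF lim.sc z]]
      by (simp add: add_ac)
    then have "?d (?T (X x)) (?T (Y x)) = 0"
      using zero[OF XY(1)] zero[OF XY(2)] inf.dmetric_sym[of c "snd c x" "?T \<xi>" "?T (Y x)" "?T (X x)"] by simp
    then have "ginf x (second_fund A D P ginf X Y x) \<xi> = 0"
      using inf.second_fund_flat[OF fc xc x U X Y \<xi>] by simp
    also have "0 = ginf x 0 \<xi>" using linear_0[OF inf.linear_g(2)] by simp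
    finally show "ginf x (second_fund A D P ginf X Y x) \<xi> = ginf x 0 \<xi>" .
  qed
qed

end

text \<open>The evolution equation contains the factor \<open>2 / n\<close>, so the case \<open>n = 0\<close> is treated apart; then all
  sections of \<open>D\<close> vanish.\<close>

lemma totally_geodesic_of_dim_0:
  assumes "smooth_atlas A" "riemannian_metric A g" "distribution A D 0" "distribution A P p" "complementary D P"
    "integrable_dist A P"
  shows "totally_geodesic A D P g"
proof -
  have D0: "u = 0" if "u \<in> D x" for u x using that assms(3) dim_eq_0[of "D x"] unfolding distribution_def by auto
  have "g x 0 v = 0" for x v using assms(2) bilinear_lzero unfolding riemannian_metric_def by blast
  then have "orthogonal_dists g D P" unfolding orthogonal_dists_def using D0 by metis
  then interpret orthogonal_foliation A g D P 0 p using assms by unfold_locales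
  show ?thesis
    unfolding totally_geodesic_def
  proof (intro allI impI ballI)
    fix U X Y x
    assume "open U \<and> smooth_section A D U X \<and> smooth_section A D U Y" and x: "x \<in> U"
    then have U: "open U" and X: "smooth_section A D U X" and Y: "smooth_section A D U Y" by auto
    obtain c W where fc: "flat_chart A P c W" and xc: "x \<in> fst c" using assms(6) unfolding integrable_dist_def by blast
    have sc: "smooth_chart A c" using fc unfolding flat_chart_def by blast
    have z: "snd c x \<in> snd c ` fst c" using xc by blast
    have X0: "X x = 0" using X x D0 unfolding smooth_section_def by blast
    show "second_fund A D P g X Y x = 0"
    proof (rule perp_part_eqI)
      show "second_fund A D P g X Y x \<in> P x" by (rule second_fund_in_P)
      show "0 \<in> P x" by (rule subspace_0[OF subspace_P])
      fix \<xi> assume \<xi>: "\<xi> \<in> P x"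
      have "g x (second_fund A D P g X Y x) \<xi> = 0"
        using second_fund_flat[OF fc xc x U X Y \<xi>] linear_0[OF linear_to_comp[OF sc xc]] linear_0[OF linear_dmetric2[OF sc z]]
        unfolding X0 by simp
      also have "0 = g x 0 \<xi>" using linear_0[OF linear_g(2)] by simp
      finally show "g x (second_fund A D P g X Y x) \<xi> = g x 0 \<xi>" .
    qed
  qed
qed


section \<open>The theorem\<close>

theorem corollary1:
  fixes A :: "('m::{t2_space, second_countable_topology}, 'e::euclidean_space) chart set"
    and AB :: "('b::{t2_space, second_countable_topology}, 'k::euclidean_space) chart set"
    and AF :: "('f::{t2_space, second_countable_topology}, 'l::euclidean_space) chart set"
    and \<pi> :: "'m \<Rightarrow> 'b"
    and D Dperp :: "'m \<Rightarrow> 'e set"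
    and n p :: nat
    and g ginf :: "('m, 'e) tensor2"
    and gt :: "real \<Rightarrow> ('m, 'e) tensor2"
  assumes "smooth_atlas A" and "compact (UNIV :: 'm set)" and "connected (UNIV :: 'm set)"
    and "riemannian_metric A g"
    and "distribution A D n" and "distribution A Dperp p"
    and "complementary D Dperp" and "orthogonal_dists g D Dperp"
    and "integrable_dist A Dperp"
    and "\<forall>L\<in>leaves A Dperp. compactin (leaf_topology A Dperp) L \<and> orientable_leaf A Dperp p L"
    and "smooth_atlas AB" and "smooth_atlas AF" and "DIM('k) = n" and "DIM('l) = p"
    and "smooth_fiber_bundle A AB AF \<pi>"
    and "leaves A Dperp = {\<pi> -` {b} | b. True}"
    and "p > 1 \<longrightarrow> leafwise_closed A Dperp (dual_form g (mean_curvature A D Dperp g))"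
    and "umbilical A D Dperp g"
    and "evolution_solution A D Dperp n gt" and "gt 0 = g"
    and "riemannian_metric A ginf" and "Cinf_converges A gt ginf"
  shows "totally_geodesic A D Dperp ginf"
proof (cases "n = 0")
  case True
  then show ?thesis using assms by (intro totally_geodesic_of_dim_0) simp_all
next
  case False
  interpret fibered_umbilical_flow A D Dperp n p gt AB AF \<pi> ginf
    using assms False by unfold_locales auto
  show ?thesis by (rule limit_totally_geodesic)
qed

end
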